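(* Let $\Omega\subset\mathbb{R}^d$ be any bounded set with $\mathcal{L}^d(\Omega)>0$, and let $\mathbf{Q}$ be a measure on $\mathcal{X}$ satisfying (M1)–(M4), with $0\le\alpha=\alpha(\mathbf{Q})<d$. Let $A$ and $\mu_\infty$ be the associated Poissonian cutout set and limit measure. Then almost surely $\dim_B(A)\le d-\alpha$ (i.e. the upper box-counting dimension of $A$ is at most $d-\alpha$). Moreover, $\mu_\infty\neq0$ with positive probability and, almost surely conditioned on $\mu_\infty\neq0$: (1) $\dim_{\rm loc}(\mu_\infty,x)=d-\alpha$ for $\mu_\infty$-almost all $x\in A$, and (2) $\dim_H(A)=\dim_B(A)=d-\alpha$.
   Context: $\mathcal{X}$ is the family of compact subsets of $\mathbb{R}^d$ with the Hausdorff metric and its Borel $\sigma$-algebra. $\mathbf{Q}$ is an (infinite, $\sigma$-finite) Borel measure on $\mathcal{X}$ such that for all Borel $\mathcal{A}\subset\mathcal{X}$: (M1) $\mathbf{Q}(\mathcal{A})=\mathbf{Q}(\{\Lambda+t:\Lambda\in\mathcal{A}\})$ for all $t$; (M2) $\mathbf{Q}(\mathcal{A})=\mathbf{Q}(\{s\Lambda:\Lambda\in\mathcal{A}\})$ for all $s>0$; (M3) the $\mathbf{Q}$-measure of the family of all sets of diameter larger than $1$ that are contained in $[-1,1]^d$ is finite; (M4) $\mathcal{L}^d(\partial\Lambda)=0$ for $\mathbf{Q}$-a.e. $\Lambda$. Let $\mathcal{Y}$ be a Poisson point process on $\mathcal{X}$ with intensity $\mathbf{Q}$ (a random countable collection of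 sets such that $\#(\mathcal{A}\cap\mathcal{Y})$ is Poisson with mean $\mathbf{Q}(\mathcal{A})$, independent for disjoint $\mathcal{A}$). For $a<b$, $\Delta_a^b(\mathcal{Y})$ is the union of the sets in $\mathcal{Y}$ with diameter in $[a,b)$. $\alpha(\mathbf{Q})$ is defined by $2^{-\alpha}=\mathbb{P}(0\notin\Delta_{1/2}^1(\mathcal{Y}))$. Set $A_n=\Omega\setminus\Delta^1_{2^{-n}}(\mathcal{Y})$, $\mu_n=2^{n\alpha}\mathbf{1}_{A_n}$, $A=\overline{\bigcap_nA_n}$, and $\mu_\infty$ the a.s. weak limit of $\mu_n$ (as measures $\mu_n(x)dx$). $\dim_{\rm loc}(\mu,x)=\lim_{r\downarrow0}\log\mu(B(x,r))/\log r$ when the limit exists. *)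

theory Defs
  imports "HOL-Probability.Probability"
begin

definition compact_sets :: "'a::euclidean_space set set" where
  "compact_sets = {K. compact K \<and> K \<noteq> {}}"

definition hausdorff_dist :: "'a::metric_space set \<Rightarrow> 'a set \<Rightarrow> real" where
  "hausdorff_dist K L = max (SUP x\<in>K. infdist x L) (SUP y\<in>L. infdist y K)"

definition hausdorff_open :: "'a::euclidean_space set set \<Rightarrow> bool" where
  "hausdorff_open U \<longleftrightarrow> U \<subseteq> compact_sets \<and>
     (\<forall>K\<in>U. \<exists>e>0. \<forall>L\<in>compact_sets. hausdorff_dist K L < e \<longrightarrow> L \<in> U)"

definition hausdorff_borel :: "'a::euclidean_space set measure" where
  "hausdorff_borel = sigma compact_sets {U. hausdorff_open U}"

definition npoints :: "'b set \<Rightarrow> 'b set \<Rightarrow> enat" where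
  "npoints S Y = (if finite (S \<inter> Y) then enat (card (S \<inter> Y)) else \<infinity>)"

definition poisson_point_process :: "'p measure \<Rightarrow> ('p \<Rightarrow> 'b set) \<Rightarrow> 'b measure \<Rightarrow> bool" where
  "poisson_point_process P Y Q \<longleftrightarrow>
     prob_space P \<and>
     (\<forall>\<omega>\<in>space P. countable (Y \<omega>) \<and> Y \<omega> \<subseteq> space Q) \<and>
     (\<forall>S\<in>sets Q. (\<lambda>\<omega>. npoints S (Y \<omega>)) \<in> measurable P (count_space UNIV)) \<and>
     (\<forall>S\<in>sets Q. emeasure Q S < \<infinity> \<longrightarrow>
        (\<forall>k::nat. measure P {\<omega>\<in>space P. npoints S (Y \<omega>) = enat k}
                   = exp (- measure Q S) * measure Q S ^ k / fact k)) \<and>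
     (\<forall>S\<in>sets Q. emeasure Q S = \<infinity> \<longrightarrow>
        (AE \<omega> in P. npoints S (Y \<omega>) = \<infinity>)) \<and>
     (\<forall>(I::nat set) (F::nat \<Rightarrow> 'b set). finite I \<longrightarrow> F ` I \<subseteq> sets Q \<longrightarrow>
        disjoint_family_on F I \<longrightarrow>
        prob_space.indep_vars P (\<lambda>_. count_space UNIV) (\<lambda>i \<omega>. npoints (F i) (Y \<omega>)) I)"

definition Delta :: "real \<Rightarrow> real \<Rightarrow> 'a::metric_space set set \<Rightarrow> 'a set" where
  "Delta a b Y = \<Union>{L\<in>Y. a \<le> diameter L \<and> diameter L < b}"

definition weak_conv_measures :: "(nat \<Rightarrow> 'a::metric_space measure) \<Rightarrow> 'a measure \<Rightarrow> bool" where
  "weak_conv_measures \<mu>s \<mu> \<longleftrightarrow>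
     (\<forall>f::'a \<Rightarrow> real. continuous_on UNIV f \<longrightarrow> bounded (range f) \<longrightarrow>
        (\<lambda>n. \<integral>x. f x \<partial>\<mu>s n) \<longlonglongrightarrow> (\<integral>x. f x \<partial>\<mu>))"

definition local_dim_eq :: "'a::metric_space measure \<Rightarrow> 'a \<Rightarrow> real \<Rightarrow> bool" where
  "local_dim_eq \<mu> x D \<longleftrightarrow>
     ((\<lambda>r. ln (measure \<mu> (cball x r)) / ln r) \<longlongrightarrow> D) (at_right 0)"

definition hausdorff_premeasure :: "real \<Rightarrow> real \<Rightarrow> 'a::metric_space set \<Rightarrow> ennreal" where
  "hausdorff_premeasure s \<delta> E =
     (INF U \<in> {U :: nat \<Rightarrow> 'a set. (\<forall>i. bounded (U i) \<and> diameter (U i) \<le> \<delta>) \<and> E \<subseteq> (\<Union>i. U i)}.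
        \<Sum>i. ennreal (diameter (U i) powr s))"

definition hausdorff_measure :: "real \<Rightarrow> 'a::metric_space set \<Rightarrow> ennreal" where
  "hausdorff_measure s E = (SUP \<delta>\<in>{0<..}. hausdorff_premeasure s \<delta> E)"

definition hausdorff_dim :: "'a::euclidean_space set \<Rightarrow> real" where
  "hausdorff_dim E = Inf {s. s > 0 \<and> hausdorff_measure s E = 0}"

definition covering_number :: "real \<Rightarrow> 'a::metric_space set \<Rightarrow> nat" where
  "covering_number \<delta> E =
     (LEAST n. \<exists>F. finite F \<and> card F = n \<and> (\<forall>U\<in>F. bounded U \<and> diameter U \<le> \<delta>) \<and> E \<subseteq> \<Union>F)"

definition upper_box_dim :: "'a::metric_space set \<Rightarrow> ereal" where
  "upper_box_dim E = Limsup (at_right 0) (\<lambda>\<delta>. ereal (ln (real (covering_number \<delta> E)) / - ln \<delta>))"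

end

(*
  Write q for the Q-measure of {L. 0 in L, 1/2 <= diam L < 1}.  Void probabilities and scaling give
  alpha ln 2 = q and P(x uncovered by diameters in [2^-n,1)) = 2^(-n alpha).  By (M4), translation
  invariance and Fubini, the set of L having a given point on the frontier is Q-null, hence the
  measure of the sets L (with diameter in a fixed range) that meet a small ball without containing
  it tends to 0 with the radius.

  Upper bound: a ball of radius 2^-n meets A_n only if no L in Y contains it, so the expected
  number of balls of a grid needed to cover A is 2^(n(d-alpha)+o(n)); Borel-Cantelli.

  Lower bound: the mean of mu_n(U) is the volume of U in Omega, and
  2^(2n alpha) P(x and y uncovered) = exp Q{L. x and y in L} is at most a multiple of
  |x-y|^(-alpha), so mu_n is bounded in L^2 (whence mu_inf is nonzero with positive probability) and
  the second moments of mu_n on balls, passed to the limit by Fatou, show that mu_inf has lower local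
  dimension at least d-alpha.  The measure mu_inf does not charge the removed sets: their interiors
  because mu_n vanishes there, their frontiers by the estimate above.  So mu_inf lives on the cutout
  set and the mass distribution principle applies, while the box dimension bound controls the upper
  local dimension.

  Since mu_inf is not assumed measurable in omega, every estimate bounds it from above by
  liminf mu_n, which is.
*)

theory Submission
  imports Defs
begin

section \<open>Measurability for the Hausdorff metric\<close>

text \<open>M3 controls only sets confined to a window, so the first task is local finiteness: for
  \<open>a > 0\<close> the sets with diameter in \<open>[a, b)\<close> that hit a ball have finite
  measure. The cutouts with diameters in \<open>[2^-n, 1)\<close> are then almost surely locally
  finite, their union is closed, and its complement can be read off from countably many void events.
  That gives the joint measurability that Tonelli needs. Scales are dyadic because M2 gives every
  layer \<open>[2^-(j+1), 2^-j)\<close> of sets through a point the same measure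
  \<open>alpha ln 2\<close>. The limit enters through two consequences of weak convergence:
  mu_inf(U) is at most liminf mu_n(U) for open U, and the total masses converge. Upper bounds alone
  could never exclude a zero limit, hence the second. First moments of a ball are of the order of
  its volume and say nothing about the few balls that survive. The remedy is that mu_inf(W) > tau
  forces mu_inf(W) to be at most liminf mu_n(W)^2 / tau, so second moments bound the total mass of
  all heavy balls of one scale. Omega need not be closed, so a weak limit could charge points
  outside it; outer regularity rules this out.\<close>

lemma space_hausdorff_borel: "space hausdorff_borel = compact_sets"
  unfolding hausdorff_borel_def by (rule space_measure_of) (auto simp: hausdorff_open_def)

lemma hausdorff_open_sets: "hausdorff_open U \<Longrightarrow> U \<in> sets hausdorff_borel"
  unfolding hausdorff_borel_def by (subst sets_measure_of) (auto simp: hausdorff_open_def)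

text \<open>A real supremum is unspecified on unbounded families. Compactness bounds both families
  of distances, which lets \<open>hausdorff_dist\<close> dominate each member.\<close>

lemma infdist_le_hausdorff_dist:
  assumes "K \<in> compact_sets" "L \<in> compact_sets"
  shows "x \<in> K \<Longrightarrow> infdist x L \<le> hausdorff_dist K L"
    and "y \<in> L \<Longrightarrow> infdist y K \<le> hausdorff_dist K L"
proof -
  have bdd: "bdd_above ((\<lambda>x. infdist x M) ` N)"
    if "N \<in> compact_sets" for M N :: "'a set"
  proof -
    have "compact N" using that by (simp add: compact_sets_def)
    hence "compact ((\<lambda>x. infdist x M) ` N)"
      by (intro compact_continuous_image continuous_intros)
    thus ?thesis by (rule bounded_imp_bdd_above[OF compact_imp_bounded])
  qed
  show "x \<in> K \<Longrightarrow> infdist x L \<le> hausdorff_dist K L"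
    unfolding hausdorff_dist_def using bdd[OF assms(1), of L] by (intro max.coboundedI1 cSUP_upper)
  show "y \<in> L \<Longrightarrow> infdist y K \<le> hausdorff_dist K L"
    unfolding hausdorff_dist_def using bdd[OF assms(2), of K] by (intro max.coboundedI2 cSUP_upper)
qed

lemma infdist_lessE:
  assumes "infdist x L < e" "L \<noteq> {}"
  obtains y where "y \<in> L" "dist x y < e"
proof -
  have "(INF a\<in>L. dist x a) < e" using assms by (simp add: infdist_def)
  thus ?thesis using assms(2) that by (subst (asm) cINF_less_iff) (auto intro: bdd_belowI2[of _ 0])
qed

text \<open>The family is Hausdorff-open: a compact set disjoint from the closed \<open>K\<close>
  keeps a positive distance \<open>e\<close> from it, and a perturbation smaller than
  \<open>e\<close> cannot bridge that gap.\<close>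

lemma missing_measurable:
  assumes "closed K"
  shows "{L \<in> compact_sets. L \<inter> K = {}} \<in> sets hausdorff_borel"
proof (rule hausdorff_open_sets, unfold hausdorff_open_def, safe)
  fix L :: "'a set" assume L: "L \<in> compact_sets" "L \<inter> K = {}"
  obtain e where e: "e > 0" "\<And>x y. x \<in> L \<Longrightarrow> y \<in> K \<Longrightarrow> e \<le> dist x y"
    using separate_compact_closed[of L K] L assms unfolding compact_sets_def by auto
  show "\<exists>e>0. \<forall>M\<in>compact_sets. hausdorff_dist L M < e \<longrightarrow> M \<in> {L \<in> compact_sets. L \<inter> K = {}}"
  proof (intro exI[of _ e] conjI ballI impI CollectI e(1))
    fix M assume M: "M \<in> compact_sets" "hausdorff_dist L M < e"
    show "M \<inter> K = {}"
    proof safe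
      fix y assume y: "y \<in> M" "y \<in> K"
      have "infdist y L < e" using infdist_le_hausdorff_dist(2)[OF L(1) M(1) y(1)] M(2) by linarith
      then obtain x where "x \<in> L" "dist y x < e"
        using L by (auto elim!: infdist_lessE simp: compact_sets_def)
      thus "y \<in> {}" using e(2)[of x y] y by (simp add: dist_commute)
    qed
  qed
qed

lemma hitting_measurable:
  assumes "closed K"
  shows "{L \<in> compact_sets. L \<inter> K \<noteq> {}} \<in> sets hausdorff_borel"
proof -
  have "{L \<in> compact_sets. L \<inter> K \<noteq> {}} = space hausdorff_borel - {L \<in> compact_sets. L \<inter> K = {}}"
    by (auto simp: space_hausdorff_borel)
  thus ?thesis using missing_measurable[OF assms] by simp
qed

text \<open>The complement is Hausdorff-open: a point \<open>x\<close> of \<open>K\<close> missed by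
  \<open>L\<close> is still missed by every set at Hausdorff distance below
  \<open>infdist x L\<close>.\<close>

lemma containing_measurable:
  "{L \<in> compact_sets. K \<subseteq> L} \<in> sets hausdorff_borel"
proof -
  have "hausdorff_open {L \<in> compact_sets. \<not> K \<subseteq> L}"
    unfolding hausdorff_open_def
  proof (intro conjI ballI)
    fix L :: "'a set" assume "L \<in> {L \<in> compact_sets. \<not> K \<subseteq> L}"
    then obtain x where L: "L \<in> compact_sets" "x \<in> K" "x \<notin> L" by auto
    hence pos: "infdist x L > 0"
      by (simp add: compact_sets_def infdist_pos_not_in_closed compact_imp_closed)
    show "\<exists>e>0. \<forall>M\<in>compact_sets. hausdorff_dist L M < e \<longrightarrow> M \<in> {L \<in> compact_sets. \<not> K \<subseteq> L}"
    proof (intro exI[of _ "infdist x L"] conjI ballI impI CollectI pos)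
      fix M assume M: "M \<in> compact_sets" "hausdorff_dist L M < infdist x L"
      thus "\<not> K \<subseteq> M" using infdist_le_hausdorff_dist(2)[OF L(1) M(1), of x] L by force
    qed
  qed auto
  hence "space hausdorff_borel - {L \<in> compact_sets. \<not> K \<subseteq> L} \<in> sets hausdorff_borel"
    using hausdorff_open_sets by blast
  also have "space hausdorff_borel - {L \<in> compact_sets. \<not> K \<subseteq> L} = {L \<in> compact_sets. K \<subseteq> L}"
    by (auto simp: space_hausdorff_borel)
  finally show ?thesis .
qed

lemma contained_measurable:
  assumes "closed K"
  shows "{L \<in> compact_sets. L \<subseteq> K} \<in> sets hausdorff_borel"
proof -
  have "hausdorff_open {L \<in> compact_sets. \<not> L \<subseteq> K}"
    unfolding hausdorff_open_def
  proof (intro conjI ballI)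
    fix L :: "'a set" assume "L \<in> {L \<in> compact_sets. \<not> L \<subseteq> K}"
    then obtain x where L: "L \<in> compact_sets" "x \<in> L" "x \<notin> K" by auto
    obtain e where e: "e > 0" "ball x e \<inter> K = {}"
      using L assms by (metis open_Compl open_contains_ball disjoint_eq_subset_Compl ComplI)
    show "\<exists>e>0. \<forall>M\<in>compact_sets. hausdorff_dist L M < e \<longrightarrow> M \<in> {L \<in> compact_sets. \<not> L \<subseteq> K}"
    proof (intro exI[of _ e] conjI ballI impI CollectI e(1))
      fix M assume M: "M \<in> compact_sets" "hausdorff_dist L M < e"
      have "infdist x M < e" using infdist_le_hausdorff_dist(1)[OF L(1) M(1) L(2)] M(2) by linarith
      then obtain y where "y \<in> M" "dist x y < e"
        using M by (auto elim!: infdist_lessE simp: compact_sets_def)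
      thus "\<not> M \<subseteq> K" using e(2) by auto
    qed
  qed auto
  hence "space hausdorff_borel - {L \<in> compact_sets. \<not> L \<subseteq> K} \<in> sets hausdorff_borel"
    using hausdorff_open_sets by blast
  also have "space hausdorff_borel - {L \<in> compact_sets. \<not> L \<subseteq> K} = {L \<in> compact_sets. L \<subseteq> K}"
    by (auto simp: space_hausdorff_borel)
  finally show ?thesis .
qed

lemma diameter_less_measurable:
  "{L \<in> compact_sets. diameter L < a} \<in> sets hausdorff_borel"
proof (rule hausdorff_open_sets, unfold hausdorff_open_def, safe)
  fix L :: "'a set" assume L: "L \<in> compact_sets" "diameter L < a"
  \<comment> \<open>A perturbation by \<open>e\<close> changes the diameter by at most
    \<open>2 * e\<close>, which is half of the available gap, so the inequality stays
    strict.\<close>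
  define e where "e = (a - diameter L) / 4"
  have e: "e > 0" using L by (simp add: e_def)
  show "\<exists>e>0. \<forall>M\<in>compact_sets. hausdorff_dist L M < e \<longrightarrow> M \<in> {L \<in> compact_sets. diameter L < a}"
  proof (intro exI[of _ e] conjI ballI impI CollectI e)
    fix M assume M: "M \<in> compact_sets" "hausdorff_dist L M < e"
    have near: "\<exists>x\<in>L. dist y x < e" if y: "y \<in> M" for y
    proof -
      have "infdist y L < e" using infdist_le_hausdorff_dist(2)[OF L(1) M(1) y(1)] M(2) by linarith
      thus ?thesis using L by (auto elim!: infdist_lessE simp: compact_sets_def)
    qed
    have "diameter M \<le> diameter L + 2 * e"
    proof (rule diameter_le)
      show "M \<noteq> {} \<or> 0 \<le> diameter L + 2 * e" using M by (simp add: compact_sets_def)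
      fix y z assume "y \<in> M" "z \<in> M"
      then obtain y' z' where *: "y' \<in> L" "dist y y' < e" "z' \<in> L" "dist z z' < e" using near by meson
      have "dist y z \<le> dist y y' + dist y' z' + dist z z'"
        using dist_triangle[of y z y'] dist_triangle[of y' z z'] dist_commute[of z z'] by linarith
      moreover have "dist y' z' \<le> diameter L"
        using * L by (intro diameter_bounded_bound) (auto simp: compact_sets_def compact_imp_bounded)
      ultimately show "norm (y - z) \<le> diameter L + 2 * e" using * by (simp add: dist_norm)
    qed
    thus "diameter M < a" using L(2) unfolding e_def by (simp add: field_simps)
  qed
qed

lemma diameter_borel_measurable [measurable]: "diameter \<in> borel_measurable hausdorff_borel"
  by (rule borel_measurableI_less) (simp add: space_hausdorff_borel diameter_less_measurable)

lemma countable_ball_dense: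
  obtains D :: "'a::euclidean_space set"
  where "countable D" "\<And>x r. r > 0 \<Longrightarrow> \<exists>c\<in>D. dist c x < r"
proof -
  obtain D :: "'a set" where D: "countable D" "\<And>X. open X \<Longrightarrow> X \<noteq> {} \<Longrightarrow> \<exists>d\<in>D. d \<in> X"
    using countable_dense_setE by blast
  show ?thesis
  proof (rule that[OF D(1)])
    fix x :: 'a and r :: real assume "r > 0"
    thus "\<exists>c\<in>D. dist c x < r" using D(2)[of "ball x r"] by (auto simp: dist_commute)
  qed
qed

text \<open>Membership in a closed set is approximated by countably many rectangles: at every scale
  some dense centre close to \<open>x\<close> has a closed ball that meets \<open>L\<close>.
  Measurability in the pair is what Fubini needs in \<open>frontier_null\<close>.\<close>

lemma mem_pair_measurable:
  "{(x :: 'a::euclidean_space, L). L \<in> compact_sets \<and> x \<in> L} \<in> sets (borel \<Otimes>\<^sub>M hausdorff_borel)"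
proof -
  obtain D :: "'a set" where D: "countable D" "\<And>x r. r > 0 \<Longrightarrow> \<exists>c\<in>D. dist c x < r"
    using countable_ball_dense by blast
  have "{(x, L). L \<in> compact_sets \<and> x \<in> L} =
    (\<Inter>j. \<Union>c\<in>D. ball c (1 / Suc j) \<times> {L \<in> compact_sets. L \<inter> cball c (1 / Suc j) \<noteq> {}})" (is "?A = ?B")
  proof (intro set_eqI iffI; clarify)
    fix x :: 'a and L :: "'a set" and j :: nat assume *: "L \<in> compact_sets" "x \<in> L"
    obtain c where "c \<in> D" "dist c x < 1 / Suc j" using D(2)[of "1 / Suc j" x] by auto
    thus "(x, L) \<in> (\<Union>c\<in>D. ball c (1 / Suc j) \<times> {L \<in> compact_sets. L \<inter> cball c (1 / Suc j) \<noteq> {}})"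
      using * by (intro UN_I[of c]) auto
  next
    fix x :: 'a and L assume *: "(x, L) \<in> ?B"
    hence L: "L \<in> compact_sets" by auto
    have "x \<in> L"
    proof (rule ccontr)
      assume "x \<notin> L"
      hence "infdist x L > 0"
        using L by (simp add: compact_sets_def infdist_pos_not_in_closed compact_imp_closed)
      then obtain j where j: "1 / Suc j < infdist x L / 2"
        using reals_Archimedean[of "infdist x L / 2"] by (auto simp: inverse_eq_divide)
      obtain c y where "dist c x < 1 / Suc j" "y \<in> L" "dist c y \<le> 1 / Suc j"
      proof -
        from * have "(x, L) \<in> (\<Union>c\<in>D. ball c (1 / Suc j) \<times> {L \<in> compact_sets. L \<inter> cball c (1 / Suc j) \<noteq> {}})"
          by blast
        thus ?thesis using that by auto
      qed
      moreover from this have "infdist x L \<le> dist x y" by (intro infdist_le) auto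
      ultimately show False using j dist_triangle3[of x y c] by linarith
    qed
    thus "L \<in> compact_sets \<and> x \<in> L" using L by simp
  qed
  also have "\<dots> \<in> sets (borel \<Otimes>\<^sub>M hausdorff_borel)"
    using D(1) by (intro sets.countable_INT sets.countable_UN' pair_measureI hitting_measurable image_subsetI) auto
  finally show ?thesis .
qed

text \<open>An interior point lies in a ball of a fixed countable family that is contained in
  \<open>L\<close>, so the set is a countable union of rectangles.\<close>

lemma interior_pair_measurable:
  "{(x :: 'a::euclidean_space, L). L \<in> compact_sets \<and> x \<in> interior L} \<in> sets (borel \<Otimes>\<^sub>M hausdorff_borel)"
proof -
  obtain D :: "'a set" where D: "countable D" "\<And>x r. r > 0 \<Longrightarrow> \<exists>c\<in>D. dist c x < r"
    using countable_ball_dense by blast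
  have "{(x, L). L \<in> compact_sets \<and> x \<in> interior L} =
    (\<Union>j. \<Union>c\<in>D. ball c (1 / Suc j) \<times> {L \<in> compact_sets. ball c (1 / Suc j) \<subseteq> L})" (is "?A = ?B")
  proof (intro set_eqI iffI; clarify)
    fix x :: 'a and L :: "'a set" assume *: "L \<in> compact_sets" "x \<in> interior L"
    obtain e where e: "e > 0" "ball x e \<subseteq> L" using *(2) by (meson mem_interior)
    then obtain j where j: "1 / Suc j < e / 2"
      using reals_Archimedean[of "e / 2"] by (auto simp: inverse_eq_divide)
    obtain c where c: "c \<in> D" "dist c x < 1 / Suc j" using D(2)[of "1 / Suc j" x] by auto
    have "ball c (1 / Suc j) \<subseteq> ball x e"
    proof
      fix y assume "y \<in> ball c (1 / Suc j)"
      thus "y \<in> ball x e" using c j dist_triangle3[of x y c] by auto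
    qed
    thus "(x, L) \<in> (\<Union>j. \<Union>c\<in>D. ball c (1 / Suc j) \<times> {L \<in> compact_sets. ball c (1 / Suc j) \<subseteq> L})"
      using * c e by (intro UN_I[of j] UN_I[of c]) auto
  next
    fix x :: 'a and L j c assume "x \<in> ball c (1 / Suc j)" "ball c (1 / Suc j) \<subseteq> L"
    thus "x \<in> interior L" by (meson interiorI open_ball)
  qed
  also have "\<dots> \<in> sets (borel \<Otimes>\<^sub>M hausdorff_borel)"
    using D(1) by (intro sets.countable_UN'' sets.countable_UN' pair_measureI containing_measurable image_subsetI) auto
  finally show ?thesis .
qed

lemma frontier_pair_measurable:
  "{(x :: 'a::euclidean_space, L). L \<in> compact_sets \<and> x \<in> frontier L} \<in> sets (borel \<Otimes>\<^sub>M hausdorff_borel)"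
proof -
  have "{(x :: 'a, L). L \<in> compact_sets \<and> x \<in> frontier L} =
    {(x, L). L \<in> compact_sets \<and> x \<in> L} - {(x, L). L \<in> compact_sets \<and> x \<in> interior L}"
    by (auto simp: compact_sets_def frontier_def compact_imp_closed)
  thus ?thesis using sets.Diff[OF mem_pair_measurable interior_pair_measurable] by simp
qed

section \<open>Covering numbers, Hausdorff measure and local dimension\<close>

lemma dyadic_scale:
  assumes "0 < r" "r \<le> (1::real)"
  obtains k where "(1/2) ^ Suc k < r" "r \<le> (1/2) ^ k"
proof -
  obtain n :: nat where "(1/2) ^ n < r" using real_arch_pow_inv[OF assms(1), of "1/2"] by auto
  define m where "m = (LEAST n. (1/2) ^ n < r)"
  have m: "(1/2) ^ m < r" unfolding m_def by (rule LeastI) fact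
  have "m \<noteq> 0" using m assms by (intro notI) simp
  then obtain k where k: "m = Suc k" using not0_implies_Suc by blast
  have "\<not> (1/2) ^ k < r" using not_less_Least[of k "\<lambda>n. (1/2) ^ n < r"] k unfolding m_def by simp
  thus ?thesis using that[of k] m k by simp
qed

lemma dyadic_scale_ge:
  assumes "(1/2) ^ Suc k < r" "r \<le> ((1/2) ^ m :: real)"
  shows "m \<le> k"
proof (rule ccontr)
  assume "\<not> m \<le> k"
  hence "(1/2 :: real) ^ m \<le> (1/2) ^ Suc k" by (intro power_decreasing) auto
  thus False using assms by linarith
qed

lemma grid_cover:
  fixes S :: "'a::euclidean_space set"
  assumes "bounded S"
  obtains C where "C \<ge> (1::real)"
    "\<And>k. \<exists>I. finite I \<and> real (card I) \<le> C * 2 ^ (k * DIM('a)) \<and> S \<subseteq> (\<Union>c\<in>I. cball c ((1/2) ^ k))"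
proof -
  define d where "d = DIM('a)"
  have d: "d > 0" by (simp add: d_def)
  obtain R where R: "R > 0" "\<And>x. x \<in> S \<Longrightarrow> norm x \<le> R"
    using assms unfolding bounded_pos by blast
  have "\<exists>I. finite I \<and> real (card I) \<le> (2 * R * d + 5) ^ d * 2 ^ (k * d) \<and> S \<subseteq> (\<Union>c\<in>I. cball c ((1/2) ^ k))" for k
  proof -
    \<comment> \<open>Rounding moves each of the \<open>d\<close> coordinates by at most the mesh,
      hence the point by at most \<open>d * h\<close> in the l1 norm, which dominates the Euclidean
      norm.\<close>
    define h :: real where "h = (1/2) ^ k / d"
    have h: "h > 0" using d by (simp add: h_def)
    define N where "N = \<lceil>R / h\<rceil> + 1"
    have N0: "N \<ge> 1" unfolding N_def using divide_pos_pos[OF R(1) h] by linarith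
    define pt :: "('a \<Rightarrow> int) \<Rightarrow> 'a" where "pt = (\<lambda>z. \<Sum>i\<in>Basis. (real_of_int (z i) * h) *\<^sub>R i)"
    define J where "J = (\<Pi>\<^sub>E i\<in>(Basis::'a set). {-N..N})"
    have J: "finite J" "card J = nat (2 * N + 1) ^ d"
      unfolding J_def d_def by (auto intro!: finite_PiE simp: card_PiE)
    have "real (card (pt ` J)) \<le> real (card J)" using card_image_le[OF J(1)] by simp
    also have "\<dots> = (2 * real_of_int N + 1) ^ d" using N0 J by simp
    also have "2 * real_of_int N + 1 \<le> (2 * R * d + 5) * 2 ^ k"
    proof -
      have "real_of_int N \<le> R / h + 2" unfolding N_def by linarith
      hence "2 * real_of_int N + 1 \<le> 2 * R * d * 2 ^ k + 5"
        by (simp add: h_def field_simps power_divide)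
      also have "\<dots> \<le> 2 * R * d * 2 ^ k + 5 * 2 ^ k" by simp
      finally show ?thesis by (simp add: algebra_simps)
    qed
    hence "(2 * real_of_int N + 1) ^ d \<le> ((2 * R * d + 5) * 2 ^ k) ^ d"
      using N0 by (intro power_mono) auto
    also have "\<dots> = (2 * R * d + 5) ^ d * 2 ^ (k * d)" by (simp add: power_mult_distrib power_mult)
    finally have card: "real (card (pt ` J)) \<le> (2 * R * d + 5) ^ d * 2 ^ (k * d)" .
    have "S \<subseteq> (\<Union>c\<in>pt ` J. cball c ((1/2) ^ k))"
    proof
      fix x assume x: "x \<in> S"
      define z where "z = restrict (\<lambda>i. \<lfloor>x \<bullet> i / h\<rfloor>) Basis"
      have z: "\<bar>x \<bullet> i - real_of_int (z i) * h\<bar> \<le> h" if "i \<in> Basis" for i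
      proof -
        have "real_of_int (z i) \<le> x \<bullet> i / h" "x \<bullet> i / h \<le> real_of_int (z i) + 1" using that unfolding z_def by simp_all
        thus ?thesis using h by (auto simp: field_simps abs_le_iff)
      qed
      have "z \<in> J" unfolding J_def
      proof (rule PiE_I)
        fix i :: 'a assume i: "i \<in> Basis"
        have "\<bar>x \<bullet> i\<bar> \<le> R" using R(2)[OF x] Basis_le_norm[OF i, of x] by linarith
        hence "\<bar>x \<bullet> i / h\<bar> \<le> R / h" using h by (simp add: divide_right_mono)
        thus "z i \<in> {-N..N}" using i unfolding z_def N_def atLeastAtMost_iff abs_le_iff by (simp only: restrict_apply if_True) linarith
      qed (auto simp: z_def)
      moreover have "norm (pt z - x) \<le> (1/2) ^ k"
      proof -
        have "norm (pt z - x) \<le> (\<Sum>i\<in>Basis. \<bar>(pt z - x) \<bullet> i\<bar>)" by (rule norm_le_l1)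
        also have "\<dots> \<le> (\<Sum>i\<in>(Basis::'a set). h)"
        proof (rule sum_mono)
          fix i :: 'a assume i: "i \<in> Basis"
          have "pt z \<bullet> i = real_of_int (z i) * h" unfolding pt_def using i by (simp add: inner_sum_left_Basis)
          thus "\<bar>(pt z - x) \<bullet> i\<bar> \<le> h" using z[OF i] by (simp add: inner_diff_left abs_minus_commute)
        qed
        also have "\<dots> = (1/2) ^ k" using d by (simp add: h_def d_def)
        finally show ?thesis .
      qed
      ultimately show "x \<in> (\<Union>c\<in>pt ` J. cball c ((1/2) ^ k))" by (auto simp: dist_norm)
    qed
    thus ?thesis using J(1) card by blast
  qed
  moreover have "(2 * R * d + 5) ^ d \<ge> 1" using R(1) by (intro one_le_power) simp
  ultimately show ?thesis using that unfolding d_def by blast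
qed

section \<open>Covering numbers and box dimension\<close>

lemma covering_number_le:
  assumes "finite F" "\<And>U. U \<in> F \<Longrightarrow> bounded U \<and> diameter U \<le> \<delta>" "E \<subseteq> \<Union>F"
  shows "covering_number \<delta> E \<le> card F"
  unfolding covering_number_def using assms by (intro Least_le) blast

text \<open>\<open>LEAST\<close> carries no information unless some finite cover exists; boundedness
  of \<open>E\<close> supplies one.\<close>

lemma covering_number_attained:
  fixes E :: "'a::euclidean_space set"
  assumes "bounded E" "\<delta> > 0"
  obtains F where "finite F" "card F = covering_number \<delta> E"
    "\<And>U. U \<in> F \<Longrightarrow> bounded U" "\<And>U. U \<in> F \<Longrightarrow> diameter U \<le> \<delta>" "E \<subseteq> \<Union>F"
proof -
  obtain k where k: "(1/2) ^ k < \<delta> / 2" using real_arch_pow_inv[of "\<delta>/2" "1/2"] assms by auto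
  obtain C where "\<And>k. \<exists>I. finite I \<and> real (card I) \<le> C * 2 ^ (k * DIM('a)) \<and> E \<subseteq> (\<Union>c\<in>I. cball c ((1/2) ^ k))"
    using grid_cover[OF assms(1)] by metis
  then obtain I where I: "finite I" "E \<subseteq> (\<Union>c\<in>I. cball c ((1/2) ^ k))" by meson
  let ?F = "(\<lambda>c. cball c ((1/2) ^ k)) ` I"
  have "\<exists>n F. finite F \<and> card F = n \<and> (\<forall>U\<in>F. bounded U \<and> diameter U \<le> \<delta>) \<and> E \<subseteq> \<Union>F"
    using I k by (intro exI[of _ "card ?F"] exI[of _ ?F]) auto
  from LeastI_ex[OF this] show ?thesis using that unfolding covering_number_def by blast
qed

lemma covering_number_antimono:
  fixes E :: "'a::euclidean_space set"
  assumes "bounded E" "0 < \<delta>" "\<delta> \<le> \<epsilon>"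
  shows "covering_number \<epsilon> E \<le> covering_number \<delta> E"
proof -
  obtain F where F: "finite F" "card F = covering_number \<delta> E"
    "\<And>U. U \<in> F \<Longrightarrow> bounded U" "\<And>U. U \<in> F \<Longrightarrow> diameter U \<le> \<delta>" "E \<subseteq> \<Union>F"
    using covering_number_attained[OF assms(1,2)] by blast
  have "covering_number \<epsilon> E \<le> card F"
    using F assms(3) by (intro covering_number_le) (auto intro: order_trans)
  thus ?thesis using F by simp
qed

text \<open>Passing from an arbitrary scale to the next smaller dyadic one costs the factor
  \<open>2 powr t\<close>. It is absorbed in \<open>c\<close>, and \<open>c / - ln \<delta>\<close>
  vanishes in the limit.\<close>

lemma upper_box_dim_le:
  fixes E :: "'a::euclidean_space set"
  assumes E: "bounded E" and t: "t \<ge> 0" and C: "C \<ge> 1"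
    and N: "\<And>k. real (covering_number ((1/2) ^ k) E) \<le> C * ((1/2) ^ k) powr (- t)"
  shows "upper_box_dim E \<le> ereal t"
proof -
  define c where "c = ln (C * 2 powr t)"
  have lim: "((\<lambda>\<delta>. ereal (t + c / - ln \<delta>)) \<longlongrightarrow> ereal (t + 0)) (at_right 0)"
  proof (intro tendsto_ereal tendsto_add tendsto_const)
    have "filterlim (\<lambda>\<delta>. - ln \<delta>) at_top (at_right (0::real))"
      using ln_at_0 by (simp add: filterlim_uminus_at_top)
    thus "((\<lambda>\<delta>. c / - ln \<delta>) \<longlongrightarrow> 0) (at_right 0)"
      by (intro tendsto_divide_0[OF tendsto_const] filterlim_at_top_imp_at_infinity)
  qed
  have "upper_box_dim E \<le> Limsup (at_right 0) (\<lambda>\<delta>. ereal (t + c / - ln \<delta>))"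
    unfolding upper_box_dim_def
  proof (rule Limsup_mono)
    have "\<forall>\<^sub>F \<delta> in at_right 0. \<delta> \<in> {0<..<1::real}" by (rule eventually_at_right_real) simp
    thus "\<forall>\<^sub>F \<delta> in at_right 0. ereal (ln (real (covering_number \<delta> E)) / - ln \<delta>) \<le> ereal (t + c / - ln \<delta>)"
    proof eventually_elim
      case (elim \<delta>)
      hence ln: "- ln \<delta> > 0" by simp
      obtain k where k: "(1/2) ^ Suc k < \<delta>" "\<delta> \<le> (1/2) ^ k"
        using dyadic_scale[of \<delta>] elim by auto
      have "real (covering_number \<delta> E) \<le> real (covering_number ((1/2) ^ Suc k) E)"
        using covering_number_antimono[OF E, of "(1/2) ^ Suc k" \<delta>] k(1) by simp
      also have "\<dots> \<le> C * ((1/2) ^ Suc k) powr (- t)" by (rule N)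
      also have "\<dots> \<le> C * (\<delta> / 2) powr (- t)"
        using C t k elim by (intro mult_left_mono powr_mono2') auto
      also have "\<dots> = (C * 2 powr t) * \<delta> powr (- t)"
        using elim by (simp add: powr_divide powr_minus field_simps)
      finally have le: "real (covering_number \<delta> E) \<le> (C * 2 powr t) * \<delta> powr (- t)" .
      have "ln (real (covering_number \<delta> E)) \<le> c + t * (- ln \<delta>)"
      proof (cases "covering_number \<delta> E = 0")
        \<comment> \<open>Here \<open>ln 0 = 0\<close>, so the right-hand side has to be nonnegative
          by itself; this is where \<open>C\<close> being at least 1 enters.\<close>
        case True
        have "C * 2 powr t \<ge> 1 * 1" using C t by (intro mult_mono) (auto simp: ge_one_powr_ge_zero)
        hence "c \<ge> 0" by (simp add: c_def)
        moreover have "t * (- ln \<delta>) \<ge> 0" using t ln by (intro mult_nonneg_nonneg) auto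
        ultimately show ?thesis using True by simp
      next
        case False
        hence "ln (real (covering_number \<delta> E)) \<le> ln ((C * 2 powr t) * \<delta> powr (- t))"
          using le by (intro ln_mono) auto
        also have "\<dots> = c + t * (- ln \<delta>)"
          unfolding c_def using C elim by (subst ln_mult) (auto simp: ln_powr)
        finally show ?thesis .
      qed
      thus ?case using ln by (simp add: field_simps)
    qed
  qed
  also have "\<dots> = ereal t" using lim_imp_Limsup[OF _ lim] by simp
  finally show ?thesis .
qed

lemma upper_box_dim_lessD:
  fixes E :: "'a::euclidean_space set"
  assumes "upper_box_dim E < ereal t"
  shows "\<forall>\<^sub>F \<delta> in at_right 0. real (covering_number \<delta> E) \<le> \<delta> powr (- t)"
proof -
  have "\<forall>\<^sub>F \<delta> in at_right 0. ereal (ln (real (covering_number \<delta> E)) / - ln \<delta>) < ereal t"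
    using assms unfolding upper_box_dim_def by (rule Limsup_lessD)
  moreover have "\<forall>\<^sub>F \<delta> in at_right 0. \<delta> \<in> {0<..<1::real}" by (rule eventually_at_right_real) simp
  ultimately show ?thesis
  proof eventually_elim
    case (elim \<delta>)
    show ?case
    proof (cases "covering_number \<delta> E = 0")
      case False
      have "- ln \<delta> > 0" using elim by simp
      hence "ln (real (covering_number \<delta> E)) \<le> (- t) * ln \<delta>" using elim by (simp add: field_simps)
      hence "exp (ln (real (covering_number \<delta> E))) \<le> exp ((- t) * ln \<delta>)" by simp
      thus ?thesis using False elim by (simp add: powr_def)
    qed simp
  qed
qed

text \<open>With \<open>t\<close> strictly between the box dimension and \<open>s\<close>, a cover
  by at most \<open>\<eta> powr (- t)\<close> sets of diameter at most \<open>\<eta>\<close> has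
  \<open>s\<close>-sum at most \<open>\<eta> powr (s - t)\<close>, which tends to 0.\<close>

lemma hausdorff_measure_eq_0_of_box_dim:
  fixes E :: "'a::euclidean_space set"
  assumes E: "bounded E" and s: "0 < s" "upper_box_dim E < ereal s"
  shows "hausdorff_measure s E = 0"
proof -
  obtain t where t: "upper_box_dim E < ereal t" "t < s"
    using ereal_dense2[OF s(2)] by auto
  have "hausdorff_premeasure s \<delta> E \<le> 0" if \<delta>: "\<delta> > 0" for \<delta>
  proof (rule ennreal_le_epsilon)
    fix e :: real assume e: "e > 0"
    have "((\<lambda>\<eta>. \<eta> powr (s - t)) \<longlongrightarrow> 0) (at_right (0::real))"
      using t by (intro tendsto_eq_intros refl) (auto simp: eventually_at_filter)
    hence "\<forall>\<^sub>F \<eta> in at_right 0. \<eta> powr (s - t) < e" using e by (rule order_tendstoD)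
    moreover have "\<forall>\<^sub>F \<eta> in at_right 0. \<eta> \<in> {0<..<\<delta>}" using \<delta> by (rule eventually_at_right_real)
    ultimately have "\<forall>\<^sub>F \<eta> in at_right 0. \<eta> powr (s - t) < e \<and> \<eta> \<in> {0<..<\<delta>} \<and> real (covering_number \<eta> E) \<le> \<eta> powr (- t)"
      using upper_box_dim_lessD[OF t(1)] by eventually_elim auto
    then obtain \<eta> where \<eta>: "\<eta> powr (s - t) < e" "\<eta> > 0" "\<eta> < \<delta>" "real (covering_number \<eta> E) \<le> \<eta> powr (- t)"
      using eventually_happens[of _ "at_right (0::real)"] by auto
    obtain F where F: "finite F" "card F = covering_number \<eta> E"
      "\<And>U. U \<in> F \<Longrightarrow> bounded U" "\<And>U. U \<in> F \<Longrightarrow> diameter U \<le> \<eta>" "E \<subseteq> \<Union>F"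
      using covering_number_attained[OF E \<eta>(2)] by blast
    obtain f where f: "bij_betw f {..<card F} F"
      using ex_bij_betw_nat_finite[OF F(1)] by (auto simp: lessThan_atLeast0)
    \<comment> \<open>The premeasure wants a sequence, so the finite cover is padded with empty
      sets; these contribute 0 because the empty set has diameter 0 and
      \<open>0 powr s = 0\<close>.\<close>
    define U where "U = (\<lambda>i. if i < card F then f i else {})"
    have fF: "i < card F \<Longrightarrow> f i \<in> F" for i using f by (auto simp: bij_betw_def)
    have "hausdorff_premeasure s \<delta> E \<le> (\<Sum>i. ennreal (diameter (U i) powr s))"
      unfolding hausdorff_premeasure_def
    proof (rule INF_lower, safe)
      fix i show "bounded (U i)" using F(3) fF by (auto simp: U_def)
      show "diameter (U i) \<le> \<delta>" using order_trans[OF F(4)[OF fF] less_imp_le[OF \<eta>(3)]] \<delta> by (auto simp: U_def)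
    next
      fix x assume "x \<in> E"
      then obtain V where "V \<in> F" "x \<in> V" using F(5) by auto
      moreover from this obtain i where "i < card F" "f i = V"
        using f by (metis bij_betw_imp_surj_on imageE lessThan_iff)
      ultimately show "x \<in> (\<Union>i. U i)" by (auto simp: U_def intro!: exI[of _ i])
    qed
    also have "\<dots> = (\<Sum>i<card F. ennreal (diameter (U i) powr s))"
      by (rule suminf_finite) (auto simp: U_def)
    also have "\<dots> \<le> (\<Sum>i<card F. ennreal (\<eta> powr s))"
      using F fF s by (intro sum_mono ennreal_leI powr_mono2) (auto simp: U_def diameter_ge_0)
    also have "\<dots> = ennreal (real (card F) * \<eta> powr s)"
      by (simp add: ennreal_of_nat_eq_real_of_nat ennreal_mult)
    also have "real (card F) * \<eta> powr s \<le> \<eta> powr (- t) * \<eta> powr s"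
      using F(2) \<eta>(4) by (intro mult_right_mono) auto
    also have "\<dots> = \<eta> powr (s - t)" by (simp add: powr_add[symmetric])
    also have "\<dots> \<le> e" using \<eta> by simp
    finally show "hausdorff_premeasure s \<delta> E \<le> 0 + ennreal e" using e by (simp add: ennreal_leI)
  qed
  hence "hausdorff_measure s E \<le> 0" unfolding hausdorff_measure_def by (intro SUP_least) auto
  thus ?thesis by simp
qed


section \<open>Mass distribution and comparison of dimensions\<close>

lemma hausdorff_coverE:
  assumes "hausdorff_measure s E = 0" "\<delta> > 0" "\<epsilon> > 0"
  obtains U :: "nat \<Rightarrow> 'a::metric_space set" where "\<And>i. bounded (U i)" "\<And>i. diameter (U i) \<le> \<delta>"
    "E \<subseteq> (\<Union>i. U i)" "(\<Sum>i. ennreal (diameter (U i) powr s)) < ennreal \<epsilon>"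
proof -
  have "hausdorff_premeasure s \<delta> E \<le> hausdorff_measure s E"
    unfolding hausdorff_measure_def using assms(2) by (intro SUP_upper) auto
  hence "hausdorff_premeasure s \<delta> E < ennreal \<epsilon>" using assms by simp
  thus ?thesis unfolding hausdorff_premeasure_def INF_less_iff using that by blast
qed

lemma emeasure_cball_le_diameter:
  fixes \<mu> :: "'a::euclidean_space measure"
  assumes \<mu>: "sets \<mu> = sets borel" "finite_measure \<mu>" and s: "s > 0"
    and x: "\<And>k. k \<ge> m \<Longrightarrow> measure \<mu> (cball x ((1/2) ^ k)) \<le> ((1/2) ^ k) powr s"
    and r: "0 \<le> r" "r \<le> (1/2) ^ m"
  shows "emeasure \<mu> (cball x r) \<le> ennreal (2 powr s * r powr s)"
proof -
  interpret finite_measure \<mu> by fact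
  have meas: "cball x t \<in> sets \<mu>" for t using \<mu> by simp
  have "measure \<mu> (cball x r) \<le> 2 powr s * r powr s"
  proof (cases "r = 0")
    \<comment> \<open>Cover members may be single points. Radius 0 lies below every dyadic scale,
      and letting \<open>k\<close> grow shows that the point carries no mass.\<close>
    case True
    have "measure \<mu> (cball x r) \<le> 0"
    proof (rule tendsto_lowerbound)
      show "(\<lambda>k. ((1/2 :: real) ^ k) powr s) \<longlonglongrightarrow> 0"
        using s by (intro tendsto_zero_powrI[where b=s] LIMSEQ_realpow_zero tendsto_const always_eventually) auto
      show "\<forall>\<^sub>F k in sequentially. measure \<mu> (cball x r) \<le> ((1/2 :: real) ^ k) powr s"
        using eventually_ge_at_top[of m]
      proof eventually_elim
        case (elim k)
        have "measure \<mu> (cball x r) \<le> measure \<mu> (cball x ((1/2) ^ k))"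
          using True meas by (intro finite_measure_mono) auto
        thus ?case using x[OF elim] by simp
      qed
    qed simp
    thus ?thesis by (meson order_trans mult_nonneg_nonneg powr_ge_zero)
  next
    case False
    hence "r > 0" using r by simp
    moreover have "r \<le> 1" using r(2) power_le_one[of "1/2::real" m] by simp
    ultimately obtain k where k: "(1/2) ^ Suc k < r" "r \<le> (1/2) ^ k" using dyadic_scale by blast
    have "m \<le> k" using dyadic_scale_ge[OF k(1) r(2)] .
    have "measure \<mu> (cball x r) \<le> measure \<mu> (cball x ((1/2) ^ k))"
      using k(2) meas by (intro finite_measure_mono) auto
    also have "\<dots> \<le> ((1/2) ^ k) powr s" using x[OF \<open>m \<le> k\<close>] .
    also have "\<dots> \<le> (2 * r) powr s" using s k(1) by (intro powr_mono2) auto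
    also have "\<dots> = 2 powr s * r powr s" using r by (simp add: powr_mult)
    finally show ?thesis .
  qed
  thus ?thesis by (simp add: emeasure_eq_measure ennreal_leI)
qed

text \<open>The scale from which the growth bound holds depends on the point, so the space is
  exhausted by sets \<open>G m\<close> with a common starting scale. Neither \<open>E\<close> nor
  \<open>G m\<close> is known to be measurable; nullity is shown through measurable supersets of
  arbitrarily small measure.\<close>

lemma mass_distribution:
  fixes \<mu> :: "'a::euclidean_space measure"
  assumes \<mu>: "sets \<mu> = sets borel" "finite_measure \<mu>" and s: "s > 0"
    and supp: "AE x in \<mu>. x \<in> E"
    and dim: "AE x in \<mu>. \<forall>\<^sub>F k in sequentially. measure \<mu> (cball x ((1/2) ^ k)) \<le> ((1/2) ^ k) powr s"
    and null: "hausdorff_measure s E = 0"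
  shows "\<mu> = null_measure \<mu>"
proof -
  define G where "G m = {x. \<forall>k\<ge>m. measure \<mu> (cball x ((1/2) ^ k)) \<le> ((1/2) ^ k) powr s}" for m
  have small: "\<exists>V\<in>sets \<mu>. E \<inter> G m \<subseteq> V \<and> emeasure \<mu> V \<le> ennreal (2 powr s * \<epsilon>)" if \<epsilon>: "\<epsilon> > 0" for m and \<epsilon> :: real
  proof -
    have d: "(0::real) < (1/2) ^ m" by simp
    obtain U :: "nat \<Rightarrow> 'a set" where U: "\<And>i. bounded (U i)" "\<And>i. diameter (U i) \<le> (1/2) ^ m"
      "E \<subseteq> (\<Union>i. U i)" "(\<Sum>i. ennreal (diameter (U i) powr s)) < ennreal \<epsilon>"
      by (rule hausdorff_coverE[OF null d \<epsilon>]) blast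
    \<comment> \<open>The growth bound is available only at points of \<open>G m\<close>, so each
      cover member is replaced by a ball centred at such a point. The ball is also Borel, which the
      cover member need not be.\<close>
    define V where "V i = (if U i \<inter> G m = {} then {} else cball (SOME x. x \<in> U i \<inter> G m) (diameter (U i)))" for i
    have meas: "V i \<in> sets \<mu>" for i using \<mu> by (simp add: V_def)
    have le: "emeasure \<mu> (V i) \<le> ennreal (2 powr s * diameter (U i) powr s)" for i
    proof (cases "U i \<inter> G m = {}")
      case False
      hence "(SOME x. x \<in> U i \<inter> G m) \<in> G m" using someI_ex[of "\<lambda>x. x \<in> U i \<inter> G m"] by blast
      thus ?thesis using False U \<mu> s
        by (auto simp: V_def G_def intro!: emeasure_cball_le_diameter diameter_ge_0)
    qed (simp add: V_def)
    have sub: "U i \<inter> G m \<subseteq> V i" for i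
    proof
      fix y assume y: "y \<in> U i \<inter> G m"
      hence "(SOME x. x \<in> U i \<inter> G m) \<in> U i" using someI_ex[of "\<lambda>x. x \<in> U i \<inter> G m"] by blast
      thus "y \<in> V i" using y U(1) by (auto simp: V_def intro!: diameter_bounded_bound)
    qed
    have "emeasure \<mu> (\<Union>i. V i) \<le> (\<Sum>i. emeasure \<mu> (V i))"
      using meas by (intro emeasure_subadditive_countably) auto
    also have "\<dots> \<le> (\<Sum>i. ennreal (2 powr s) * ennreal (diameter (U i) powr s))"
      using le by (intro suminf_le) (auto simp: ennreal_mult)
    also have "\<dots> = ennreal (2 powr s) * (\<Sum>i. ennreal (diameter (U i) powr s))" by simp
    also have "\<dots> \<le> ennreal (2 powr s) * ennreal \<epsilon>" using U(4) by (intro mult_left_mono) auto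
    also have "\<dots> = ennreal (2 powr s * \<epsilon>)" using \<epsilon> by (simp add: ennreal_mult)
    finally have "emeasure \<mu> (\<Union>i. V i) \<le> ennreal (2 powr s * \<epsilon>)" .
    moreover have "E \<inter> G m \<subseteq> (\<Union>i. V i)"
    proof
      fix x assume x: "x \<in> E \<inter> G m"
      then obtain i where "x \<in> U i" using U(3) by blast
      thus "x \<in> (\<Union>i. V i)" using sub[of i] x by blast
    qed
    moreover have "(\<Union>i. V i) \<in> sets \<mu>" using meas by blast
    ultimately show ?thesis by blast
  qed
  have "AE x in \<mu>. x \<notin> E \<inter> G m" for m
  proof -
    have "\<forall>j. \<exists>V\<in>sets \<mu>. E \<inter> G m \<subseteq> V \<and> emeasure \<mu> V \<le> ennreal (2 powr s * (1/2) ^ j)"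
      using small[of "(1/2) ^ _" m] by simp
    then obtain V where V: "\<And>j. V j \<in> sets \<mu>" "\<And>j. E \<inter> G m \<subseteq> V j"
      "\<And>j. emeasure \<mu> (V j) \<le> ennreal (2 powr s * (1/2) ^ j)" by metis
    have "(\<Inter>j. V j) \<in> null_sets \<mu>"
    proof (rule null_setsI)
      have "(\<lambda>j. ennreal (2 powr s * (1/2) ^ j)) \<longlonglongrightarrow> ennreal (2 powr s * 0)"
        by (intro tendsto_ennrealI tendsto_mult tendsto_const LIMSEQ_realpow_zero) auto
      moreover have "emeasure \<mu> (\<Inter>j. V j) \<le> ennreal (2 powr s * (1/2) ^ j)" for j
        using V by (intro order_trans[OF emeasure_mono V(3)]) auto
      ultimately have "emeasure \<mu> (\<Inter>j. V j) \<le> ennreal (2 powr s * 0)"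
        by (intro tendsto_lowerbound[OF _ always_eventually]) auto
      thus "emeasure \<mu> (\<Inter>j. V j) = 0" by simp
    qed (use V in auto)
    thus ?thesis using V(2) by (intro AE_I'[of "\<Inter>j. V j"]) auto
  qed
  hence "AE x in \<mu>. \<forall>m. x \<notin> E \<inter> G m" by (subst AE_all_countable) auto
  with supp dim have "AE x in \<mu>. False"
  proof eventually_elim
    case (elim x)
    then obtain m where "x \<in> G m" unfolding G_def eventually_sequentially by blast
    thus False using elim by blast
  qed
  then obtain N where N: "{x \<in> space \<mu>. \<not> False} \<subseteq> N" "emeasure \<mu> N = 0" "N \<in> sets \<mu>"
    by (rule AE_E)
  hence "emeasure \<mu> (space \<mu>) = 0" using emeasure_mono[of "space \<mu>" N \<mu>] by simp
  hence "emeasure \<mu> A = 0" if "A \<in> sets \<mu>" for A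
    using emeasure_mono[OF sets.sets_into_space[OF that], of \<mu>] by simp
  thus ?thesis by (intro measure_eqI) auto
qed

text \<open>The box bound makes the Hausdorff measure vanish above \<open>D\<close>, and
  \<open>pos\<close> keeps it alive below. A box dimension smaller than \<open>D\<close> would make
  it vanish at some exponent below \<open>D\<close>, contradicting \<open>pos\<close>.\<close>

lemma hausdorff_upper_box_dim_eq:
  fixes E :: "'a::euclidean_space set"
  assumes E: "bounded E" and D: "D > 0" "upper_box_dim E \<le> ereal D"
    and pos: "\<And>s. 0 < s \<Longrightarrow> s < D \<Longrightarrow> hausdorff_measure s E \<noteq> 0"
  shows "hausdorff_dim E = D" and "upper_box_dim E = ereal D"
proof -
  let ?S = "{s. s > 0 \<and> hausdorff_measure s E = 0}"
  have up: "s \<in> ?S" if "s > D" for s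
    using hausdorff_measure_eq_0_of_box_dim[OF E, of s] that D order_le_less_trans[OF D(2), of "ereal s"] by auto
  have low: "D \<le> s" if "s \<in> ?S" for s using pos[of s] that by force
  have "Inf ?S = D"
  proof (rule cInf_eq_non_empty)
    show "?S \<noteq> {}" using up[of "D + 1"] by auto
    show "\<And>s. s \<in> ?S \<Longrightarrow> D \<le> s" by (rule low)
    show "y \<le> D" if "\<And>s. s \<in> ?S \<Longrightarrow> y \<le> s" for y
      using that[OF up] by (rule dense_ge)
  qed
  thus "hausdorff_dim E = D" by (simp add: hausdorff_dim_def)
  show "upper_box_dim E = ereal D"
  proof (rule antisym[OF D(2)], rule ccontr)
    assume "\<not> ereal D \<le> upper_box_dim E"
    \<comment> \<open>The maximum with 0 keeps the intermediate exponent positive, as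
      \<open>pos\<close> requires.\<close>
    hence "max (upper_box_dim E) (ereal 0) < ereal D" using D(1) by simp
    then obtain s where s: "max (upper_box_dim E) (ereal 0) < ereal s" "ereal s < ereal D" using ereal_dense2 by blast
    hence "0 < s" "s < D" "upper_box_dim E < ereal s" by auto
    thus False using pos[of s] hausdorff_measure_eq_0_of_box_dim[OF E] by blast
  qed
qed

text \<open>At scale \<open>(1/2) ^ k\<close> the light members of an optimal cover carry together
  at most the covering number times \<open>((1/2) ^ k) powr s\<close>. This is summable when
  \<open>s\<close> exceeds the box dimension, so almost every point is eventually only in heavy
  members, each of which lies in the ball about the point.\<close>

lemma AE_measure_cball_ge:
  fixes \<mu> :: "'a::euclidean_space measure"
  assumes \<mu>: "sets \<mu> = sets borel" "finite_measure \<mu>"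
    and E: "bounded E" "AE x in \<mu>. x \<in> E" and s: "upper_box_dim E < ereal s"
  shows "AE x in \<mu>. \<forall>\<^sub>F k in sequentially. ((1/2) ^ k) powr s \<le> measure \<mu> (cball x ((1/2) ^ k))"
proof -
  interpret finite_measure \<mu> by fact
  obtain t where t: "upper_box_dim E < ereal t" "t < s" using ereal_dense2[OF s] by auto
  define q :: real where "q = (1/2) powr (s - t)"
  have q: "0 \<le> q" "q < 1" using t powr_mono_both'[of "0" "s-t" "1/2" "1/2"] powr_less_one[of "1/2" "s-t"] by (auto simp: q_def powr01_less_one)
  have half: "filterlim (\<lambda>k. (1/2 :: real) ^ k) (at_right 0) sequentially"
    by (auto simp: filterlim_at intro!: LIMSEQ_realpow_zero)
  have "\<exists>F. finite F \<and> card F = covering_number ((1/2) ^ k) E \<and> (\<forall>U\<in>F. bounded U \<and> diameter U \<le> (1/2) ^ k) \<and> E \<subseteq> \<Union>F" for k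
    using covering_number_attained[OF E(1), of "(1/2) ^ k"] by (metis zero_less_power half_gt_zero zero_less_one)
  then obtain F where F: "\<And>k. finite (F k)" "\<And>k. card (F k) = covering_number ((1/2) ^ k) E"
    "\<And>k U. U \<in> F k \<Longrightarrow> bounded U" "\<And>k U. U \<in> F k \<Longrightarrow> diameter U \<le> (1/2) ^ k" "\<And>k. E \<subseteq> \<Union>(F k)" by metis
  \<comment> \<open>Cover members need not be Borel. Their closures are, and they still lie in the
    closed ball about any point of the original set.\<close>
  define B where "B k = (\<Union>U\<in>{U\<in>F k. measure \<mu> (closure U) < ((1/2) ^ k) powr s}. closure U)" for k
  have B: "B k \<in> sets \<mu>" for k unfolding B_def using F(1) \<mu> by (intro sets.finite_UN) auto
  have "\<forall>\<^sub>F k in sequentially. norm (measure \<mu> (B k)) \<le> q ^ k"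
    using filterlim_iff[THEN iffD1, OF half, rule_format, OF upper_box_dim_lessD[OF t(1)]]
  proof eventually_elim
    case (elim k)
    have "measure \<mu> (B k) \<le> (\<Sum>U\<in>{U\<in>F k. measure \<mu> (closure U) < ((1/2) ^ k) powr s}. measure \<mu> (closure U))"
      unfolding B_def using F(1) \<mu> by (intro finite_measure_subadditive_finite) auto
    also have "\<dots> \<le> (\<Sum>U\<in>{U\<in>F k. measure \<mu> (closure U) < ((1/2) ^ k) powr s}. ((1/2) ^ k) powr s)"
      by (intro sum_mono) auto
    also have "\<dots> \<le> (\<Sum>U\<in>F k. ((1/2) ^ k) powr s)" using F(1) by (intro sum_mono2) auto
    also have "\<dots> = real (covering_number ((1/2) ^ k) E) * ((1/2) ^ k) powr s" by (simp add: F(2))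
    also have "\<dots> \<le> ((1/2) ^ k) powr (- t) * ((1/2) ^ k) powr s" using elim by (intro mult_right_mono) auto
    also have "\<dots> = ((1/2) ^ k) powr (s - t)" by (simp add: powr_add[symmetric])
    also have "\<dots> = q ^ k" by (simp add: q_def powr_power powr_realpow[symmetric] powr_powr mult.commute)
    finally show ?case by simp
  qed
  hence "summable (\<lambda>k. measure \<mu> (B k))"
    using q by (intro summable_comparison_test_ev[OF _ summable_geometric[of q]]) auto
  hence "AE x in \<mu>. \<forall>\<^sub>F k in sequentially. x \<in> space \<mu> - B k"
    using B by (intro borel_cantelli_AE1) (auto simp: emeasure_eq_measure)
  with E(2) show ?thesis
  proof eventually_elim
    case (elim x)
    from elim(2) show ?case
    proof eventually_elim
      case (elim k)
      obtain U where U: "U \<in> F k" "x \<in> U" using F(5)[of k] \<open>x \<in> E\<close> by auto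
      have "\<not> measure \<mu> (closure U) < ((1/2) ^ k) powr s"
        using elim U closure_subset[of U] by (auto simp: B_def)
      moreover have "measure \<mu> (closure U) \<le> measure \<mu> (cball x ((1/2) ^ k))"
      proof (intro finite_measure_mono closure_minimal subsetI)
        fix y assume "y \<in> U"
        thus "y \<in> cball x ((1/2) ^ k)"
          using diameter_bounded_bound[OF F(3)[OF U(1)] U(2)] F(4)[OF U(1)] by force
      qed (use \<mu> in auto)
      ultimately show ?case by linarith
    qed
  qed
qed

lemma local_dim_eqI:
  fixes \<mu> :: "'a::euclidean_space measure"
  assumes \<mu>: "sets \<mu> = sets borel" "finite_measure \<mu>" and D: "D > 0"
    and up: "\<And>s. 0 < s \<Longrightarrow> s < D \<Longrightarrow> \<forall>\<^sub>F k in sequentially. measure \<mu> (cball x ((1/2) ^ k)) \<le> ((1/2) ^ k) powr s"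
    and low: "\<And>s. D < s \<Longrightarrow> \<forall>\<^sub>F k in sequentially. ((1/2) ^ k) powr s \<le> measure \<mu> (cball x ((1/2) ^ k))"
  shows "local_dim_eq \<mu> x D"
proof -
  interpret finite_measure \<mu> by fact
  have meas: "cball x t \<in> sets \<mu>" for t using \<mu> by simp
  let ?m = "\<lambda>r. measure \<mu> (cball x r)"
  have mono: "?m r \<le> ?m t" if "r \<le> t" for r t using that meas by (intro finite_measure_mono) auto
  \<comment> \<open>Transfers an eventual statement along dyadic radii to all small
    \<open>r\<close>, using the two dyadic neighbours of \<open>r\<close>.\<close>
  have bound: "\<forall>\<^sub>F r in at_right 0. P r"
    if ev: "\<forall>\<^sub>F k in sequentially. Q k" and step: "\<And>k r. 0 < r \<Longrightarrow> r < 1 \<Longrightarrow> (1/2) ^ Suc k < r \<Longrightarrow> r \<le> (1/2) ^ k \<Longrightarrow> Q k \<Longrightarrow> Q (Suc k) \<Longrightarrow> P r"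
    for P :: "real \<Rightarrow> bool" and Q :: "nat \<Rightarrow> bool"
  proof -
    obtain K where K: "\<And>k. k \<ge> K \<Longrightarrow> Q k" using ev unfolding eventually_sequentially by blast
    have "\<forall>\<^sub>F r in at_right 0. r \<in> {0<..<(1/2)^K :: real}" by (rule eventually_at_right_real) simp
    moreover have "\<forall>\<^sub>F r in at_right 0. r \<in> {0<..<1::real}" by (rule eventually_at_right_real) simp
    ultimately show ?thesis
    proof eventually_elim
      case (elim r)
      then obtain k where k: "(1/2) ^ Suc k < r" "r \<le> (1/2) ^ k" using dyadic_scale[of r] by auto
      have "K \<le> k" using dyadic_scale_ge[OF k(1), of K] elim by simp
      thus ?case using step[OF _ _ k] elim K by auto
    qed
  qed
  have ln0: "filterlim (\<lambda>r. ln r) at_infinity (at_right (0::real))"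
    using ln_at_0 by (rule filterlim_at_bot_imp_at_infinity)
  have lim: "((\<lambda>r. s + c / ln r) \<longlongrightarrow> s) (at_right (0::real))" for s c :: real
    using tendsto_add[OF tendsto_const[of s] tendsto_divide_0[OF tendsto_const[of c] ln0]] by simp
  have pos: "\<forall>\<^sub>F r in at_right 0. ?m r > 0"
  proof (rule bound[OF low[of "D + 1"]])
    fix k and r :: real assume "(1/2) ^ Suc k < r" "((1/2) ^ Suc k) powr (D + 1) \<le> ?m ((1/2) ^ Suc k)"
    moreover have "((1/2 :: real) ^ Suc k) powr (D + 1) > 0" by simp
    ultimately show "?m r > 0" using mono[of "(1/2) ^ Suc k" r] by linarith
  qed simp
  show ?thesis unfolding local_dim_eq_def
  proof (rule order_tendstoI)
    fix a assume a: "a < D"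
    \<comment> \<open>The bound \<open>a\<close> may be negative, whereas \<open>up\<close> requires
      a positive exponent; the midpoint of \<open>max a 0\<close> and \<open>D\<close> is positive
      and strictly between \<open>a\<close> and \<open>D\<close>.\<close>
    define s where "s = (max a 0 + D) / 2"
    have s: "0 < s" "s < D" "a < s" using a D by (auto simp: s_def)
    have "\<forall>\<^sub>F r in at_right 0. ?m r \<le> (2 * r) powr s"
    proof (rule bound[OF up[OF s(1,2)]])
      fix k and r :: real assume "(1/2) ^ Suc k < r" "r \<le> (1/2) ^ k" "?m ((1/2) ^ k) \<le> ((1/2) ^ k) powr s"
      moreover from this have "((1/2) ^ k) powr s \<le> (2 * r) powr s" using s by (intro powr_mono2) auto
      ultimately show "?m r \<le> (2 * r) powr s" using mono[of r "(1/2) ^ k"] by linarith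
    qed
    moreover have "\<forall>\<^sub>F r in at_right 0. a < s + s * ln 2 / ln r"
      using order_tendstoD(1)[OF lim s(3)] .
    moreover have "\<forall>\<^sub>F r in at_right 0. r \<in> {0<..<1::real}" by (rule eventually_at_right_real) simp
    ultimately show "\<forall>\<^sub>F r in at_right 0. a < ln (?m r) / ln r"
      using pos
    proof eventually_elim
      case (elim r)
      have "ln (?m r) \<le> ln ((2 * r) powr s)" using elim by (intro ln_mono) auto
      also have "\<dots> = s * ln 2 + s * ln r" using elim by (simp add: ln_powr ln_mult algebra_simps)
      finally have "(s * ln 2 + s * ln r) / ln r \<le> ln (?m r) / ln r" using elim by (intro divide_right_mono_neg) auto
      moreover have "(s * ln 2 + s * ln r) / ln r = s + s * ln 2 / ln r" using elim by (simp add: field_simps)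
      ultimately show ?case using elim by linarith
    qed
  next
    fix a assume a: "D < a"
    define s where "s = (a + D) / 2"
    have s: "0 < s" "D < s" "s < a" using a D by (auto simp: s_def)
    have "\<forall>\<^sub>F r in at_right 0. (r / 2) powr s \<le> ?m r"
    proof (rule bound[OF low[OF s(2)]])
      fix k and r :: real assume "0 < r" "(1/2) ^ Suc k < r" "r \<le> (1/2) ^ k" "((1/2) ^ Suc k) powr s \<le> ?m ((1/2) ^ Suc k)"
      moreover from this have "(r / 2) powr s \<le> ((1/2) ^ Suc k) powr s" using s by (intro powr_mono2) auto
      ultimately show "(r / 2) powr s \<le> ?m r" using mono[of "(1/2) ^ Suc k" r] by linarith
    qed
    moreover have "\<forall>\<^sub>F r in at_right 0. s + (- s * ln 2) / ln r < a"
      using order_tendstoD(2)[OF lim s(3)] .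
    moreover have "\<forall>\<^sub>F r in at_right 0. r \<in> {0<..<1::real}" by (rule eventually_at_right_real) simp
    ultimately show "\<forall>\<^sub>F r in at_right 0. ln (?m r) / ln r < a"
      using pos
    proof eventually_elim
      case (elim r)
      have "s * ln r - s * ln 2 = ln ((r / 2) powr s)" using elim by (simp add: ln_powr ln_div algebra_simps)
      also have "\<dots> \<le> ln (?m r)" using elim by (intro ln_mono) auto
      finally have "ln (?m r) / ln r \<le> (s * ln r - s * ln 2) / ln r" using elim by (intro divide_right_mono_neg) auto
      moreover have "(s * ln r - s * ln 2) / ln r = s + (- s * ln 2) / ln r" using elim by (simp add: field_simps)
      ultimately show ?case using elim by linarith
    qed
  qed
qed

section \<open>Invariant measures on compact sets\<close>

definition hit_sets :: "'a::euclidean_space set \<Rightarrow> real \<Rightarrow> real \<Rightarrow> 'a set set" where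
  "hit_sets K a b = {L \<in> compact_sets. L \<inter> K \<noteq> {} \<and> a \<le> diameter L \<and> diameter L < b}"

definition con_sets :: "'a::euclidean_space set \<Rightarrow> real \<Rightarrow> real \<Rightarrow> 'a set set" where
  "con_sets K a b = {L \<in> compact_sets. K \<subseteq> L \<and> a \<le> diameter L \<and> diameter L < b}"

lemma sized_measurable: "{L \<in> compact_sets. a \<le> diameter L \<and> diameter L < b} \<in> sets hausdorff_borel"
proof -
  have "{L \<in> space hausdorff_borel. a \<le> diameter L \<and> diameter L < b} \<in> sets hausdorff_borel"
    by measurable
  thus ?thesis by (simp add: space_hausdorff_borel)
qed

lemma hit_sets_measurable: "closed K \<Longrightarrow> hit_sets K a b \<in> sets hausdorff_borel"
  using sets.Int[OF hitting_measurable[of K] sized_measurable[of a b]]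
  by (simp add: hit_sets_def Collect_conj_eq Int_ac)

lemma con_sets_measurable: "con_sets K a b \<in> sets hausdorff_borel"
  using sets.Int[OF containing_measurable[of K] sized_measurable[of a b]]
  by (simp add: con_sets_def Collect_conj_eq Int_ac)

section \<open>Similarities acting on families of compact sets\<close>

lemma diameter_similarity:
  fixes f :: "'a::euclidean_space \<Rightarrow> 'a"
  assumes L: "L \<in> compact_sets" and f: "\<And>x y. dist (f x) (f y) = c * dist x y" and c: "c > 0"
  shows "diameter (f ` L) = c * diameter L"
proof -
  have L': "compact L" "L \<noteq> {}" using L by (auto simp: compact_sets_def)
  have bdd: "bounded L" using L' by (simp add: compact_imp_bounded)
  have bddf: "bounded (f ` L)"
  proof -
    obtain x e where "\<And>y. y \<in> L \<Longrightarrow> dist x y \<le> e" using bdd unfolding bounded_def by blast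
    thus ?thesis unfolding bounded_def using c f by (intro exI[of _ "f x"] exI[of _ "c * e"]) auto
  qed
  show ?thesis
  proof (rule antisym)
    show "diameter (f ` L) \<le> c * diameter L"
    proof (rule diameter_le)
      fix x y assume "x \<in> f ` L" "y \<in> f ` L"
      thus "norm (x - y) \<le> c * diameter L"
        using diameter_bounded_bound[OF bdd] c f by (auto simp: dist_norm[symmetric])
    qed (use L' in auto)
    have "diameter L \<le> diameter (f ` L) / c"
    proof (rule diameter_le)
      fix x y assume "x \<in> L" "y \<in> L"
      thus "norm (x - y) \<le> diameter (f ` L) / c"
        using diameter_bounded_bound[OF bddf, of "f x" "f y"] c f by (auto simp: dist_norm[symmetric] field_simps)
    qed (use L' in auto)
    thus "c * diameter L \<le> diameter (f ` L)" using c by (simp add: field_simps)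
  qed
qed

text \<open>M1 and M2 speak of images of families, while the families used here are given by
  predicates. Pulling the predicate back along the inverse map translates one into the
  other.\<close>

lemma image_compact_sets_Collect:
  assumes "continuous_on UNIV f" "continuous_on UNIV g" "\<And>x. f (g x) = x" "\<And>x. g (f x) = x"
  shows "image f ` {L \<in> compact_sets. \<Phi> L} = {M \<in> compact_sets. \<Phi> (g ` M)}"
proof safe
  fix L assume L: "L \<in> compact_sets" "\<Phi> L"
  show "f ` L \<in> compact_sets"
    using L assms(1) by (auto simp: compact_sets_def intro!: compact_continuous_image intro: continuous_on_subset)
  have "g ` f ` L = L" using assms(4) by (force simp: image_image)
  thus "\<Phi> (g ` f ` L)" using L by simp
next
  fix M assume M: "M \<in> compact_sets" "\<Phi> (g ` M)"
  have "M = f ` g ` M" using assms(3) by (force simp: image_image)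
  moreover have "g ` M \<in> compact_sets"
    using M assms(2) by (auto simp: compact_sets_def intro!: compact_continuous_image intro: continuous_on_subset)
  ultimately show "M \<in> (`) f ` {L \<in> compact_sets. \<Phi> L}" using M by blast
qed

lemma diameter_shift: "M \<in> compact_sets \<Longrightarrow> diameter ((\<lambda>x. x - t) ` M) = diameter (M :: 'a::euclidean_space set)"
  using diameter_similarity[of M "\<lambda>x. x - t" 1] by (simp add: dist_norm)

lemma diameter_scale: "M \<in> compact_sets \<Longrightarrow> s > 0 \<Longrightarrow> diameter ((\<lambda>x. x /\<^sub>R s) ` M) = diameter (M :: 'a::euclidean_space set) / s"
proof -
  assume M: "M \<in> compact_sets" and s: "s > 0"
  have "dist (x /\<^sub>R s) (y /\<^sub>R s) = inverse s * dist x y" for x y :: 'a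
    using s unfolding dist_norm scaleR_diff_right[symmetric] norm_scaleR by simp
  from diameter_similarity[OF M this] s show ?thesis by (simp add: divide_inverse mult.commute)
qed

text \<open>Each coordinate of \<open>L\<close> ranges over an interval no longer than the diameter;
  the centre collects the midpoints. A cube centred at a point of \<open>L\<close> could need
  half-side \<open>diameter L\<close>, which is too large for M3: there the diameter must exceed the
  half-side.\<close>

lemma bounding_box:
  fixes L :: "'a::euclidean_space set"
  assumes "L \<in> compact_sets"
  obtains c where "\<And>z i. z \<in> L \<Longrightarrow> i \<in> Basis \<Longrightarrow> \<bar>(z - c) \<bullet> i\<bar> \<le> diameter L / 2"
proof -
  have L: "compact L" "L \<noteq> {}" using assms by (auto simp: compact_sets_def)
  have "\<exists>m. \<forall>z\<in>L. \<bar>z \<bullet> i - m\<bar> \<le> diameter L / 2" if i: "i \<in> Basis" for i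
  proof -
    obtain u where u: "u \<in> L" "\<And>z. z \<in> L \<Longrightarrow> z \<bullet> i \<le> u \<bullet> i"
      using continuous_attains_sup[OF L, of "\<lambda>z. z \<bullet> i"] continuous_on_inner[OF continuous_on_id continuous_on_const] by blast
    obtain v where v: "v \<in> L" "\<And>z. z \<in> L \<Longrightarrow> v \<bullet> i \<le> z \<bullet> i"
      using continuous_attains_inf[OF L, of "\<lambda>z. z \<bullet> i"] continuous_on_inner[OF continuous_on_id continuous_on_const] by blast
    have "u \<bullet> i - v \<bullet> i \<le> norm (u - v)" using Basis_le_norm[OF i, of "u - v"] by (simp add: inner_diff_left)
    also have "\<dots> \<le> diameter L"
      using diameter_bounded_bound[OF compact_imp_bounded[OF L(1)] u(1) v(1)] by (simp add: dist_norm)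
    finally have "u \<bullet> i - v \<bullet> i \<le> diameter L" .
    hence "\<bar>z \<bullet> i - (u \<bullet> i + v \<bullet> i) / 2\<bar> \<le> diameter L / 2" if "z \<in> L" for z
      using u(2)[OF that] v(2)[OF that] unfolding abs_le_iff by (auto simp: field_simps)
    thus ?thesis by blast
  qed
  then obtain m where m: "\<And>i z. i \<in> Basis \<Longrightarrow> z \<in> L \<Longrightarrow> \<bar>z \<bullet> i - m i\<bar> \<le> diameter L / 2" by metis
  show ?thesis
  proof (rule that[of "\<Sum>i\<in>Basis. m i *\<^sub>R i"])
    fix z i assume "z \<in> L" "i \<in> (Basis :: 'a set)"
    thus "\<bar>(z - (\<Sum>i\<in>Basis. m i *\<^sub>R i)) \<bullet> i\<bar> \<le> diameter L / 2"
      using m[of i z] by (simp add: inner_diff_left inner_sum_left_Basis)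
  qed
qed

locale invariant_measure =
  fixes Q :: "'a::euclidean_space set measure"
  assumes Q_space: "space Q = compact_sets"
    and Q_sets: "sets Q = sets hausdorff_borel"
    and Q_sigma_finite: "sigma_finite_measure Q"
    and M1: "\<And>S t. S \<in> sets Q \<Longrightarrow>
               emeasure Q S = emeasure Q ((\<lambda>L. (\<lambda>x. x + t) ` L) ` S)"
    and M2: "\<And>S s. S \<in> sets Q \<Longrightarrow> s > 0 \<Longrightarrow>
               emeasure Q S = emeasure Q ((\<lambda>L. (\<lambda>x. s *\<^sub>R x) ` L) ` S)"
    and M3: "emeasure Q {L \<in> space Q. diameter L > 1 \<and> L \<subseteq> cbox (- One) One} < \<infinity>"
    and M4: "AE L in Q. emeasure lborel (frontier L) = 0"
begin

lemma sets_hit [measurable]: "closed K \<Longrightarrow> hit_sets K a b \<in> sets Q"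
  by (simp add: Q_sets hit_sets_measurable)

lemma sets_con [measurable]: "con_sets K a b \<in> sets Q"
  by (simp add: Q_sets con_sets_measurable)

lemma Q_translate:
  assumes "{L \<in> compact_sets. \<Phi> L} \<in> sets Q"
  shows "emeasure Q {M \<in> compact_sets. \<Phi> ((\<lambda>x. x - t) ` M)} = emeasure Q {L \<in> compact_sets. \<Phi> L}"
proof -
  have "image (\<lambda>x. x + t) ` {L \<in> compact_sets. \<Phi> L} = {M \<in> compact_sets. \<Phi> ((\<lambda>x. x - t) ` M)}"
    by (rule image_compact_sets_Collect) (auto intro!: continuous_intros)
  with M1[OF assms, of t] show ?thesis by argo
qed

lemma Q_scale:
  assumes "{L \<in> compact_sets. \<Phi> L} \<in> sets Q" "s > 0"
  shows "emeasure Q {M \<in> compact_sets. \<Phi> ((\<lambda>x. x /\<^sub>R s) ` M)} = emeasure Q {L \<in> compact_sets. \<Phi> L}"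
proof -
  have "image (\<lambda>x. s *\<^sub>R x) ` {L \<in> compact_sets. \<Phi> L} = {M \<in> compact_sets. \<Phi> ((\<lambda>x. x /\<^sub>R s) ` M)}"
    using assms(2) by (intro image_compact_sets_Collect) (auto intro!: continuous_intros)
  with M2[OF assms] show ?thesis by argo
qed

lemma Q_con_cball: "emeasure Q (con_sets (cball x r) a b) = emeasure Q (con_sets (cball 0 r) a b)"
proof -
  have sub: "cball 0 r \<subseteq> (\<lambda>z. z - x) ` M \<longleftrightarrow> cball x r \<subseteq> M" for M
  proof -
    have "u \<in> (\<lambda>z. z - x) ` cball x r" if "u \<in> cball 0 r" for u :: 'a
      using that by (intro image_eqI[of _ _ "u + x"]) (auto simp: dist_norm)
    hence "cball 0 r = (\<lambda>z. z - x) ` cball x r" by (auto simp: dist_norm norm_minus_commute)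
    thus ?thesis by (simp add: inj_image_subset_iff)
  qed
  show ?thesis
    using Q_translate[of "\<lambda>L. cball 0 r \<subseteq> L \<and> a \<le> diameter L \<and> diameter L < b" x] sets_con[of "cball 0 r" a b]
    by (simp add: con_sets_def sub diameter_shift cong: conj_cong)
qed

lemma Q_hit_cball: "emeasure Q (hit_sets (cball x r) a b) = emeasure Q (hit_sets (cball 0 r) a b)"
proof -
  have sub: "(\<lambda>z. z - x) ` M \<inter> cball 0 r = {} \<longleftrightarrow> M \<inter> cball x r = {}" for M
    by (auto simp: disjoint_iff dist_norm norm_minus_commute)
  show ?thesis
    using Q_translate[of "\<lambda>L. L \<inter> cball 0 r \<noteq> {} \<and> a \<le> diameter L \<and> diameter L < b" x] sets_hit[of "cball 0 r" a b]
    by (simp add: hit_sets_def sub diameter_shift cong: conj_cong)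
qed

lemma Q_con_scale:
  assumes "s > 0"
  shows "emeasure Q (con_sets (cball 0 (s * r)) (s * a) (s * b)) = emeasure Q (con_sets (cball 0 r) a b)"
proof -
  have sub: "cball 0 r \<subseteq> (\<lambda>z. z /\<^sub>R s) ` M \<longleftrightarrow> cball 0 (s * r) \<subseteq> M" for M :: "'a set"
  proof -
    have "u \<in> (\<lambda>z. z /\<^sub>R s) ` cball 0 (s * r)" if "u \<in> cball 0 r" for u :: 'a
    proof (rule image_eqI)
      show "u = (s *\<^sub>R u) /\<^sub>R s" using assms unfolding scaleR_scaleR by simp
      show "s *\<^sub>R u \<in> cball 0 (s * r)" using that assms by simp
    qed
    moreover have "u /\<^sub>R s \<in> cball 0 r" if "u \<in> cball 0 (s * r)" for u :: 'a
      using that assms by (simp add: field_simps)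
    ultimately have "cball (0 :: 'a) r = (\<lambda>z. z /\<^sub>R s) ` cball 0 (s * r)" by blast
    moreover have "inj (\<lambda>z :: 'a. z /\<^sub>R s)" using assms by (auto intro!: injI)
    ultimately show ?thesis by (simp add: inj_image_subset_iff)
  qed
  show ?thesis
    using Q_scale[of "\<lambda>L. cball 0 r \<subseteq> L \<and> a \<le> diameter L \<and> diameter L < b" s] sets_con[of "cball 0 r" a b] assms
    by (simp add: con_sets_def sub diameter_scale pos_le_divide_eq pos_divide_less_eq mult.commute[of s a] mult.commute[of s b] cong: conj_cong)
qed

section \<open>Finiteness of the family of sets that hit a ball\<close>

lemma Q_box_finite:
  assumes s: "s > 0"
  shows "emeasure Q {L \<in> compact_sets. s < diameter L \<and> L \<subseteq> cbox (x - s *\<^sub>R One) (x + s *\<^sub>R One)} < \<infinity>" (is "emeasure Q ?A < _")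
    and "{L \<in> compact_sets. s < diameter L \<and> L \<subseteq> cbox (x - s *\<^sub>R One) (x + s *\<^sub>R One)} \<in> sets Q"
proof -
  have meas: "{L \<in> compact_sets. s < diameter L \<and> L \<subseteq> cbox u v} \<in> sets Q" for s :: real and u v :: 'a
  proof -
    have "{L \<in> space hausdorff_borel. s < diameter L} \<in> sets (hausdorff_borel :: 'a set measure)" by measurable
    from sets.Int[OF this contained_measurable[OF closed_cbox[of u v]]]
    show ?thesis by (simp add: Q_sets space_hausdorff_borel Collect_conj_eq Int_ac)
  qed
  show "?A \<in> sets Q" by (rule meas)
  have sub1: "(\<lambda>z. z /\<^sub>R s) ` M \<subseteq> cbox (- One) One \<longleftrightarrow> M \<subseteq> cbox (- (s *\<^sub>R One)) (s *\<^sub>R One)" for M :: "'a set"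
    using s by (auto simp: subset_iff mem_box field_simps inner_Basis)
  have sub2: "(\<lambda>z. z - x) ` M \<subseteq> cbox (- (s *\<^sub>R One)) (s *\<^sub>R One) \<longleftrightarrow> M \<subseteq> cbox (x - s *\<^sub>R One) (x + s *\<^sub>R One)" for M :: "'a set"
    by (auto simp: subset_iff mem_box algebra_simps)
  have "emeasure Q ?A = emeasure Q {L \<in> compact_sets. s < diameter L \<and> L \<subseteq> cbox (- (s *\<^sub>R One)) (s *\<^sub>R One)}"
    using Q_translate[of "\<lambda>L. s < diameter L \<and> L \<subseteq> cbox (- (s *\<^sub>R One)) (s *\<^sub>R One)" x] meas
    by (simp add: sub2 diameter_shift cong: conj_cong)
  also have "\<dots> = emeasure Q {L \<in> compact_sets. 1 < diameter L \<and> L \<subseteq> cbox (- One) One}"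
    using Q_scale[of "\<lambda>L. 1 < diameter L \<and> L \<subseteq> cbox (- One) One" s] meas s
    by (simp add: sub1 diameter_scale pos_less_divide_eq cong: conj_cong)
  also have "\<dots> < \<infinity>" using M3 by (simp add: Q_space)
  finally show "emeasure Q ?A < \<infinity>" .
qed

text \<open>M3 applies to sets of diameter above \<open>s\<close> inside a cube of half-side
  \<open>s\<close>. A diameter below \<open>3/2 * s\<close> gives a bounding cube of half-side
  \<open>3/4 * s\<close>, so its centre may be moved by \<open>s / 4\<close> to one of finitely many
  grid points. The lower end \<open>4/3 * s\<close> lies above \<open>s\<close>, and the admissible
  range covers a factor 9/8.\<close>

lemma Q_hit_finite_step:
  assumes s: "s > 0"
  shows "emeasure Q (hit_sets (cball 0 R) (4/3 * s) (3/2 * s)) < \<infinity>"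
proof -
  obtain k where k: "(1/2) ^ k < s / 4" using real_arch_pow_inv[of "s/4" "1/2"] s by auto
  \<comment> \<open>The centre of the bounding cube differs by at most \<open>s\<close> in each
    coordinate from a point of \<open>L\<close> in \<open>cball 0 R\<close>, whence the enlarged
    radius.\<close>
  obtain C where "\<And>k. \<exists>I. finite I \<and> real (card I) \<le> C * 2 ^ (k * DIM('a)) \<and>
      cball 0 (R + DIM('a) * s) \<subseteq> (\<Union>c\<in>I. cball (c::'a) ((1/2) ^ k))"
    using grid_cover[OF bounded_cball] by metis
  then obtain I where I: "finite I" "cball 0 (R + DIM('a) * s) \<subseteq> (\<Union>c\<in>I. cball (c::'a) ((1/2) ^ k))" by meson
  let ?B = "\<lambda>x. {L \<in> compact_sets. s < diameter L \<and> L \<subseteq> cbox (x - s *\<^sub>R One) (x + s *\<^sub>R One)}"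
  have "hit_sets (cball 0 R) (4/3 * s) (3/2 * s) \<subseteq> (\<Union>x\<in>I. ?B x)"
  proof
    fix L :: "'a set" assume "L \<in> hit_sets (cball 0 R) (4/3 * s) (3/2 * s)"
    then obtain z where L: "L \<in> compact_sets" "s < diameter L" "diameter L < 3/2 * s" "z \<in> L" "norm z \<le> R"
      using s by (auto simp: hit_sets_def)
    obtain c where c: "\<And>z i. z \<in> L \<Longrightarrow> i \<in> Basis \<Longrightarrow> \<bar>(z - c) \<bullet> i\<bar> \<le> diameter L / 2"
      using bounding_box[OF L(1)] by blast
    have "norm (z - c) \<le> (\<Sum>i\<in>Basis. \<bar>(z - c) \<bullet> i\<bar>)" by (rule norm_le_l1)
    also have "\<dots> \<le> (\<Sum>i\<in>(Basis::'a set). s)"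
      using L(3) s by (intro sum_mono order_trans[OF c[OF L(4)]]) auto
    finally have "norm c \<le> R + DIM('a) * s"
      using L(5) norm_triangle_ineq4[of z "z - c"] by simp
    then obtain x where x: "x \<in> I" "dist x c \<le> (1/2) ^ k" using I(2) by (auto simp: subset_iff)
    have "y \<in> cbox (x - s *\<^sub>R One) (x + s *\<^sub>R One)" if y: "y \<in> L" for y
      unfolding mem_box
    proof
      fix i :: 'a assume i: "i \<in> Basis"
      have "\<bar>(x - c) \<bullet> i\<bar> \<le> s / 4"
        using Basis_le_norm[OF i, of "x - c"] x(2) k by (simp add: dist_norm)
      hence "\<bar>(y - x) \<bullet> i\<bar> \<le> s"
        using c[OF y i] L(3) unfolding abs_le_iff inner_diff_left by linarith
      thus "(x - s *\<^sub>R One) \<bullet> i \<le> y \<bullet> i \<and> y \<bullet> i \<le> (x + s *\<^sub>R One) \<bullet> i"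
        using i unfolding abs_le_iff by (simp add: inner_diff_left inner_add_left)
    qed
    thus "L \<in> (\<Union>x\<in>I. ?B x)" using x L by blast
  qed
  hence "emeasure Q (hit_sets (cball 0 R) (4/3 * s) (3/2 * s)) \<le> emeasure Q (\<Union>x\<in>I. ?B x)"
    using I(1) Q_box_finite(2)[OF s] by (intro emeasure_mono sets.finite_UN) auto
  also have "\<dots> \<le> (\<Sum>x\<in>I. emeasure Q (?B x))"
    using I(1) Q_box_finite(2)[OF s] by (intro emeasure_subadditive_finite) auto
  also have "\<dots> < \<infinity>" using I(1) Q_box_finite(1)[OF s] by simp
  finally show ?thesis .
qed

lemma Q_hit_finite:
  assumes a: "a > 0"
  shows "emeasure Q (hit_sets (cball x R) a b) < \<infinity>"
proof -
  have step: "emeasure Q (hit_sets (cball 0 R) a ((9/8) ^ n * a)) < \<infinity>" for n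
  proof (induction n)
    case 0
    have "hit_sets (cball (0::'a) R) a a = {}" by (auto simp: hit_sets_def)
    thus ?case by simp
  next
    case (Suc n)
    have "emeasure Q (hit_sets (cball 0 R) a ((9/8) ^ Suc n * a)) \<le>
        emeasure Q (hit_sets (cball 0 R) a ((9/8) ^ n * a) \<union> hit_sets (cball 0 R) ((9/8) ^ n * a) ((9/8) ^ Suc n * a))"
      by (intro emeasure_mono sets.Un sets_hit) (auto simp: hit_sets_def)
    also have "\<dots> \<le> emeasure Q (hit_sets (cball 0 R) a ((9/8) ^ n * a)) +
        emeasure Q (hit_sets (cball 0 R) ((9/8) ^ n * a) ((9/8) ^ Suc n * a))"
      by (intro emeasure_subadditive) auto
    \<comment> \<open>With \<open>s\<close> equal to 3/4 of the current lower end, the range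
      \<open>4/3 * s\<close> to \<open>3/2 * s\<close> is exactly the next factor 9/8.\<close>
    also have "\<dots> < \<infinity>"
      using Suc Q_hit_finite_step[of "(3/4) * ((9/8) ^ n * a)" R] a by (simp add: mult_ac)
    finally show ?case .
  qed
  obtain n where "b / a < (9/8) ^ n" using real_arch_pow[of "9/8" "b / a"] by auto
  hence "b \<le> (9/8) ^ n * a" using a by (simp add: field_simps)
  hence "emeasure Q (hit_sets (cball 0 R) a b) \<le> emeasure Q (hit_sets (cball 0 R) a ((9/8) ^ n * a))"
    by (intro emeasure_mono sets_hit) (auto simp: hit_sets_def)
  thus ?thesis using step[of n] Q_hit_cball[of x R a b] by simp
qed

lemma Q_con_finite:
  assumes "a > 0" "K \<noteq> {}"
  shows "emeasure Q (con_sets K a b) < \<infinity>"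
proof -
  obtain x where x: "x \<in> K" using assms by blast
  have "emeasure Q (con_sets K a b) \<le> emeasure Q (hit_sets (cball x 0) a b)"
    using x by (intro emeasure_mono sets_hit) (auto simp: con_sets_def hit_sets_def)
  thus ?thesis using Q_hit_finite[OF assms(1), of x 0 b] by simp
qed

text \<open>By translation invariance the measure is the same for all \<open>x\<close>. Integrated
  over the whole space it equals, by Fubini, the integral of the volumes of frontiers, which is 0 by
  M4; a constant whose product with infinite volume is 0 must be 0.\<close>

lemma frontier_null: "emeasure Q {L \<in> compact_sets. x \<in> frontier L \<and> a \<le> diameter L \<and> diameter L < b} = 0"
proof -
  interpret sigma_finite_measure Q by (rule Q_sigma_finite)
  interpret pair_sigma_finite lborel Q ..
  define E where "E = {(x :: 'a, L). L \<in> compact_sets \<and> x \<in> frontier L \<and> a \<le> diameter L \<and> diameter L < b}"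
  have "E = {(x, L). L \<in> compact_sets \<and> x \<in> frontier L} \<inter>
      (UNIV \<times> {L \<in> compact_sets. a \<le> diameter L \<and> diameter L < b})"
    by (auto simp: E_def)
  also have "\<dots> \<in> sets (borel \<Otimes>\<^sub>M hausdorff_borel)"
    by (intro sets.Int frontier_pair_measurable pair_measureI sized_measurable) auto
  also have "sets (borel \<Otimes>\<^sub>M hausdorff_borel) = sets (lborel \<Otimes>\<^sub>M Q)"
    using Q_sets by (intro sets_pair_measure_cong) auto
  finally have E: "E \<in> sets (lborel \<Otimes>\<^sub>M Q)" .
  have E1: "Pair x -` E = {L \<in> compact_sets. x \<in> frontier L \<and> a \<le> diameter L \<and> diameter L < b}" for x
    by (auto simp: E_def)
  have const: "emeasure Q (Pair x -` E) = emeasure Q (Pair 0 -` E)" for x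
  proof -
    have fr: "0 \<in> frontier ((\<lambda>z. z - x) ` M) \<longleftrightarrow> x \<in> frontier M" for M
    proof -
      have "(\<lambda>z. z - x) ` M = (+) (- x) ` M" by (simp add: image_def)
      hence "frontier ((\<lambda>z. z - x) ` M) = (+) (- x) ` frontier M" by (simp only: frontier_translation)
      thus ?thesis by (auto simp: image_iff)
    qed
    have "Pair 0 -` E \<in> sets Q" using E by (rule sets_Pair1)
    thus ?thesis
      using Q_translate[of "\<lambda>L. 0 \<in> frontier L \<and> a \<le> diameter L \<and> diameter L < b" x]
      unfolding E1 by (simp add: fr diameter_shift cong: conj_cong)
  qed
  have "emeasure Q (Pair 0 -` E) * emeasure lborel (UNIV :: 'a set) = (\<integral>\<^sup>+x. emeasure Q (Pair x -` E) \<partial>lborel)"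
    by (subst nn_integral_cong[OF const]) (simp only: nn_integral_const space_lborel space_borel sets_lborel)
  also have "\<dots> = emeasure (lborel \<Otimes>\<^sub>M Q) E" using E by (rule sigma_finite_measure.emeasure_pair_measure_alt[OF Q_sigma_finite, symmetric])
  also have "\<dots> = (\<integral>\<^sup>+L. emeasure lborel ((\<lambda>x. (x, L)) -` E) \<partial>Q)" using E by (rule emeasure_pair_measure_alt2)
  also have "\<dots> = (\<integral>\<^sup>+L. 0 \<partial>Q)"
  proof (rule nn_integral_cong_AE, use M4 in eventually_elim)
    fix L :: "'a set" assume "emeasure lborel (frontier L) = 0"
    moreover have "emeasure lborel ((\<lambda>x. (x, L)) -` E) \<le> emeasure lborel (frontier L)"
      by (intro emeasure_mono) (auto simp: E_def)
    ultimately show "emeasure lborel ((\<lambda>x. (x, L)) -` E) = 0" by simp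
  qed
  finally have "emeasure Q (Pair 0 -` E) = 0" by simp
  thus ?thesis using const[of x] E1[of x] by simp
qed

text \<open>A closed set that meets every ball about 0 and contains none has 0 on its frontier.
  Continuity from above applies because the hitting families have finite measure.\<close>

lemma measure_near_boundary_tendsto:
  assumes "a > 0"
  shows "(\<lambda>k. measure Q (hit_sets (cball 0 ((1/2) ^ k)) a b - con_sets (cball 0 ((1/2) ^ k)) a b)) \<longlonglongrightarrow> 0"
proof -
  let ?A = "\<lambda>k. hit_sets (cball 0 ((1/2) ^ k)) a b - con_sets (cball (0::'a) ((1/2) ^ k)) a b"
  have meas: "?A k \<in> sets Q" for k by auto
  have fin: "emeasure Q (?A k) < \<infinity>" for k
    using Q_hit_finite[OF assms, of 0 "(1/2) ^ k" b] emeasure_mono[of "?A k" "hit_sets (cball 0 ((1/2) ^ k)) a b" Q] by auto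
  have dec: "decseq ?A"
  proof (rule decseq_SucI, rule subsetI)
    fix k L assume "L \<in> ?A (Suc k)"
    moreover have "cball 0 ((1/2) ^ Suc k) \<subseteq> cball (0::'a) ((1/2) ^ k)" by (rule subset_cball) simp
    ultimately show "L \<in> ?A k" unfolding hit_sets_def con_sets_def by blast
  qed
  have "(\<Inter>k. ?A k) \<subseteq> {L \<in> compact_sets. 0 \<in> frontier L \<and> a \<le> diameter L \<and> diameter L < b}"
  proof
    fix L assume L: "L \<in> (\<Inter>k. ?A k)"
    hence L1: "L \<in> compact_sets" "a \<le> diameter L" "diameter L < b" and
      hit: "\<And>k. L \<inter> cball 0 ((1/2) ^ k) \<noteq> {}" and ncon: "\<And>k. \<not> cball 0 ((1/2) ^ k) \<subseteq> L"
      by (auto simp: hit_sets_def con_sets_def)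
    have cl: "closed L" using L1 by (simp add: compact_sets_def compact_imp_closed)
    have ex: "\<exists>k. (1/2) ^ k < e" if "e > 0" for e :: real using real_arch_pow_inv[OF that, of "1/2"] by auto
    have "0 \<in> closure L" unfolding closure_approachable
    proof (intro allI impI)
      fix e :: real assume "e > 0"
      then obtain k where k: "(1/2) ^ k < e" using ex by blast
      obtain y where "y \<in> L" "norm y \<le> (1/2) ^ k" using hit[of k] by auto
      thus "\<exists>y\<in>L. dist y 0 < e" using k by (intro bexI[of _ y]) auto
    qed
    moreover have "0 \<notin> interior L"
    proof
      assume "0 \<in> interior L"
      then obtain e where e: "e > 0" "cball 0 e \<subseteq> L" by (meson mem_interior_cball)
      then obtain k where k: "(1/2) ^ k < e" using ex by blast
      thus False using ncon[of k] e subset_cball[of "(1/2) ^ k" e "0::'a"] by auto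
    qed
    ultimately show "L \<in> {L \<in> compact_sets. 0 \<in> frontier L \<and> a \<le> diameter L \<and> diameter L < b}"
      using L1 by (simp add: frontier_def)
  qed
  note sub = this
  have fr: "{L \<in> compact_sets. 0 \<in> frontier L \<and> a \<le> diameter L \<and> diameter L < b} \<in> sets Q"
  proof -
    have "Pair 0 -` {(x :: 'a, L). L \<in> compact_sets \<and> x \<in> frontier L} \<in> sets hausdorff_borel"
      by (intro sets_Pair1[OF frontier_pair_measurable])
    from sets.Int[OF this sized_measurable[of a b]] show ?thesis
      by (simp add: Q_sets Collect_conj_eq vimage_def Int_ac)
  qed
  have zero: "emeasure Q (\<Inter>k. ?A k) = 0"
    using emeasure_mono[OF sub fr] frontier_null[of 0 a b] by simp
  have "(\<lambda>k. emeasure Q (?A k)) \<longlonglongrightarrow> emeasure Q (\<Inter>k. ?A k)"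
    using meas dec fin by (intro Lim_emeasure_decseq) (auto simp: less_top)
  hence "(\<lambda>k. enn2real (emeasure Q (?A k))) \<longlonglongrightarrow> enn2real 0"
    unfolding zero by (intro tendsto_enn2real) auto
  thus ?thesis by (simp add: measure_def)
qed

end

section \<open>Uncovered points\<close>

lemma two_powr_eq_half_power: "2 powr (- real n) = (1/2 :: real) ^ n"
  by (simp add: powr_minus powr_realpow power_one_over inverse_eq_divide)

lemma npoints_eq_0_iff: "npoints S Z = enat 0 \<longleftrightarrow> S \<inter> Z = {}"
  by (auto simp: npoints_def)

locale poisson_cutout = invariant_measure Q
  for Q :: "'a::euclidean_space set measure" +
  fixes P :: "'p measure" and Y :: "'p \<Rightarrow> 'a set set" and \<alpha> :: real
  assumes PPP: "poisson_point_process P Y Q"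
    and alpha_def: "2 powr (- \<alpha>) = measure P {\<omega> \<in> space P. 0 \<notin> Delta (1/2) 1 (Y \<omega>)}"
    and alpha_nonneg: "0 \<le> \<alpha>"
    and alpha_lt: "\<alpha> < real DIM('a)"
begin

sublocale prob_space P
  using PPP by (simp add: poisson_point_process_def)

lemma Y_sub: "\<omega> \<in> space P \<Longrightarrow> Y \<omega> \<subseteq> compact_sets"
  using PPP by (simp add: poisson_point_process_def Q_space)

lemma npoints_measurable: "S \<in> sets Q \<Longrightarrow> (\<lambda>\<omega>. npoints S (Y \<omega>)) \<in> measurable P (count_space UNIV)"
  using PPP by (simp add: poisson_point_process_def)

section \<open>Void probabilities and dyadic layers of diameters\<close>

lemma void_event: assumes "S \<in> sets Q" shows "{\<omega> \<in> space P. S \<inter> Y \<omega> = {}} \<in> sets P"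
proof -
  have "(\<lambda>\<omega>. npoints S (Y \<omega>)) -` {enat 0} \<inter> space P \<in> sets P"
    using npoints_measurable[OF assms] by (rule measurable_sets) simp
  also have "(\<lambda>\<omega>. npoints S (Y \<omega>)) -` {enat 0} \<inter> space P = {\<omega> \<in> space P. S \<inter> Y \<omega> = {}}"
    using npoints_eq_0_iff[of S] by blast
  finally show ?thesis .
qed

lemma void_prob:
  assumes "S \<in> sets Q" "emeasure Q S < \<infinity>"
  shows "prob {\<omega> \<in> space P. S \<inter> Y \<omega> = {}} = exp (- measure Q S)"
proof -
  have "prob {\<omega> \<in> space P. npoints S (Y \<omega>) = enat 0} = exp (- measure Q S) * measure Q S ^ 0 / fact 0"
    using PPP assms unfolding poisson_point_process_def by blast
  thus ?thesis by (simp only: npoints_eq_0_iff) simp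
qed

text \<open>The Poisson weights of the finite counts already sum to 1. This is the source of local
  finiteness of the cutouts.\<close>

lemma AE_finite_points:
  assumes "S \<in> sets Q" "emeasure Q S < \<infinity>"
  shows "AE \<omega> in P. finite (S \<inter> Y \<omega>)"
proof -
  let ?A = "\<lambda>k. {\<omega> \<in> space P. npoints S (Y \<omega>) = enat k}"
  have meas: "?A k \<in> sets P" for k
  proof -
    have "(\<lambda>\<omega>. npoints S (Y \<omega>)) -` {enat k} \<inter> space P \<in> sets P"
      using npoints_measurable[OF assms(1)] by (rule measurable_sets) simp
    thus ?thesis by (simp add: vimage_def Int_def conj_commute)
  qed
  have "(\<lambda>k. exp (- measure Q S) * (measure Q S ^ k /\<^sub>R fact k)) sums (exp (- measure Q S) * exp (measure Q S))"
    by (intro sums_mult exp_converges)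
  hence "(\<lambda>k. exp (- measure Q S) * measure Q S ^ k / fact k) sums 1"
    by (simp add: exp_minus field_simps)
  moreover have "prob (?A k) = exp (- measure Q S) * measure Q S ^ k / fact k" for k
    using PPP assms unfolding poisson_point_process_def by blast
  ultimately have "(\<lambda>k. prob (?A k)) sums 1" by simp
  moreover have "(\<lambda>k. prob (?A k)) sums prob (\<Union>k. ?A k)"
    using meas by (intro finite_measure_UNION) (auto simp: disjoint_family_on_def)
  ultimately have "prob (\<Union>k. ?A k) = 1" by (rule sums_unique2[symmetric])
  hence "AE \<omega> in P. \<omega> \<in> (\<Union>k. ?A k)" using meas by (intro prob_eq_1[THEN iffD1]) auto
  thus ?thesis by eventually_elim (auto simp: npoints_def split: if_splits)
qed

abbreviation (input) pt :: "nat \<Rightarrow> 'a \<Rightarrow> 'a set set" where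
  "pt n x \<equiv> con_sets {x} ((1/2) ^ n) 1"

lemma pt_finite: "emeasure Q (pt n x) < \<infinity>"
  by (rule Q_con_finite) auto

lemma fmeasurable_hit: "a > 0 \<Longrightarrow> hit_sets (cball x r) a b \<in> fmeasurable Q"
  using Q_hit_finite[of a x r b] by (intro fmeasurableI) auto

lemma fmeasurable_con: "a > 0 \<Longrightarrow> K \<noteq> {} \<Longrightarrow> con_sets K a b \<in> fmeasurable Q"
  using Q_con_finite[of a K b] by (intro fmeasurableI) auto

lemma not_in_Delta_iff:
  assumes "\<omega> \<in> space P"
  shows "x \<notin> Delta a b (Y \<omega>) \<longleftrightarrow> con_sets {x} a b \<inter> Y \<omega> = {}"
  using Y_sub[OF assms] by (auto simp: Delta_def con_sets_def)

lemma measure_pt_1: "measure Q (con_sets {0} (1/2) 1) = \<alpha> * ln 2"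
proof -
  have "{\<omega> \<in> space P. 0 \<notin> Delta (1/2) 1 (Y \<omega>)} = {\<omega> \<in> space P. con_sets {0} (1/2) 1 \<inter> Y \<omega> = {}}"
    using not_in_Delta_iff by blast
  hence "2 powr (- \<alpha>) = exp (- measure Q (con_sets {0} (1/2) 1))"
    using alpha_def void_prob[of "con_sets {0} (1/2) 1"] Q_con_finite[of "1/2" "{0}" 1] by simp
  thus ?thesis by (simp add: powr_def)
qed

text \<open>Scaling by \<open>2 ^ j\<close> carries the layer of diameters
  \<open>[2^-(j+1), 2^-j)\<close> to \<open>[1/2, 1)\<close> and the radius
  \<open>\<theta> * (1/2) ^ n\<close> to \<open>\<theta> * (1/2) ^ (n - j)\<close>. The induction
  runs over \<open>m\<close> with the ball fixed; \<open>\<theta> = 0\<close> treats points and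
  \<open>\<theta> = 1\<close> balls.\<close>

lemma measure_con_layers:
  assumes "m \<le> n" and \<theta>: "\<theta> \<ge> 0"
  shows "measure Q (con_sets (cball x (\<theta> * (1/2) ^ n)) ((1/2) ^ m) 1)
    = (\<Sum>j<m. measure Q (con_sets (cball 0 (\<theta> * (1/2) ^ (n - j))) (1/2) 1))"
  using assms(1)
proof (induction m)
  case 0
  have "con_sets (cball x (\<theta> * (1/2) ^ n)) 1 1 = {}" by (auto simp: con_sets_def)
  thus ?case by simp
next
  case (Suc m)
  let ?K = "cball x (\<theta> * (1/2) ^ n)"
  have ne: "?K \<noteq> {}" using \<theta> by (simp add: not_less)
  have "con_sets ?K ((1/2) ^ Suc m) 1 = con_sets ?K ((1/2) ^ m) 1 \<union> con_sets ?K ((1/2) ^ Suc m) ((1/2) ^ m)"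
  proof -
    have h: "(1/2) ^ Suc m \<le> ((1/2) ^ m :: real)" "(1/2) ^ m \<le> (1 :: real)"
      by (simp_all add: power_le_one)
    show ?thesis
      by (auto simp: con_sets_def simp del: power_Suc intro: order_trans[OF h(1)] less_le_trans[OF _ h(2)])
  qed
  note * = this
  have "measure Q (con_sets ?K ((1/2) ^ Suc m) 1) =
      measure Q (con_sets ?K ((1/2) ^ m) 1) + measure Q (con_sets ?K ((1/2) ^ Suc m) ((1/2) ^ m))"
  proof -
    have "con_sets ?K ((1/2) ^ m) 1 \<inter> con_sets ?K ((1/2) ^ Suc m) ((1/2) ^ m) = {}"
      unfolding con_sets_def by fastforce
    thus ?thesis
      using measure_Un3[OF fmeasurable_con[OF _ ne] fmeasurable_con[OF _ ne], of "(1/2) ^ m" "(1/2) ^ Suc m" 1 "(1/2) ^ m"] *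
      by simp
  qed
  moreover have "measure Q (con_sets ?K ((1/2) ^ Suc m) ((1/2) ^ m)) = measure Q (con_sets (cball 0 (\<theta> * (1/2) ^ (n - m))) (1/2) 1)"
  proof -
    have "(1/2 :: real) ^ n = (1/2) ^ m * (1/2) ^ (n - m)" using Suc.prems by (simp flip: power_add)
    hence "emeasure Q (con_sets ?K ((1/2) ^ Suc m) ((1/2) ^ m)) = emeasure Q (con_sets (cball 0 (\<theta> * (1/2) ^ (n - m))) (1/2) 1)"
      using Q_con_scale[of "(1/2) ^ m" "\<theta> * (1/2) ^ (n - m)" "1/2" 1] Q_con_cball[of x "\<theta> * (1/2) ^ n"]
      by (simp add: mult_ac)
    thus ?thesis by (simp add: measure_def)
  qed
  ultimately show ?case using Suc by simp
qed

lemma measure_pt: "measure Q (pt n x) = real n * \<alpha> * ln 2"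
  using measure_con_layers[of n n 0 x] measure_pt_1 by simp

text \<open>A set through 0 either contains the small ball or hits it without containing it, and the
  second family becomes negligible.\<close>

lemma measure_con_half_tendsto:
  "(\<lambda>i. measure Q (con_sets (cball 0 ((1/2) ^ i)) (1/2) 1)) \<longlonglongrightarrow> \<alpha> * ln 2"
proof -
  let ?c = "\<lambda>i. con_sets (cball (0::'a) ((1/2) ^ i)) (1/2) 1"
  let ?h = "\<lambda>i. hit_sets (cball (0::'a) ((1/2) ^ i)) (1/2) 1"
  have low: "\<alpha> * ln 2 - measure Q (?h i - ?c i) \<le> measure Q (?c i)" for i
  proof -
    have "measure Q (con_sets {0} (1/2) 1) \<le> measure Q ((?h i - ?c i) \<union> ?c i)"
    proof (rule measure_mono_fmeasurable)
      show "(?h i - ?c i) \<union> ?c i \<in> fmeasurable Q"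
        by (intro fmeasurable.Un fmeasurable.Diff fmeasurable_hit fmeasurable_con) auto
      show "con_sets {0} (1/2) 1 \<subseteq> (?h i - ?c i) \<union> ?c i"
        by (force simp: con_sets_def hit_sets_def)
    qed (rule sets_con)
    also have "\<dots> \<le> measure Q (?h i - ?c i) + measure Q (?c i)" by (intro measure_Un_le sets.Diff sets_hit sets_con) simp
    finally show ?thesis by (simp add: measure_pt_1)
  qed
  have up: "measure Q (?c i) \<le> \<alpha> * ln 2" for i
  proof -
    have "measure Q (?c i) \<le> measure Q (con_sets {0} (1/2) 1)"
      by (intro measure_mono_fmeasurable sets_con fmeasurable_con) (auto simp: con_sets_def subset_iff)
    thus ?thesis by (simp add: measure_pt_1)
  qed
  have "(\<lambda>i. \<alpha> * ln 2 - measure Q (?h i - ?c i)) \<longlonglongrightarrow> \<alpha> * ln 2 - 0"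
    by (intro tendsto_diff tendsto_const measure_near_boundary_tendsto) simp
  hence lim: "(\<lambda>i. \<alpha> * ln 2 - measure Q (?h i - ?c i)) \<longlonglongrightarrow> \<alpha> * ln 2" by (simp only: diff_zero)
  show ?thesis
    by (rule tendsto_sandwich[OF always_eventually always_eventually lim tendsto_const]) (use low up in blast)+
qed

text \<open>In the layers with \<open>n - j\<close> at least \<open>K\<close> the rescaled ball is
  so small that almost nothing is lost compared with a point. Fewer than \<open>K\<close> layers
  remain, and their loss is the constant \<open>c\<close>, independent of \<open>n\<close>.\<close>

lemma measure_con_cball_ge:
  assumes "\<epsilon> > 0"
  obtains c where "\<And>n x. measure Q (con_sets (cball x ((1/2) ^ n)) ((1/2) ^ n) 1) \<ge> real n * (\<alpha> * ln 2 - \<epsilon>) - c"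
proof -
  let ?e = "\<lambda>i. measure Q (con_sets (cball (0::'a) ((1/2) ^ i)) (1/2) 1)"
  have "\<forall>\<^sub>F i in sequentially. \<alpha> * ln 2 - \<epsilon> < ?e i"
    using order_tendstoD(1)[OF measure_con_half_tendsto] assms by simp
  then obtain K where K: "\<And>i. i \<ge> K \<Longrightarrow> \<alpha> * ln 2 - \<epsilon> < ?e i" unfolding eventually_sequentially by blast
  have "measure Q (con_sets (cball x ((1/2) ^ n)) ((1/2) ^ n) 1) \<ge> real n * (\<alpha> * ln 2 - \<epsilon>) - real K * (\<alpha> * ln 2)" for n x
  proof -
    have "measure Q (con_sets (cball x ((1/2) ^ n)) ((1/2) ^ n) 1) = (\<Sum>j<n. ?e (n - j))"
      using measure_con_layers[of n n 1 x] by simp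
    also have "\<dots> \<ge> (\<Sum>j<n. (\<alpha> * ln 2 - \<epsilon>) - (if n - j < K then \<alpha> * ln 2 else 0))"
    proof (rule sum_mono)
      fix j
      have e0: "?e (n - j) \<ge> 0" by simp
      show "(\<alpha> * ln 2 - \<epsilon>) - (if n - j < K then \<alpha> * ln 2 else 0) \<le> ?e (n - j)"
      proof (cases "n - j < K")
        case True
        hence "(if n - j < K then \<alpha> * ln 2 else 0) = \<alpha> * ln 2" by simp
        thus ?thesis using e0 assms by linarith
      next
        case False
        hence "(if n - j < K then \<alpha> * ln 2 else 0) = 0" by simp
        thus ?thesis using K[of "n - j"] False by linarith
      qed
    qed
    also have "(\<Sum>j<n. (\<alpha> * ln 2 - \<epsilon>) - (if n - j < K then \<alpha> * ln 2 else 0)) =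
        real n * (\<alpha> * ln 2 - \<epsilon>) - real (card {j\<in>{..<n}. n - j < K}) * (\<alpha> * ln 2)"
      by (simp add: sum_subtractf sum.If_cases Int_def)
    finally have "real n * (\<alpha> * ln 2 - \<epsilon>) - real (card {j\<in>{..<n}. n - j < K}) * (\<alpha> * ln 2) \<le>
      measure Q (con_sets (cball x ((1/2) ^ n)) ((1/2) ^ n) 1)" .
    moreover have "card {j\<in>{..<n}. n - j < K} \<le> card {n - K..<n}" by (intro card_mono) auto
    hence "real (card {j\<in>{..<n}. n - j < K}) * (\<alpha> * ln 2) \<le> real K * (\<alpha> * ln 2)"
      using alpha_nonneg by (intro mult_right_mono) auto
    ultimately show ?thesis by linarith
  qed
  thus ?thesis using that by blast
qed

section \<open>The uncovered set as a random open set\<close>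

definition dense_pts :: "'a set" where
  "dense_pts = (SOME D. countable D \<and> (\<forall>x r. r > 0 \<longrightarrow> (\<exists>c\<in>D. dist c x < r)))"

lemma dense_pts: "countable dense_pts" "r > 0 \<Longrightarrow> \<exists>c\<in>dense_pts. dist c x < r"
proof -
  obtain D :: "'a set" where "countable D" "\<And>x r. r > 0 \<Longrightarrow> \<exists>c\<in>D. dist c x < r"
    using countable_ball_dense by blast
  hence "\<exists>D :: 'a set. countable D \<and> (\<forall>x r. r > 0 \<longrightarrow> (\<exists>c\<in>D. dist c x < r))" by blast
  from someI_ex[OF this] show "countable dense_pts" "r > 0 \<Longrightarrow> \<exists>c\<in>dense_pts. dist c x < r"
    unfolding dense_pts_def by blast+
qed

text \<open>Almost surely this is the complement of \<open>Delta (2 powr (- n)) 1 (Y \<omega>)\<close>; unlike that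
  complement, it is jointly measurable in \<open>\<omega>\<close> and the point by construction.\<close>

definition vacant :: "nat \<Rightarrow> 'p \<Rightarrow> 'a set" where
  "vacant n \<omega> = (\<Union>c\<in>dense_pts. \<Union>j\<in>{j. hit_sets (cball c (1 / Suc j)) ((1/2) ^ n) 1 \<inter> Y \<omega> = {}}. ball c (1 / Suc j))"

lemma open_vacant: "open (vacant n \<omega>)"
  unfolding vacant_def by blast

lemma vacant_pair_measurable: "{(\<omega>, x). \<omega> \<in> space P \<and> x \<in> vacant n \<omega>} \<in> sets (P \<Otimes>\<^sub>M borel)"
proof -
  have "{(\<omega>, x). \<omega> \<in> space P \<and> x \<in> vacant n \<omega>} =
      (\<Union>c\<in>dense_pts. \<Union>j. {\<omega> \<in> space P. hit_sets (cball c (1 / Suc j)) ((1/2) ^ n) 1 \<inter> Y \<omega> = {}} \<times> ball c (1 / Suc j))"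
    unfolding vacant_def by blast
  also have "\<dots> \<in> sets (P \<Otimes>\<^sub>M borel)"
    using dense_pts(1)
    by (intro sets.countable_UN'' sets.countable_UN' pair_measureI void_event sets_hit image_subsetI) auto
  finally show ?thesis .
qed

lemma vacant_disjoint_Delta:
  assumes \<omega>: "\<omega> \<in> space P"
  shows "vacant n \<omega> \<inter> Delta ((1/2) ^ n) 1 (Y \<omega>) = {}"
proof -
  have False if "x \<in> vacant n \<omega>" "L \<in> Y \<omega>" "x \<in> L" "(1/2) ^ n \<le> diameter L" "diameter L < 1" for x L
  proof -
    obtain c j where "hit_sets (cball c (1 / Suc j)) ((1/2) ^ n) 1 \<inter> Y \<omega> = {}" "x \<in> ball c (1 / Suc j)"
      using \<open>x \<in> vacant n \<omega>\<close> unfolding vacant_def by blast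
    moreover have "x \<in> cball c (1 / Suc j)" using \<open>x \<in> ball c (1 / Suc j)\<close> by simp
    ultimately show False using that Y_sub[OF \<omega>] unfolding hit_sets_def by blast
  qed
  thus ?thesis unfolding Delta_def by blast
qed

text \<open>Almost surely only finitely many of these cutouts hit a bounded region. Their union is
  closed there, so every uncovered point has a small ball, centred at a dense point, that no such
  cutout hits.\<close>

lemma AE_vacant: "AE \<omega> in P. \<forall>n. vacant n \<omega> = - Delta ((1/2) ^ n) 1 (Y \<omega>)"
proof -
  have "AE \<omega> in P. \<forall>n R::nat. finite (hit_sets (cball 0 (real R)) ((1/2) ^ n) 1 \<inter> Y \<omega>)"
    unfolding AE_all_countable by (intro allI AE_finite_points sets_hit Q_hit_finite) auto
  with AE_space show ?thesis
  proof eventually_elim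
    case (elim \<omega>)
    show ?case
    proof (intro allI equalityI subsetI)
      fix n x assume "x \<in> vacant n \<omega>"
      thus "x \<in> - Delta ((1/2) ^ n) 1 (Y \<omega>)" using vacant_disjoint_Delta[OF elim(1)] by blast
    next
      fix n x assume x: "x \<in> - Delta ((1/2) ^ n) 1 (Y \<omega>)"
      \<comment> \<open>The margin 1 keeps all points closer than 1 to \<open>x\<close> inside the
        ball of radius \<open>R\<close>, so that only the finitely many sets making up
        \<open>C\<close> matter near \<open>x\<close>.\<close>
      obtain R :: nat where R: "norm x + 1 \<le> real R" using real_arch_simple by blast
      define C where "C = \<Union>(hit_sets (cball 0 (real R)) ((1/2) ^ n) 1 \<inter> Y \<omega>)"
      have "closed C" unfolding C_def using elim(2)
        by (intro closed_Union) (auto simp: hit_sets_def compact_sets_def compact_imp_closed)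
      moreover have "x \<notin> C" using x unfolding C_def hit_sets_def Delta_def by blast
      ultimately obtain e where e: "e > 0" "ball x e \<inter> C = {}"
        by (metis open_Compl open_contains_ball disjoint_eq_subset_Compl ComplI)
      \<comment> \<open>Halved because a point of the ball about \<open>c\<close> is reached from
        \<open>x\<close> through \<open>c\<close>, at the cost of two radii.\<close>
      obtain j where j: "1 / Suc j < min e 1 / 2"
        using reals_Archimedean[of "min e 1 / 2"] e by (auto simp: inverse_eq_divide)
      obtain c where c: "c \<in> dense_pts" "dist c x < 1 / Suc j" using dense_pts(2)[of "1 / Suc j" x] by auto
      have sub: "dist x y < min e 1" if "y \<in> cball c (1 / Suc j)" for y
      proof -
        have "dist c y \<le> 1 / Suc j" using that by (simp only: mem_cball)
        thus ?thesis using c(2) j dist_triangle3[of x y c] by linarith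
      qed
      have "hit_sets (cball c (1 / Suc j)) ((1/2) ^ n) 1 \<inter> Y \<omega> = {}"
      proof (rule ccontr)
        assume "hit_sets (cball c (1 / Suc j)) ((1/2) ^ n) 1 \<inter> Y \<omega> \<noteq> {}"
        then obtain L y where L: "L \<in> Y \<omega>" "L \<in> compact_sets" "(1/2) ^ n \<le> diameter L" "diameter L < 1" "y \<in> L" "y \<in> cball c (1 / Suc j)"
          unfolding hit_sets_def by blast
        have y: "dist x y < min e 1" using sub L by blast
        hence "norm y \<le> real R" using R norm_triangle_ineq2[of y x] by (simp add: dist_norm norm_minus_commute)
        hence "L \<inter> cball 0 (real R) \<noteq> {}" using L(5) by auto
        hence "y \<in> C" using L unfolding C_def hit_sets_def by blast
        thus False using e(2) y by auto
      qed
      thus "x \<in> vacant n \<omega>" unfolding vacant_def using c by auto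
    qed
  qed
qed

lemma vacant_event [measurable]: "{\<omega> \<in> space P. x \<in> vacant n \<omega>} \<in> sets P"
proof -
  have "(\<lambda>\<omega>. (\<omega>, x)) -` {(\<omega>, x). \<omega> \<in> space P \<and> x \<in> vacant n \<omega>} \<in> sets P"
    by (rule sets_Pair2[OF vacant_pair_measurable])
  thus ?thesis by (simp add: vimage_def)
qed

lemma AE_vacant_iff: "AE \<omega> in P. x \<in> vacant n \<omega> \<longleftrightarrow> pt n x \<inter> Y \<omega> = {}"
  using AE_vacant AE_space by eventually_elim (simp add: not_in_Delta_iff[symmetric])

lemma emeasure_vacant_event:
  "emeasure P {\<omega> \<in> space P. x \<in> vacant n \<omega>} = ennreal (2 powr (- (real n * \<alpha>)))"
proof -
  have "emeasure P {\<omega> \<in> space P. x \<in> vacant n \<omega>} = emeasure P {\<omega> \<in> space P. pt n x \<inter> Y \<omega> = {}}"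
    using AE_vacant_iff[of x n] by (intro emeasure_eq_AE vacant_event void_event sets_con) auto
  also have "\<dots> = ennreal (exp (- (real n * \<alpha> * ln 2)))"
    using void_prob[OF sets_con pt_finite] by (simp add: emeasure_eq_measure measure_pt)
  also have "exp (- (real n * \<alpha> * ln 2)) = 2 powr (- (real n * \<alpha>))" by (simp add: powr_def)
  finally show ?thesis .
qed

text \<open>A set containing both points has diameter at least \<open>dist x y\<close>. The overlap
  of the two families therefore lies in the family of sets through \<open>x\<close> at level
  \<open>i\<close>, of measure \<open>i * alpha * ln 2\<close>, whatever \<open>n\<close>
  is.\<close>

lemma emeasure_vacant_pair_le:
  assumes "dist x y \<ge> (1/2) ^ i"
  shows "emeasure P {\<omega> \<in> space P. x \<in> vacant n \<omega> \<and> y \<in> vacant n \<omega>}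
    \<le> ennreal (2 powr (- 2 * (real n * \<alpha>)) * 2 powr (\<alpha> * real i))"
proof -
  have fin: "pt n z \<in> fmeasurable Q" for n z by (rule fmeasurable_con) auto
  have "pt n x \<inter> pt n y \<subseteq> pt i x"
  proof
    fix L assume L: "L \<in> pt n x \<inter> pt n y"
    hence "bounded L" "x \<in> L" "y \<in> L" by (auto simp: con_sets_def compact_sets_def compact_imp_bounded)
    hence "dist x y \<le> diameter L" by (intro diameter_bounded_bound)
    thus "L \<in> pt i x" using L assms by (auto simp: con_sets_def)
  qed
  hence "measure Q (pt n x \<inter> pt n y) \<le> measure Q (pt i x)"
    using fin by (intro measure_mono_fmeasurable) auto
  moreover have "measure Q (pt n x \<union> pt n y) = measure Q (pt n x) + measure Q (pt n y) - measure Q (pt n x \<inter> pt n y)"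
    using fin by (intro measure_Un3) auto
  ultimately have ge: "measure Q (pt n x \<union> pt n y) \<ge> 2 * (real n * \<alpha>) * ln 2 - \<alpha> * real i * ln 2"
    by (simp add: measure_pt algebra_simps)
  have "emeasure P {\<omega> \<in> space P. x \<in> vacant n \<omega> \<and> y \<in> vacant n \<omega>} =
      emeasure P {\<omega> \<in> space P. (pt n x \<union> pt n y) \<inter> Y \<omega> = {}}"
  proof (rule emeasure_eq_AE)
    show "AE \<omega> in P. (\<omega> \<in> {\<omega> \<in> space P. x \<in> vacant n \<omega> \<and> y \<in> vacant n \<omega>}) =
        (\<omega> \<in> {\<omega> \<in> space P. (pt n x \<union> pt n y) \<inter> Y \<omega> = {}})"
      using AE_vacant_iff[of x n] AE_vacant_iff[of y n] by eventually_elim blast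
    show "{\<omega> \<in> space P. (pt n x \<union> pt n y) \<inter> Y \<omega> = {}} \<in> events"
      by (intro void_event sets.Un sets_con)
    show "{\<omega> \<in> space P. x \<in> vacant n \<omega> \<and> y \<in> vacant n \<omega>} \<in> events" by measurable
  qed
  also have "\<dots> = ennreal (exp (- measure Q (pt n x \<union> pt n y)))"
  proof -
    have "pt n x \<union> pt n y \<in> fmeasurable Q" by (intro fmeasurable.Un fin)
    thus ?thesis by (subst emeasure_eq_measure, subst void_prob) (auto simp: fmeasurable_def)
  qed
  also have "exp (- measure Q (pt n x \<union> pt n y)) \<le> exp (- 2 * (real n * \<alpha>) * ln 2 + \<alpha> * real i * ln 2)"
    using ge by simp
  also have "\<dots> = 2 powr (- 2 * (real n * \<alpha>)) * 2 powr (\<alpha> * real i)"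
    by (simp add: powr_def flip: exp_add)
  finally show ?thesis by (simp add: ennreal_leI)
qed

end

section \<open>Moments of the approximating measures\<close>

lemma term_le_suminf: "f i \<le> (\<Sum>i. f i :: ennreal)"
  using sum_le_suminf[of f "{i}"] by simp

text \<open>\<open>\<nu>\<close> stands for Lebesgue measure restricted to Omega. The moment
  estimates use only that it is a finite Borel measure dominated by volume.\<close>

locale cutout_mass = poisson_cutout Q P Y \<alpha>
  for Q :: "'a::euclidean_space set measure" and P :: "'p measure" and Y :: "'p \<Rightarrow> 'a set set" and \<alpha> :: real +
  fixes \<nu> :: "'a measure"
  assumes nu_sets [measurable_cong, simp]: "sets \<nu> = sets borel"
    and nu_finite: "finite_measure \<nu>"
    and nu_le: "\<And>B. B \<in> sets borel \<Longrightarrow> emeasure \<nu> B \<le> emeasure lborel B"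
begin

sublocale nu: finite_measure \<nu> by (rule nu_finite)
sublocale PN: pair_sigma_finite P \<nu> ..
sublocale NN: pair_sigma_finite \<nu> \<nu> ..
lemma nu_square_sigma_finite: "sigma_finite_measure (\<nu> \<Otimes>\<^sub>M \<nu>)" ..
sublocale PNN: pair_sigma_finite P "\<nu> \<Otimes>\<^sub>M \<nu>" ..

lemma nu_space [simp]: "space \<nu> = UNIV"
  using sets_eq_imp_space_eq[OF nu_sets] by simp

text \<open>The random variable mu_n(U), formed with the jointly measurable
  \<open>vacant\<close>.\<close>

definition mass :: "nat \<Rightarrow> 'a set \<Rightarrow> 'p \<Rightarrow> ennreal" where
  "mass n U \<omega> = ennreal (2 powr (real n * \<alpha>)) * emeasure \<nu> (U \<inter> vacant n \<omega>)"

lemma vacant_pair_sets: "{(\<omega>, x). \<omega> \<in> space P \<and> x \<in> vacant n \<omega>} \<in> sets (P \<Otimes>\<^sub>M \<nu>)"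
proof -
  have "sets (P \<Otimes>\<^sub>M \<nu>) = sets (P \<Otimes>\<^sub>M borel)" by (intro sets_pair_measure_cong) auto
  thus ?thesis using vacant_pair_measurable by blast
qed

lemma mass_measurable [measurable]:
  assumes "U \<in> sets borel"
  shows "mass n U \<in> borel_measurable P"
proof -
  let ?E = "{(\<omega>, x). \<omega> \<in> space P \<and> x \<in> vacant n \<omega>} \<inter> (space P \<times> U)"
  have "?E \<in> sets (P \<Otimes>\<^sub>M \<nu>)" using assms by (intro sets.Int vacant_pair_sets pair_measureI) auto
  hence "(\<lambda>\<omega>. ennreal (2 powr (real n * \<alpha>)) * emeasure \<nu> (Pair \<omega> -` ?E)) \<in> borel_measurable P"
    by (intro borel_measurable_times_ennreal borel_measurable_const nu.measurable_emeasure_Pair)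
  also have "?this \<longleftrightarrow> ?thesis"
  proof (rule measurable_cong)
    fix \<omega> assume "\<omega> \<in> space P"
    hence "Pair \<omega> -` ?E = U \<inter> vacant n \<omega>" by auto
    thus "ennreal (2 powr (real n * \<alpha>)) * emeasure \<nu> (Pair \<omega> -` ?E) = mass n U \<omega>" by (simp add: mass_def)
  qed
  finally show ?thesis .
qed

text \<open>Tonelli. The event \<open>H\<close> is kept because it later says that some cutout hits
  a given ball; the full space gives the mean.\<close>

lemma nn_integral_mass_event:
  assumes U: "U \<in> sets borel" and H: "H \<in> events"
  shows "(\<integral>\<^sup>+\<omega>. mass n U \<omega> * indicator H \<omega> \<partial>P) =
    ennreal (2 powr (real n * \<alpha>)) * (\<integral>\<^sup>+x. indicator U x * emeasure P ({\<omega> \<in> space P. x \<in> vacant n \<omega>} \<inter> H) \<partial>\<nu>)"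
proof -
  let ?E = "{(\<omega>, x). \<omega> \<in> space P \<and> x \<in> vacant n \<omega>} \<inter> (H \<times> U)"
  have E: "?E \<in> sets (P \<Otimes>\<^sub>M \<nu>)" using assms by (intro sets.Int vacant_pair_sets pair_measureI) auto
  have "(\<integral>\<^sup>+\<omega>. mass n U \<omega> * indicator H \<omega> \<partial>P) = (\<integral>\<^sup>+\<omega>. ennreal (2 powr (real n * \<alpha>)) * emeasure \<nu> (Pair \<omega> -` ?E) \<partial>P)"
  proof (rule nn_integral_cong)
    fix \<omega> assume "\<omega> \<in> space P"
    hence "Pair \<omega> -` ?E = (if \<omega> \<in> H then U \<inter> vacant n \<omega> else {})" by auto
    thus "mass n U \<omega> * indicator H \<omega> = ennreal (2 powr (real n * \<alpha>)) * emeasure \<nu> (Pair \<omega> -` ?E)"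
      by (simp add: mass_def)
  qed
  also have "\<dots> = ennreal (2 powr (real n * \<alpha>)) * (\<integral>\<^sup>+\<omega>. emeasure \<nu> (Pair \<omega> -` ?E) \<partial>P)"
    using E by (intro nn_integral_cmult nu.measurable_emeasure_Pair)
  also have "(\<integral>\<^sup>+\<omega>. emeasure \<nu> (Pair \<omega> -` ?E) \<partial>P) = emeasure (P \<Otimes>\<^sub>M \<nu>) ?E"
    using nu.emeasure_pair_measure_alt[OF E] by simp
  also have "\<dots> = (\<integral>\<^sup>+x. emeasure P ((\<lambda>\<omega>. (\<omega>, x)) -` ?E) \<partial>\<nu>)"
    by (rule PN.emeasure_pair_measure_alt2[OF E])
  also have "\<dots> = (\<integral>\<^sup>+x. indicator U x * emeasure P ({\<omega> \<in> space P. x \<in> vacant n \<omega>} \<inter> H) \<partial>\<nu>)"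
  proof (rule nn_integral_cong)
    fix x
    have "(\<lambda>\<omega>. (\<omega>, x)) -` ?E = (if x \<in> U then {\<omega> \<in> space P. x \<in> vacant n \<omega>} \<inter> H else {})" by auto
    thus "emeasure P ((\<lambda>\<omega>. (\<omega>, x)) -` ?E) = indicator U x * emeasure P ({\<omega> \<in> space P. x \<in> vacant n \<omega>} \<inter> H)" by simp
  qed
  finally show ?thesis .
qed

text \<open>The normalisation is the reciprocal of the probability that a point is uncovered, so the
  mean does not change with \<open>n\<close>.\<close>

lemma nn_integral_mass:
  assumes U: "U \<in> sets borel"
  shows "(\<integral>\<^sup>+\<omega>. mass n U \<omega> \<partial>P) = emeasure \<nu> U"
proof -
  have "(\<integral>\<^sup>+\<omega>. mass n U \<omega> \<partial>P) = (\<integral>\<^sup>+\<omega>. mass n U \<omega> * indicator (space P) \<omega> \<partial>P)"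
    by (intro nn_integral_cong) simp
  also have "\<dots> = ennreal (2 powr (real n * \<alpha>)) * (\<integral>\<^sup>+x. indicator U x * emeasure P ({\<omega> \<in> space P. x \<in> vacant n \<omega>} \<inter> space P) \<partial>\<nu>)"
    by (rule nn_integral_mass_event[OF U sets.top])
  also have "\<dots> = ennreal (2 powr (real n * \<alpha>)) * (\<integral>\<^sup>+x. ennreal (2 powr (- (real n * \<alpha>))) * indicator U x \<partial>\<nu>)"
  proof -
    have "{\<omega> \<in> space P. x \<in> vacant n \<omega>} \<inter> space P = {\<omega> \<in> space P. x \<in> vacant n \<omega>}" for x by blast
    thus ?thesis by (simp only: emeasure_vacant_event mult.commute)
  qed
  also have "\<dots> = (ennreal (2 powr (real n * \<alpha>)) * ennreal (2 powr (- (real n * \<alpha>)))) * emeasure \<nu> U"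
    using U by (simp add: nn_integral_cmult_indicator mult.assoc)
  also have "ennreal (2 powr (real n * \<alpha>)) * ennreal (2 powr (- (real n * \<alpha>))) = 1"
    by (simp add: powr_minus flip: ennreal_mult)
  finally show ?thesis by simp
qed

text \<open>The two-point density of the approximating measures: the second moment of
  \<open>mass n U\<close> is its integral over \<open>U\<close> times \<open>U\<close>.\<close>

definition kernel :: "nat \<Rightarrow> 'a \<Rightarrow> 'a \<Rightarrow> ennreal" where
  "kernel n x y = ennreal (2 powr (2 * (real n * \<alpha>))) * emeasure P {\<omega> \<in> space P. x \<in> vacant n \<omega> \<and> y \<in> vacant n \<omega>}"

text \<open>The square of a measure is the product measure of a square. Tonelli moves the
  expectation inside, and a uniform bound on the inner integral of the kernel finishes.\<close>

lemma nn_integral_mass_sq_le: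
  assumes U: "U \<in> sets borel" and B: "\<And>x. x \<in> U \<Longrightarrow> (\<integral>\<^sup>+y. indicator U y * kernel n x y \<partial>\<nu>) \<le> B"
  shows "(\<integral>\<^sup>+\<omega>. (mass n U \<omega>)\<^sup>2 \<partial>P) \<le> emeasure \<nu> U * B"
proof -
  let ?V = "{(\<omega>, x). \<omega> \<in> space P \<and> x \<in> vacant n \<omega>} \<inter> (space P \<times> U)"
  let ?E = "{(\<omega>, z). \<omega> \<in> space P \<and> fst z \<in> U \<inter> vacant n \<omega> \<and> snd z \<in> U \<inter> vacant n \<omega>}"
  let ?c = "ennreal (2 powr (2 * (real n * \<alpha>)))"
  have V: "?V \<in> sets (P \<Otimes>\<^sub>M \<nu>)" using U by (intro sets.Int vacant_pair_sets pair_measureI) auto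
  have E: "?E \<in> sets (P \<Otimes>\<^sub>M (\<nu> \<Otimes>\<^sub>M \<nu>))"
  proof -
    have "?E = (\<lambda>p. (fst p, fst (snd p))) -` ?V \<inter> space (P \<Otimes>\<^sub>M (\<nu> \<Otimes>\<^sub>M \<nu>)) \<inter>
      ((\<lambda>p. (fst p, snd (snd p))) -` ?V \<inter> space (P \<Otimes>\<^sub>M (\<nu> \<Otimes>\<^sub>M \<nu>)))"
      by (auto simp: space_pair_measure)
    also have "\<dots> \<in> sets (P \<Otimes>\<^sub>M (\<nu> \<Otimes>\<^sub>M \<nu>))"
      by (intro sets.Int measurable_sets[OF _ V]) auto
    finally show ?thesis .
  qed
  have Emeas: "(\<lambda>z. emeasure P ((\<lambda>\<omega>. (\<omega>, z)) -` ?E)) \<in> borel_measurable (\<nu> \<Otimes>\<^sub>M \<nu>)"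
    using E by (rule PNN.measurable_emeasure_Pair2)
  have "(\<integral>\<^sup>+\<omega>. (mass n U \<omega>)\<^sup>2 \<partial>P) = (\<integral>\<^sup>+\<omega>. ?c * emeasure (\<nu> \<Otimes>\<^sub>M \<nu>) (Pair \<omega> -` ?E) \<partial>P)"
  proof (rule nn_integral_cong)
    fix \<omega> assume \<omega>: "\<omega> \<in> space P"
    hence "Pair \<omega> -` ?E = (U \<inter> vacant n \<omega>) \<times> (U \<inter> vacant n \<omega>)" by auto
    moreover have "U \<inter> vacant n \<omega> \<in> sets \<nu>" using U open_vacant by auto
    ultimately have "emeasure (\<nu> \<Otimes>\<^sub>M \<nu>) (Pair \<omega> -` ?E) = (emeasure \<nu> (U \<inter> vacant n \<omega>))\<^sup>2"
      by (simp add: nu.emeasure_pair_measure_Times power2_eq_square)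
    moreover have "?c = (ennreal (2 powr (real n * \<alpha>)))\<^sup>2"
      by (simp add: ennreal_power powr_power)
    ultimately show "(mass n U \<omega>)\<^sup>2 = ?c * emeasure (\<nu> \<Otimes>\<^sub>M \<nu>) (Pair \<omega> -` ?E)"
      by (simp add: mass_def power_mult_distrib)
  qed
  also have "\<dots> = ?c * (\<integral>\<^sup>+\<omega>. emeasure (\<nu> \<Otimes>\<^sub>M \<nu>) (Pair \<omega> -` ?E) \<partial>P)"
    using E by (intro nn_integral_cmult sigma_finite_measure.measurable_emeasure_Pair[OF nu_square_sigma_finite])
  also have "(\<integral>\<^sup>+\<omega>. emeasure (\<nu> \<Otimes>\<^sub>M \<nu>) (Pair \<omega> -` ?E) \<partial>P) = emeasure (P \<Otimes>\<^sub>M (\<nu> \<Otimes>\<^sub>M \<nu>)) ?E"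
    using sigma_finite_measure.emeasure_pair_measure_alt[OF nu_square_sigma_finite E] by simp
  also have "\<dots> = (\<integral>\<^sup>+z. emeasure P ((\<lambda>\<omega>. (\<omega>, z)) -` ?E) \<partial>(\<nu> \<Otimes>\<^sub>M \<nu>))"
    by (rule PNN.emeasure_pair_measure_alt2[OF E])
  also have "\<dots> = (\<integral>\<^sup>+x. \<integral>\<^sup>+y. emeasure P ((\<lambda>\<omega>. (\<omega>, (x, y))) -` ?E) \<partial>\<nu> \<partial>\<nu>)"
    by (rule nu.nn_integral_fst[OF Emeas, symmetric])
  also have "?c * \<dots> = (\<integral>\<^sup>+x. ?c * (\<integral>\<^sup>+y. emeasure P ((\<lambda>\<omega>. (\<omega>, (x, y))) -` ?E) \<partial>\<nu>) \<partial>\<nu>)"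
    using nu.borel_measurable_nn_integral_fst[OF Emeas] by (rule nn_integral_cmult[symmetric])
  also have "\<dots> \<le> (\<integral>\<^sup>+x. B * indicator U x \<partial>\<nu>)"
  proof (rule nn_integral_mono)
    fix x
    have "?c * (\<integral>\<^sup>+y. emeasure P ((\<lambda>\<omega>. (\<omega>, (x, y))) -` ?E) \<partial>\<nu>) = (\<integral>\<^sup>+y. ?c * emeasure P ((\<lambda>\<omega>. (\<omega>, (x, y))) -` ?E) \<partial>\<nu>)"
      using measurable_Pair2[OF Emeas, of x] by (intro nn_integral_cmult[symmetric]) auto
    also have "\<dots> = (\<integral>\<^sup>+y. indicator U x * (indicator U y * kernel n x y) \<partial>\<nu>)"
    proof (rule nn_integral_cong)
      fix y
      have "(\<lambda>\<omega>. (\<omega>, (x, y))) -` ?E = (if x \<in> U \<and> y \<in> U then {\<omega> \<in> space P. x \<in> vacant n \<omega> \<and> y \<in> vacant n \<omega>} else {})"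
        by auto
      thus "?c * emeasure P ((\<lambda>\<omega>. (\<omega>, (x, y))) -` ?E) = indicator U x * (indicator U y * kernel n x y)"
        by (auto simp: kernel_def indicator_def)
    qed
    also have "\<dots> \<le> B * indicator U x" using B[of x] by (cases "x \<in> U") auto
    finally show "?c * (\<integral>\<^sup>+y. emeasure P ((\<lambda>\<omega>. (\<omega>, (x, y))) -` ?E) \<partial>\<nu>) \<le> B * indicator U x" .
  qed
  also have "\<dots> = emeasure \<nu> U * B" using U by (simp add: nn_integral_cmult_indicator mult.commute)
  finally show ?thesis .
qed

lemma kernel_measurable [measurable]: "kernel n x \<in> borel_measurable \<nu>"
proof -
  let ?E = "{(\<omega>, x). \<omega> \<in> space P \<and> x \<in> vacant n \<omega>} \<inter> ({\<omega> \<in> space P. x \<in> vacant n \<omega>} \<times> UNIV)"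
  have E: "?E \<in> sets (P \<Otimes>\<^sub>M \<nu>)" by (intro sets.Int vacant_pair_sets pair_measureI vacant_event) simp
  have "(\<lambda>y. ennreal (2 powr (2 * (real n * \<alpha>))) * emeasure P ((\<lambda>\<omega>. (\<omega>, y)) -` ?E)) \<in> borel_measurable \<nu>"
    using PN.measurable_emeasure_Pair2[OF E] by (intro borel_measurable_times_ennreal borel_measurable_const)
  moreover have "(\<lambda>\<omega>. (\<omega>, y)) -` ?E = {\<omega> \<in> space P. x \<in> vacant n \<omega> \<and> y \<in> vacant n \<omega>}" for y by auto
  ultimately show ?thesis by (simp only: kernel_def[abs_def])
qed

lemma kernel_le:
  assumes "dist x y \<ge> (1/2) ^ i"
  shows "kernel n x y \<le> ennreal (2 powr (\<alpha> * real i))"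
proof -
  have "kernel n x y \<le> ennreal (2 powr (2 * (real n * \<alpha>))) * ennreal (2 powr (- 2 * (real n * \<alpha>)) * 2 powr (\<alpha> * real i))"
    unfolding kernel_def by (intro mult_left_mono emeasure_vacant_pair_le assms) simp
  also have "\<dots> = ennreal (2 powr (\<alpha> * real i))"
    by (simp add: powr_minus flip: ennreal_mult mult.assoc)
  finally show ?thesis .
qed

section \<open>Integrals of the two-point kernel over balls\<close>

lemma nu_cball_le:
  assumes "r \<ge> 0"
  shows "emeasure \<nu> (cball x r) \<le> ennreal (unit_ball_vol (real DIM('a)) * r ^ DIM('a))"
  using nu_le[of "cball x r"] assms by (simp add: emeasure_cball)

text \<open>The sum of the geometric series over dyadic annuli in
  \<open>nn_integral_kernel_ball\<close>; the factor \<open>2 powr \<alpha>\<close> appears because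
  the kernel is bounded by its value at the inner radius.\<close>

definition kernel_const :: real where
  "kernel_const = unit_ball_vol (real DIM('a)) * 2 powr \<alpha> / (1 - 2 powr (\<alpha> - DIM('a)))"

lemma rho: "0 < 2 powr (\<alpha> - DIM('a))" "2 powr (\<alpha> - DIM('a)) < 1"
  using alpha_lt by (simp_all add: powr_less_one)

lemma kernel_const_nonneg: "kernel_const \<ge> 0"
  using rho unfolding kernel_const_def by (intro divide_nonneg_nonneg mult_nonneg_nonneg) auto

text \<open>On the annulus between radii \<open>2^-(j+1)\<close> and \<open>2^-j\<close> the kernel
  is at most \<open>2^(alpha (j+1))\<close> and the volume is of order \<open>2^(-j d)\<close>. The
  contributions decay geometrically because \<open>alpha < d\<close>.\<close>

lemma nn_integral_kernel_ball:
  "(\<integral>\<^sup>+y. indicator (cball x ((1/2) ^ k)) y * kernel n x y \<partial>\<nu>) \<le> ennreal (kernel_const * ((1/2) ^ k) powr (DIM('a) - \<alpha>))"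
proof -
  define d where "d = DIM('a)"
  define v where "v = unit_ball_vol (real d)"
  define \<rho> where "\<rho> = 2 powr (\<alpha> - real d)"
  define K where "K = v * 2 powr \<alpha> * ((1/2) ^ k) powr (d - \<alpha>)"
  have \<rho>: "0 < \<rho>" "\<rho> < 1" using rho by (simp_all add: \<rho>_def d_def)
  have v: "v \<ge> 0" by (simp add: v_def)
  let ?f = "\<lambda>i y. ennreal (2 powr (\<alpha> * real (Suc (i + k)))) * indicator (cball x ((1/2) ^ (i + k))) y :: ennreal"
  \<comment> \<open>The centre belongs to no annulus, so it has to be discarded as a null
    set.\<close>
  have "AE y in \<nu>. y \<noteq> x"
  proof (rule AE_I[of _ _ "{x}"])
    show "emeasure \<nu> {x} = 0" using nu_le[of "{x}"] by simp
  qed auto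
  hence "(\<integral>\<^sup>+y. indicator (cball x ((1/2) ^ k)) y * kernel n x y \<partial>\<nu>) \<le> (\<integral>\<^sup>+y. (\<Sum>i. ?f i y) \<partial>\<nu>)"
  proof (intro nn_integral_mono_AE, eventually_elim)
    fix y assume ne: "y \<noteq> x"
    show "indicator (cball x ((1/2) ^ k)) y * kernel n x y \<le> (\<Sum>i. ?f i y)"
    proof (cases "y \<in> cball x ((1/2) ^ k)")
      case True
      hence le: "dist x y \<le> (1/2) ^ k" by simp
      hence "dist x y \<le> 1" using power_le_one[of "1/2 :: real" k] by simp
      moreover have "dist x y > 0" using ne by simp
      ultimately obtain j where j: "(1/2) ^ Suc j < dist x y" "dist x y \<le> (1/2) ^ j" using dyadic_scale by blast
      have "k \<le> j" using dyadic_scale_ge[OF j(1) le] .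
      have "kernel n x y \<le> ennreal (2 powr (\<alpha> * real (Suc j)))" using j by (intro kernel_le) simp
      also have "\<dots> = ?f (j - k) y"
        using j(2) by (simp only: le_add_diff_inverse2[OF \<open>k \<le> j\<close>]) simp
      also have "\<dots> \<le> (\<Sum>i. ?f i y)" by (rule term_le_suminf)
      finally show ?thesis using True by simp
    qed simp
  qed
  also have "\<dots> = (\<Sum>i. \<integral>\<^sup>+y. ?f i y \<partial>\<nu>)"
    by (intro nn_integral_suminf borel_measurable_times_ennreal borel_measurable_const borel_measurable_indicator) simp
  also have "\<dots> \<le> (\<Sum>i. ennreal (K * \<rho> ^ i))"
  proof (rule suminf_le)
    fix i
    have "(\<integral>\<^sup>+y. ?f i y \<partial>\<nu>) = ennreal (2 powr (\<alpha> * real (Suc (i + k)))) * emeasure \<nu> (cball x ((1/2) ^ (i + k)))"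
      by (simp add: nn_integral_cmult_indicator)
    also have "\<dots> \<le> ennreal (2 powr (\<alpha> * real (Suc (i + k)))) * ennreal (v * ((1/2) ^ (i + k)) ^ d)"
      unfolding v_def d_def by (intro mult_left_mono nu_cball_le) auto
    also have "\<dots> = ennreal (2 powr (\<alpha> * real (Suc (i + k))) * (v * ((1/2) ^ (i + k)) ^ d))"
      using v by (simp add: ennreal_mult)
    also have "2 powr (\<alpha> * real (Suc (i + k))) * (v * ((1/2) ^ (i + k)) ^ d) = K * \<rho> ^ i"
    proof -
      have 1: "2 powr (\<alpha> * real (Suc (i + k))) = 2 powr \<alpha> * 2 powr (\<alpha> * real i) * 2 powr (\<alpha> * real k)"
        by (simp add: algebra_simps powr_add)
      have 2: "((1/2 :: real) ^ (i + k)) ^ d = 2 powr (- (real d * real i)) * 2 powr (- (real d * real k))"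
        by (simp add: two_powr_eq_half_power[symmetric] powr_power algebra_simps flip: powr_add)
      have 3: "((1/2 :: real) ^ k) powr (d - \<alpha>) = 2 powr (\<alpha> * real k) * 2 powr (- (real d * real k))"
        by (simp add: two_powr_eq_half_power[symmetric] powr_powr algebra_simps flip: powr_add)
      have 4: "\<rho> ^ i = 2 powr (\<alpha> * real i) * 2 powr (- (real d * real i))"
        unfolding \<rho>_def by (simp add: powr_power algebra_simps flip: powr_add)
      show ?thesis unfolding K_def 1 2 3 4 by simp
    qed
    finally show "(\<integral>\<^sup>+y. ?f i y \<partial>\<nu>) \<le> ennreal (K * \<rho> ^ i)" .
  qed auto
  also have "\<dots> = ennreal (\<Sum>i. K * \<rho> ^ i)"
    using v \<rho> by (intro suminf_ennreal2 summable_mult summable_geometric) (auto simp: K_def)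
  also have "(\<Sum>i. K * \<rho> ^ i) = K / (1 - \<rho>)"
    using \<rho> by (subst suminf_mult) (auto simp: suminf_geometric)
  also have "\<dots> = kernel_const * ((1/2) ^ k) powr (DIM('a) - \<alpha>)"
    by (simp add: kernel_const_def K_def \<rho>_def v_def d_def)
  finally show ?thesis .
qed

lemma mass_sq_total:
  obtains C where "C \<ge> 0" "\<And>n. (\<integral>\<^sup>+\<omega>. (mass n UNIV \<omega>)\<^sup>2 \<partial>P) \<le> ennreal C"
proof -
  let ?m = "measure \<nu> UNIV"
  have UN: "emeasure \<nu> UNIV = ennreal ?m" by (rule nu.emeasure_eq_measure)
  have "(\<integral>\<^sup>+\<omega>. (mass n UNIV \<omega>)\<^sup>2 \<partial>P) \<le> emeasure \<nu> UNIV * ennreal (kernel_const + ?m)" for n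
  proof (rule nn_integral_mass_sq_le)
    fix x
    \<comment> \<open>At distance more than 1 the kernel is at most 1, since no cutout of diameter
      below 1 contains both points.\<close>
    have "(\<integral>\<^sup>+y. indicator UNIV y * kernel n x y \<partial>\<nu>) \<le> (\<integral>\<^sup>+y. indicator (cball x ((1/2) ^ 0)) y * kernel n x y + 1 \<partial>\<nu>)"
    proof (rule nn_integral_mono)
      fix y
      show "indicator UNIV y * kernel n x y \<le> indicator (cball x ((1/2) ^ 0)) y * kernel n x y + 1"
      proof (cases "dist x y \<le> 1")
        case False
        thus ?thesis using kernel_le[of 0 x y n] by simp
      qed (simp add: add_increasing2)
    qed
    also have "\<dots> \<le> ennreal (kernel_const * ((1/2) ^ 0) powr (DIM('a) - \<alpha>)) + ennreal ?m"
      using nn_integral_kernel_ball[of x 0 n]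
      by (subst nn_integral_add) (auto simp: UN intro!: add_right_mono borel_measurable_times_ennreal borel_measurable_indicator)
    finally show "(\<integral>\<^sup>+y. indicator UNIV y * kernel n x y \<partial>\<nu>) \<le> ennreal (kernel_const + ?m)"
      using kernel_const_nonneg by simp
  qed simp
  thus ?thesis using that[of "?m * (kernel_const + ?m)"] kernel_const_nonneg unfolding UN by (simp add: ennreal_mult)
qed

text \<open>The ball has radius \<open>2^-(k+1)\<close> so that it lies in the ball of radius
  \<open>2^-k\<close> about each of its points, where the kernel integral is known.\<close>

lemma mass_sq_ball:
  "(\<integral>\<^sup>+\<omega>. (mass n (cball c ((1/2) ^ Suc k)) \<omega>)\<^sup>2 \<partial>P) \<le>
    ennreal (unit_ball_vol (real DIM('a)) * kernel_const * (1/2) ^ (k * DIM('a)) * ((1/2) ^ k) powr (DIM('a) - \<alpha>))"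
proof -
  let ?U = "cball c ((1/2) ^ Suc k)"
  have "(\<integral>\<^sup>+\<omega>. (mass n ?U \<omega>)\<^sup>2 \<partial>P) \<le> emeasure \<nu> ?U * ennreal (kernel_const * ((1/2) ^ k) powr (DIM('a) - \<alpha>))"
  proof (rule nn_integral_mass_sq_le)
    fix x assume x: "x \<in> ?U"
    have "?U \<subseteq> cball x ((1/2) ^ k)"
    proof
      fix y assume "y \<in> ?U"
      thus "y \<in> cball x ((1/2) ^ k)" using x dist_triangle3[of x y c] by simp
    qed
    hence "(\<integral>\<^sup>+y. indicator ?U y * kernel n x y \<partial>\<nu>) \<le> (\<integral>\<^sup>+y. indicator (cball x ((1/2) ^ k)) y * kernel n x y \<partial>\<nu>)"
      by (intro nn_integral_mono mult_right_mono) (auto simp: indicator_def)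
    also note nn_integral_kernel_ball
    finally show "(\<integral>\<^sup>+y. indicator ?U y * kernel n x y \<partial>\<nu>) \<le> ennreal (kernel_const * ((1/2) ^ k) powr (DIM('a) - \<alpha>))" .
  qed simp
  also have "emeasure \<nu> ?U \<le> ennreal (unit_ball_vol (real DIM('a)) * (1/2) ^ (k * DIM('a)))"
  proof -
    have "emeasure \<nu> ?U \<le> ennreal (unit_ball_vol (real DIM('a)) * ((1/2) ^ Suc k) ^ DIM('a))"
      by (rule nu_cball_le) simp
    also have "((1/2 :: real) ^ Suc k) ^ DIM('a) \<le> ((1/2) ^ k) ^ DIM('a)" by (intro power_mono) auto
    finally show ?thesis by (simp add: power_mult mult_left_mono ennreal_leI)
  qed
  finally show ?thesis
    using kernel_const_nonneg by (simp add: ennreal_mult[symmetric] mult_ac mult_right_mono)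
qed

section \<open>Mass close to the frontier of a cutout\<close>

lemma measure_near_boundary_translate:
  assumes "a > 0" "r \<ge> 0"
  shows "measure Q (hit_sets (cball c r) a b - con_sets (cball c r) a b) =
    measure Q (hit_sets (cball 0 r) a b - con_sets (cball 0 r) a b)"
proof -
  have "measure Q (hit_sets (cball c r) a b - con_sets (cball c r) a b) =
      measure Q (hit_sets (cball c r) a b) - measure Q (con_sets (cball c r) a b)" for c
  proof (rule measure_Diff)
    show "emeasure Q (hit_sets (cball c r) a b) \<noteq> \<infinity>" using Q_hit_finite[OF assms(1)] by (simp add: less_top)
    have "c \<in> cball c r" using assms by simp
    thus "con_sets (cball c r) a b \<subseteq> hit_sets (cball c r) a b" unfolding con_sets_def hit_sets_def by blast
  qed auto
  thus ?thesis using Q_hit_cball[of c r a b] Q_con_cball[of c r a b] by (simp add: measure_def)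
qed

text \<open>If a point of the ball is uncovered at level \<open>m\<close>, no cutout in the given
  range contains the whole ball, so a hit must come from a set that meets the ball without
  containing it. These sets are independent of the vacancy of the point, and the probability of
  seeing one is at most their measure.\<close>

lemma nn_integral_mass_hit_le:
  assumes r: "r \<ge> 0" and U: "U \<in> sets borel" "U \<subseteq> cball c r" and nm: "n \<le> m"
  shows "(\<integral>\<^sup>+\<omega>. mass m U \<omega> * indicator {\<omega> \<in> space P. hit_sets (cball c r) ((1/2) ^ n) 1 \<inter> Y \<omega> \<noteq> {}} \<omega> \<partial>P)
    \<le> emeasure \<nu> U * ennreal (measure Q (hit_sets (cball 0 r) ((1/2) ^ n) 1 - con_sets (cball 0 r) ((1/2) ^ n) 1))"
proof -
  let ?S = "hit_sets (cball c r) ((1/2) ^ n) 1"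
  let ?H = "{\<omega> \<in> space P. ?S \<inter> Y \<omega> \<noteq> {}}"
  let ?\<delta> = "measure Q (hit_sets (cball 0 r) ((1/2) ^ n) 1 - con_sets (cball 0 r) ((1/2) ^ n) 1)"
  have H: "?H \<in> events"
  proof -
    have "space P - {\<omega> \<in> space P. ?S \<inter> Y \<omega> = {}} \<in> events" using void_event[OF sets_hit] by auto
    also have "space P - {\<omega> \<in> space P. ?S \<inter> Y \<omega> = {}} = ?H" by auto
    finally show ?thesis .
  qed
  have S: "?S \<in> fmeasurable Q" by (rule fmeasurable_hit) simp
  have key: "emeasure P ({\<omega> \<in> space P. x \<in> vacant m \<omega>} \<inter> ?H) \<le> ennreal (2 powr (- (real m * \<alpha>)) * ?\<delta>)" if x: "x \<in> U" for x
  proof -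
    have p: "pt m x \<in> fmeasurable Q" by (rule fmeasurable_con) auto
    have pS: "pt m x \<union> ?S \<in> fmeasurable Q" using p S by (rule fmeasurable.Un)
    \<comment> \<open>Uncovered and hit means: void on the sets through \<open>x\<close>, but not
      void on their union with the hitting sets. Both probabilities are known.\<close>
    have "emeasure P ({\<omega> \<in> space P. x \<in> vacant m \<omega>} \<inter> ?H) =
        emeasure P ({\<omega> \<in> space P. pt m x \<inter> Y \<omega> = {}} - {\<omega> \<in> space P. (pt m x \<union> ?S) \<inter> Y \<omega> = {}})"
    proof (rule emeasure_eq_AE)
      show "AE \<omega> in P. (\<omega> \<in> {\<omega> \<in> space P. x \<in> vacant m \<omega>} \<inter> ?H) =
        (\<omega> \<in> {\<omega> \<in> space P. pt m x \<inter> Y \<omega> = {}} - {\<omega> \<in> space P. (pt m x \<union> ?S) \<inter> Y \<omega> = {}})"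
        using AE_vacant_iff[of x m] by eventually_elim blast
      show "{\<omega> \<in> space P. x \<in> vacant m \<omega>} \<inter> ?H \<in> events" by (intro sets.Int vacant_event H)
      show "{\<omega> \<in> space P. pt m x \<inter> Y \<omega> = {}} - {\<omega> \<in> space P. (pt m x \<union> ?S) \<inter> Y \<omega> = {}} \<in> events"
        by (intro sets.Diff void_event sets_con sets.Un sets_hit) simp
    qed
    also have "\<dots> = ennreal (prob {\<omega> \<in> space P. pt m x \<inter> Y \<omega> = {}} - prob {\<omega> \<in> space P. (pt m x \<union> ?S) \<inter> Y \<omega> = {}})"
      unfolding emeasure_eq_measure
      by (subst finite_measure_Diff) (auto intro!: void_event sets.Un sets_con sets_hit)
    also have "prob {\<omega> \<in> space P. pt m x \<inter> Y \<omega> = {}} = exp (- measure Q (pt m x))"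
      using p by (intro void_prob) (auto simp: fmeasurable_def)
    also have "prob {\<omega> \<in> space P. (pt m x \<union> ?S) \<inter> Y \<omega> = {}} = exp (- measure Q (pt m x \<union> ?S))"
      using pS by (intro void_prob) (auto simp: fmeasurable_def)
    also have "measure Q (pt m x \<union> ?S) = measure Q (pt m x) + measure Q (?S - pt m x)"
      using p S by (rule measure_Un2)
    also have "exp (- measure Q (pt m x)) - exp (- (measure Q (pt m x) + measure Q (?S - pt m x))) \<le>
      exp (- measure Q (pt m x)) * measure Q (?S - pt m x)"
    proof -
      have "1 - exp (- measure Q (?S - pt m x)) \<le> measure Q (?S - pt m x)"
        using exp_ge_add_one_self[of "- measure Q (?S - pt m x)"] by simp
      hence "exp (- measure Q (pt m x)) * (1 - exp (- measure Q (?S - pt m x))) \<le> exp (- measure Q (pt m x)) * measure Q (?S - pt m x)"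
        by (intro mult_left_mono) auto
      thus ?thesis by (simp add: exp_add[symmetric] right_diff_distrib)
    qed
    also have "exp (- measure Q (pt m x)) = 2 powr (- (real m * \<alpha>))"
      by (simp add: measure_pt powr_def)
    \<comment> \<open>A hitting set that contains the ball contains \<open>x\<close> and has
      diameter at least \<open>2^-n\<close>, hence at least \<open>2^-m\<close>; so it is among the
      sets already excluded.\<close>
    also have "measure Q (?S - pt m x) \<le> measure Q (?S - con_sets (cball c r) ((1/2) ^ n) 1)"
    proof (rule measure_mono_fmeasurable)
      have "(1/2 :: real) ^ m \<le> (1/2) ^ n" using nm by (intro power_decreasing) auto
      moreover have "x \<in> cball c r" using x U(2) by blast
      ultimately show "?S - pt m x \<subseteq> ?S - con_sets (cball c r) ((1/2) ^ n) 1"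
        unfolding con_sets_def hit_sets_def
        by (auto intro: order_trans[OF \<open>(1/2 :: real) ^ m \<le> (1/2) ^ n\<close>])
      show "?S - con_sets (cball c r) ((1/2) ^ n) 1 \<in> fmeasurable Q"
        using S by (rule fmeasurable.Diff) (use r in \<open>auto intro!: fmeasurable_con simp: not_less\<close>)
      show "?S - pt m x \<in> sets Q" by (intro sets.Diff sets_hit sets_con) simp
    qed
    also have "measure Q (?S - con_sets (cball c r) ((1/2) ^ n) 1) = ?\<delta>"
      using r by (intro measure_near_boundary_translate) auto
    finally show ?thesis by (simp add: mult_left_mono ennreal_leI)
  qed
  have "(\<integral>\<^sup>+\<omega>. mass m U \<omega> * indicator ?H \<omega> \<partial>P) =
      ennreal (2 powr (real m * \<alpha>)) * (\<integral>\<^sup>+x. indicator U x * emeasure P ({\<omega> \<in> space P. x \<in> vacant m \<omega>} \<inter> ?H) \<partial>\<nu>)"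
    by (rule nn_integral_mass_event[OF U(1) H])
  also have "\<dots> \<le> ennreal (2 powr (real m * \<alpha>)) * (\<integral>\<^sup>+x. ennreal (2 powr (- (real m * \<alpha>)) * ?\<delta>) * indicator U x \<partial>\<nu>)"
    using key by (intro mult_left_mono nn_integral_mono) (auto simp: indicator_def)
  also have "\<dots> = (ennreal (2 powr (real m * \<alpha>)) * ennreal (2 powr (- (real m * \<alpha>)) * ?\<delta>)) * emeasure \<nu> U"
    using U(1) by (simp add: nn_integral_cmult_indicator mult.assoc)
  also have "ennreal (2 powr (real m * \<alpha>)) * ennreal (2 powr (- (real m * \<alpha>)) * ?\<delta>) = ennreal ?\<delta>"
    by (simp add: powr_minus flip: ennreal_mult)
  finally show ?thesis by (simp add: mult.commute)
qed

end

section \<open>The limit measure and the box dimension\<close>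

lemma weak_conv_measure_UNIV:
  assumes "weak_conv_measures \<mu>s \<mu>" "\<And>n. space (\<mu>s n) = UNIV" "space \<mu> = UNIV"
  shows "(\<lambda>n. measure (\<mu>s n) UNIV) \<longlonglongrightarrow> measure \<mu> UNIV"
proof -
  have "(\<lambda>n. \<integral>x. (1::real) \<partial>\<mu>s n) \<longlonglongrightarrow> (\<integral>x. 1 \<partial>\<mu>)"
    using assms(1) unfolding weak_conv_measures_def by (rule allE[of _ "\<lambda>x. 1"]) auto
  thus ?thesis using assms(2,3) by simp
qed

text \<open>The portmanteau inequality. The approximating measures live on the Lebesgue sets and the
  limit on the Borel sets, so only an inclusion of sigma-algebras is required of the former.\<close>

lemma weak_conv_open_le:
  fixes \<mu> :: "'a::metric_space measure"
  assumes lim: "weak_conv_measures \<mu>s \<mu>"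
    and \<mu>s: "\<And>n. sets borel \<subseteq> sets (\<mu>s n)" "\<And>n. space (\<mu>s n) = UNIV" "\<And>n. finite_measure (\<mu>s n)"
    and \<mu>: "sets \<mu> = sets borel" "finite_measure \<mu>" and U: "open U"
  shows "emeasure \<mu> U \<le> liminf (\<lambda>n. emeasure (\<mu>s n) U)"
proof -
  \<comment> \<open>The whole space is treated apart because \<open>infdist\<close> to the empty set
    is 0, which would make the test function vanish.\<close>
  define \<phi> :: "nat \<Rightarrow> 'a \<Rightarrow> real" where
    "\<phi> j x = (if U = UNIV then 1 else min 1 (real j * infdist x (- U)))" for j x
  have cont: "continuous_on UNIV (\<phi> j)" for j
    unfolding \<phi>_def by (cases "U = UNIV") (auto intro!: continuous_intros)
  have range: "0 \<le> \<phi> j x" "\<phi> j x \<le> 1" for j x by (auto simp: \<phi>_def infdist_nonneg)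
  have out: "\<phi> j x \<le> indicator U x" for j x
    using range[of j x] by (cases "x \<in> U") (auto simp: \<phi>_def)
  have meas: "\<phi> j \<in> borel_measurable borel" for j using cont by (rule borel_measurable_continuous_onI)
  have int: "integrable N (\<phi> j)" if "finite_measure N" "\<phi> j \<in> borel_measurable N" for N j
    using that range by (intro finite_measure.integrable_const_bound[where B = 1]) auto
  have measN: "\<phi> j \<in> borel_measurable (\<mu>s n)" for j n
  proof (rule measurableI)
    fix A :: "real set" assume "A \<in> sets borel"
    from measurable_sets[OF meas this, of j] show "\<phi> j -` A \<inter> space (\<mu>s n) \<in> sets (\<mu>s n)"
      using \<mu>s(1)[of n] \<mu>s(2)[of n] by auto
  qed auto
  have meas\<mu>: "\<phi> j \<in> borel_measurable \<mu>" for j using meas[of j] \<mu>(1) by (simp cong: measurable_cong_sets)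
  have step: "(\<integral>\<^sup>+x. ennreal (\<phi> j x) \<partial>\<mu>) \<le> liminf (\<lambda>n. emeasure (\<mu>s n) U)" for j
  proof -
    have "bounded (range (\<phi> j))" using range by (intro boundedI[of _ 1]) auto
    hence "(\<lambda>n. \<integral>x. \<phi> j x \<partial>\<mu>s n) \<longlonglongrightarrow> (\<integral>x. \<phi> j x \<partial>\<mu>)"
      using lim cont unfolding weak_conv_measures_def by blast
    hence "(\<lambda>n. ennreal (\<integral>x. \<phi> j x \<partial>\<mu>s n)) \<longlonglongrightarrow> ennreal (\<integral>x. \<phi> j x \<partial>\<mu>)" by (rule tendsto_ennrealI)
    hence "liminf (\<lambda>n. ennreal (\<integral>x. \<phi> j x \<partial>\<mu>s n)) = ennreal (\<integral>x. \<phi> j x \<partial>\<mu>)"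
      by (rule lim_imp_Liminf[OF sequentially_bot])
    hence "ennreal (\<integral>x. \<phi> j x \<partial>\<mu>) = liminf (\<lambda>n. ennreal (\<integral>x. \<phi> j x \<partial>\<mu>s n))" by simp
    also have "\<dots> \<le> liminf (\<lambda>n. emeasure (\<mu>s n) U)"
    proof (intro Liminf_mono always_eventually allI)
      fix n
      have "ennreal (\<integral>x. \<phi> j x \<partial>\<mu>s n) = (\<integral>\<^sup>+x. ennreal (\<phi> j x) \<partial>\<mu>s n)"
        using int[OF \<mu>s(3) measN] range by (intro nn_integral_eq_integral[symmetric]) auto
      also have "\<dots> \<le> (\<integral>\<^sup>+x. indicator U x \<partial>\<mu>s n)"
      proof (rule nn_integral_mono)
        fix x show "ennreal (\<phi> j x) \<le> indicator U x"
          using out[of j x] range[of j x] by (cases "x \<in> U") (auto simp: ennreal_eq_0_iff)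
      qed
      also have "\<dots> = emeasure (\<mu>s n) U" using U \<mu>s(1)[of n] by (intro nn_integral_indicator) auto
      finally show "ennreal (\<integral>x. \<phi> j x \<partial>\<mu>s n) \<le> emeasure (\<mu>s n) U" .
    qed
    also have "ennreal (\<integral>x. \<phi> j x \<partial>\<mu>) = (\<integral>\<^sup>+x. ennreal (\<phi> j x) \<partial>\<mu>)"
      using int[OF \<mu>(2) meas\<mu>] range by (intro nn_integral_eq_integral[symmetric]) auto
    finally show ?thesis .
  qed
  have "(\<lambda>j. \<integral>\<^sup>+x. ennreal (\<phi> j x) \<partial>\<mu>) \<longlonglongrightarrow> (\<integral>\<^sup>+x. indicator U x \<partial>\<mu>)"
  proof (rule nn_integral_LIMSEQ)
    show "incseq (\<lambda>j x. ennreal (\<phi> j x))"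
    proof (intro incseq_SucI le_funI ennreal_leI)
      fix j x
      have "real j * infdist x (- U) \<le> real (Suc j) * infdist x (- U)"
        by (intro mult_right_mono infdist_nonneg) simp
      thus "\<phi> j x \<le> \<phi> (Suc j) x" by (simp add: \<phi>_def min_def)
    qed
    show "(\<lambda>j. ennreal (\<phi> j x)) \<longlonglongrightarrow> indicator U x" for x
    proof (cases "x \<in> U")
      case False
      hence "\<phi> j x = 0" for j using out[of j x] range[of j x] by simp
      thus ?thesis using False by simp
    next
      case True
      have "\<forall>\<^sub>F j in sequentially. \<phi> j x = 1"
      proof (cases "U = UNIV")
        case False
        hence "infdist x (- U) > 0" using U True by (intro infdist_pos_not_in_closed) auto
        then obtain J where J: "1 / infdist x (- U) \<le> real J" "infdist x (- U) > 0" using real_arch_simple by blast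
        have "\<phi> j x = 1" if "j \<ge> J" for j
        proof -
          have "1 / infdist x (- U) \<le> real j" using J that by (meson of_nat_mono order_trans)
          hence "1 \<le> real j * infdist x (- U)" using J by (simp add: field_simps)
          thus ?thesis by (simp add: \<phi>_def)
        qed
        thus ?thesis unfolding eventually_sequentially by blast
      qed (simp add: \<phi>_def)
      hence "\<forall>\<^sub>F j in sequentially. ennreal (\<phi> j x) = indicator U x"
        by eventually_elim (use True in simp)
      thus ?thesis by (rule tendsto_eventually)
    qed
  qed (use meas\<mu> in auto)
  moreover have "(\<integral>\<^sup>+x. indicator U x \<partial>\<mu>) = emeasure \<mu> U" using U \<mu>(1) by (intro nn_integral_indicator) auto
  ultimately have "(\<lambda>j. \<integral>\<^sup>+x. ennreal (\<phi> j x) \<partial>\<mu>) \<longlonglongrightarrow> emeasure \<mu> U" by simp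
  thus ?thesis by (rule LIMSEQ_le_const2) (use step in blast)
qed

lemma AE_suminf_finite:
  fixes f :: "nat \<Rightarrow> 'b \<Rightarrow> ennreal"
  assumes meas: "\<And>k. f k \<in> borel_measurable M" and le: "\<And>k. (\<integral>\<^sup>+x. f k x \<partial>M) \<le> ennreal (K * \<rho> ^ k)"
    and K: "0 \<le> K" "0 \<le> \<rho>" "\<rho> < 1"
  shows "AE x in M. (\<Sum>k. f k x) < \<infinity>"
proof -
  have "(\<integral>\<^sup>+x. (\<Sum>k. f k x) \<partial>M) = (\<Sum>k. \<integral>\<^sup>+x. f k x \<partial>M)" using meas by (rule nn_integral_suminf)
  also have "\<dots> \<le> (\<Sum>k. ennreal (K * \<rho> ^ k))" using le by (intro suminf_le) auto
  also have "\<dots> = ennreal (\<Sum>k. K * \<rho> ^ k)"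
    using K by (intro suminf_ennreal2 summable_mult summable_geometric) auto
  also have "\<dots> < \<infinity>" by simp
  finally have "(\<integral>\<^sup>+x. (\<Sum>k. f k x) \<partial>M) \<noteq> \<infinity>" by simp
  moreover have "(\<lambda>x. \<Sum>k. f k x) \<in> borel_measurable M" using meas by simp
  ultimately have "AE x in M. (\<Sum>k. f k x) \<noteq> \<infinity>" by (intro nn_integral_PInf_AE)
  thus ?thesis by (simp add: less_top)
qed

lemma AE_INF_eq_0:
  fixes f :: "nat \<Rightarrow> 'b \<Rightarrow> ennreal"
  assumes meas: "\<And>k. f k \<in> borel_measurable M" and le: "\<And>k. (\<integral>\<^sup>+x. f k x \<partial>M) \<le> ennreal (e k)"
    and e: "e \<longlonglongrightarrow> 0"
  shows "AE x in M. (INF k. f k x) = 0"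
proof -
  have "(\<integral>\<^sup>+x. (INF k. f k x) \<partial>M) \<le> ennreal (e k)" for k
    by (rule order_trans[OF nn_integral_mono le]) (rule INF_lower, simp)
  moreover have "(\<lambda>k. ennreal (e k)) \<longlonglongrightarrow> ennreal 0" using e by (rule tendsto_ennrealI)
  ultimately have "(\<integral>\<^sup>+x. (INF k. f k x) \<partial>M) \<le> ennreal 0" by (intro LIMSEQ_le_const) auto
  moreover have "(\<lambda>x. INF k. f k x) \<in> borel_measurable M" using meas by simp
  ultimately show ?thesis by (simp add: nn_integral_0_iff_AE)
qed

text \<open>The part of \<open>x\<close> above the level \<open>1 / t\<close> is controlled by
  \<open>t\<close> times its square: uniform integrability from second moments, in the form that
  lets almost sure convergence pass to means.\<close>

lemma ennreal_le_min_plus_square: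
  fixes x :: ennreal
  assumes "t > 0"
  shows "x \<le> min x (ennreal (1 / t)) + ennreal t * x\<^sup>2"
proof (cases "x \<le> ennreal (1 / t)")
  case True
  thus ?thesis by (simp add: min_def)
next
  case False
  have "1 = ennreal t * ennreal (1 / t)" using assms by (simp flip: ennreal_mult)
  also have "\<dots> \<le> ennreal t * x" using False by (intro mult_left_mono) auto
  finally have "1 * x \<le> ennreal t * x * x" by (rule mult_right_mono) simp
  thus ?thesis by (simp add: power2_eq_square mult.assoc add_increasing)
qed

text \<open>A value above the threshold is at most its square divided by the threshold. This trades
  the mass of a heavy ball for a second moment of the approximations, without mentioning the limit
  on the right.\<close>

lemma le_liminf_square:
  assumes L: "L \<le> liminf a" and \<tau>: "\<tau> > 0" "ennreal \<tau> < L"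
  shows "L \<le> liminf (\<lambda>n. ennreal (1 / \<tau>) * (a n)\<^sup>2)"
proof -
  have "\<forall>\<^sub>F n in sequentially. ennreal \<tau> < a n"
    using less_LiminfD[of "ennreal \<tau>" sequentially a] L \<tau>(2) by simp
  hence "\<forall>\<^sub>F n in sequentially. a n \<le> ennreal (1 / \<tau>) * (a n)\<^sup>2"
  proof eventually_elim
    case (elim n)
    have "1 = ennreal (1 / \<tau>) * ennreal \<tau>" using \<tau> by (simp flip: ennreal_mult)
    also have "\<dots> \<le> ennreal (1 / \<tau>) * a n" using elim by (intro mult_left_mono) auto
    finally have "1 * a n \<le> ennreal (1 / \<tau>) * a n * a n" by (rule mult_right_mono) simp
    thus ?case by (simp add: power2_eq_square mult.assoc)
  qed
  thus ?thesis by (intro order_trans[OF L] Liminf_mono)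
qed

section \<open>The limit measure and its total mass\<close>

locale cutout = poisson_cutout Q P Y \<alpha>
  for Q :: "'a::euclidean_space set measure" and P :: "'p measure" and Y :: "'p \<Rightarrow> 'a set set" and \<alpha> :: real +
  fixes \<Omega> :: "'a set" and mu_inf :: "'p \<Rightarrow> 'a measure"
  assumes Omega_bounded: "bounded \<Omega>"
    and Omega_meas: "\<Omega> \<in> sets lebesgue"
    and Omega_pos: "emeasure lebesgue \<Omega> > 0"
    and mu_borel: "\<And>\<omega>. \<omega> \<in> space P \<Longrightarrow> sets (mu_inf \<omega>) = sets borel \<and> finite_measure (mu_inf \<omega>)"
    and mu_limit: "AE \<omega> in P. weak_conv_measures
               (\<lambda>n. density lebesgue (\<lambda>x. ennreal (2 powr (real n * \<alpha>)) *
                   indicator (\<Omega> - Delta (2 powr (- real n)) 1 (Y \<omega>)) x))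
               (mu_inf \<omega>)"
begin

text \<open>Omega is only Lebesgue measurable. Pushing the restricted measure forward along the
  identity cuts the sigma-algebra down to the Borel sets.\<close>

definition base :: "'a measure" where
  "base = distr (density lebesgue (indicator \<Omega>)) borel (\<lambda>x. x)"

lemma emeasure_base:
  assumes "B \<in> sets borel"
  shows "emeasure base B = emeasure lebesgue (\<Omega> \<inter> B)"
proof -
  have "(\<lambda>x :: 'a. x) \<in> measurable lebesgue borel" by (rule measurable_completion) simp
  hence "emeasure base B = emeasure (density lebesgue (indicator \<Omega>)) B"
    unfolding base_def using assms by (subst emeasure_distr) auto
  also have "\<dots> = emeasure lebesgue (\<Omega> \<inter> B)"
  proof -
    have "\<Omega> \<inter> B \<in> sets lebesgue" "B \<in> sets lebesgue" using assms Omega_meas by auto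
    thus ?thesis using Omega_meas by (subst emeasure_density) (simp_all flip: indicator_inter_arith)
  qed
  finally show ?thesis .
qed

lemma emeasure_lebesgue_Omega_Int: "emeasure lebesgue (\<Omega> \<inter> B) < \<infinity>" if "B \<in> sets borel"
proof -
  have "emeasure lebesgue (\<Omega> \<inter> B) \<le> emeasure lebesgue \<Omega>"
    using Omega_meas by (intro emeasure_mono) auto
  also have "\<dots> < \<infinity>"
    using fmeasurableD2[OF bounded_set_imp_lmeasurable[OF Omega_bounded Omega_meas]]
    unfolding infinity_ennreal_def top.not_eq_extremum .
  finally show ?thesis .
qed

sublocale cutout_mass Q P Y \<alpha> base
proof (intro cutout_mass.intro poisson_cutout_axioms cutout_mass_axioms.intro finite_measureI)
  show "sets base = sets borel" by (simp add: base_def)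
  show "emeasure base (space base) \<noteq> \<infinity>"
    using emeasure_base[of UNIV] emeasure_lebesgue_Omega_Int[of UNIV] by (simp add: base_def less_top)
  fix B :: "'a set" assume B: "B \<in> sets borel"
  have "emeasure lebesgue (\<Omega> \<inter> B) \<le> emeasure lebesgue B" using B by (intro emeasure_mono) auto
  thus "emeasure base B \<le> emeasure lborel B" using B by (simp add: emeasure_base)
qed

lemma base_UNIV_pos: "emeasure base UNIV > 0"
  using Omega_pos by (simp add: emeasure_base)

text \<open>All later estimates on \<open>mu_inf\<close> go through these two facts. On open sets
  weak convergence gives an upper bound; the total mass converges exactly because the constant 1 is
  a test function.\<close>

lemma AE_mu_inf:
  "AE \<omega> in P. (\<forall>U. open U \<longrightarrow> emeasure (mu_inf \<omega>) U \<le> liminf (\<lambda>n. mass n U \<omega>)) \<and>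
     (\<lambda>n. mass n UNIV \<omega>) \<longlonglongrightarrow> emeasure (mu_inf \<omega>) UNIV"
  using mu_limit AE_vacant AE_space
proof eventually_elim
  case (elim \<omega>)
  define \<mu>s where "\<mu>s n = density lebesgue (\<lambda>x. ennreal (2 powr (real n * \<alpha>)) *
                   indicator (\<Omega> - Delta (2 powr (- real n)) 1 (Y \<omega>)) x)" for n
  have \<mu>s_eq: "\<mu>s n = density lebesgue (\<lambda>x. ennreal (2 powr (real n * \<alpha>)) * indicator (\<Omega> \<inter> vacant n \<omega>) x)" for n
  proof -
    have "\<Omega> - Delta (2 powr (- real n)) 1 (Y \<omega>) = \<Omega> \<inter> vacant n \<omega>"
      using elim(2) two_powr_eq_half_power[of n] by auto
    thus ?thesis by (simp add: \<mu>s_def)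
  qed
  have V: "\<Omega> \<inter> vacant n \<omega> \<in> sets lebesgue" for n
    using Omega_meas open_vacant by (intro sets.Int) auto
  have em: "emeasure (\<mu>s n) U = mass n U \<omega>" if U: "U \<in> sets borel" for n U
  proof -
    have "emeasure (\<mu>s n) U = (\<integral>\<^sup>+x. ennreal (2 powr (real n * \<alpha>)) * indicator (\<Omega> \<inter> vacant n \<omega>) x * indicator U x \<partial>lebesgue)"
      unfolding \<mu>s_eq using V U by (intro emeasure_density) auto
    also have "\<dots> = (\<integral>\<^sup>+x. ennreal (2 powr (real n * \<alpha>)) * indicator (\<Omega> \<inter> (U \<inter> vacant n \<omega>)) x \<partial>lebesgue)"
      by (intro nn_integral_cong) (auto simp: indicator_def)
    also have "\<dots> = ennreal (2 powr (real n * \<alpha>)) * emeasure lebesgue (\<Omega> \<inter> (U \<inter> vacant n \<omega>))"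
      using Omega_meas U open_vacant by (intro nn_integral_cmult_indicator) auto
    also have "emeasure lebesgue (\<Omega> \<inter> (U \<inter> vacant n \<omega>)) = emeasure base (U \<inter> vacant n \<omega>)"
      using U open_vacant by (intro emeasure_base[symmetric]) auto
    finally show ?thesis by (simp add: mass_def)
  qed
  have sp: "space (\<mu>s n) = UNIV" "sets borel \<subseteq> sets (\<mu>s n)" for n by (auto simp: \<mu>s_def)
  have fin: "finite_measure (\<mu>s n)" for n
  proof (rule finite_measureI)
    have "emeasure (\<mu>s n) UNIV = mass n UNIV \<omega>" by (rule em) simp
    also have "\<dots> < \<infinity>" unfolding mass_def
      using nu.emeasure_finite[of "UNIV \<inter> vacant n \<omega>"] unfolding infinity_ennreal_def top.not_eq_extremum
      by (intro ennreal_mult_less_top[THEN iffD2]) auto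
    finally show "emeasure (\<mu>s n) (space (\<mu>s n)) \<noteq> \<infinity>" using sp by simp
  qed
  have lim: "weak_conv_measures \<mu>s (mu_inf \<omega>)" using elim(1) by (simp add: \<mu>s_def[abs_def])
  have mu: "sets (mu_inf \<omega>) = sets borel" "finite_measure (mu_inf \<omega>)" using mu_borel[OF elim(3)] by auto
  have "emeasure (mu_inf \<omega>) U \<le> liminf (\<lambda>n. mass n U \<omega>)" if U: "open U" for U
    using weak_conv_open_le[OF lim sp(2,1) fin mu U] U by (simp add: em)
  moreover have "(\<lambda>n. mass n UNIV \<omega>) \<longlonglongrightarrow> emeasure (mu_inf \<omega>) UNIV"
  proof -
    have "(\<lambda>n. ennreal (measure (\<mu>s n) UNIV)) \<longlonglongrightarrow> ennreal (measure (mu_inf \<omega>) UNIV)"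
      using sets_eq_imp_space_eq[OF mu(1)] sp lim by (intro tendsto_ennrealI weak_conv_measure_UNIV) auto
    moreover have "ennreal (measure (\<mu>s n) UNIV) = mass n UNIV \<omega>" for n
      using finite_measure.emeasure_eq_measure[OF fin, of n UNIV] em[of UNIV n] by simp
    moreover have "ennreal (measure (mu_inf \<omega>) UNIV) = emeasure (mu_inf \<omega>) UNIV"
      by (rule finite_measure.emeasure_eq_measure[OF mu(2), symmetric])
    ultimately show ?thesis by (simp only:)
  qed
  ultimately show ?case by blast
qed

text \<open>A limit that vanishes almost surely would make the total masses tend to 0, although
  their mean stays at the volume of Omega. Dominated convergence handles the masses truncated at
  \<open>1 / t\<close>, and the L^2 bound leaves an excess of at most \<open>t * C\<close>.\<close>

lemma not_AE_mu_inf_null: "\<not> (AE \<omega> in P. mu_inf \<omega> = null_measure (mu_inf \<omega>))"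
proof
  assume null: "AE \<omega> in P. mu_inf \<omega> = null_measure (mu_inf \<omega>)"
  have "AE \<omega> in P. (\<lambda>n. mass n UNIV \<omega>) \<longlonglongrightarrow> 0"
    using null AE_mu_inf
  proof eventually_elim
    case (elim \<omega>)
    have "emeasure (mu_inf \<omega>) UNIV = 0" by (subst elim(1)) simp
    thus ?case using elim(2) by simp
  qed
  note conv = this
  obtain C where C: "C \<ge> 0" "\<And>n. (\<integral>\<^sup>+\<omega>. (mass n UNIV \<omega>)\<^sup>2 \<partial>P) \<le> ennreal C" using mass_sq_total by blast
  have le: "emeasure base UNIV \<le> ennreal (t * C)" if t: "t > 0" for t
  proof -
    let ?m = "\<lambda>n \<omega>. min (mass n UNIV \<omega>) (ennreal (1 / t))"
    have "(\<lambda>n. \<integral>\<^sup>+\<omega>. ?m n \<omega> \<partial>P) \<longlonglongrightarrow> (\<integral>\<^sup>+\<omega>. 0 \<partial>P)"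
    proof (rule nn_integral_dominated_convergence[where w = "\<lambda>_. ennreal (1 / t)"])
      show "AE \<omega> in P. (\<lambda>n. ?m n \<omega>) \<longlonglongrightarrow> 0"
        using conv
      proof eventually_elim
        case (elim \<omega>)
        from tendsto_min[OF elim tendsto_const[of "ennreal (1 / t)"]] show ?case by simp
      qed
    qed (auto simp: emeasure_space_1)
    hence "(\<lambda>n. (\<integral>\<^sup>+\<omega>. ?m n \<omega> \<partial>P) + ennreal (t * C)) \<longlonglongrightarrow> 0 + ennreal (t * C)"
      by (intro tendsto_add tendsto_const) simp
    moreover have "emeasure base UNIV \<le> (\<integral>\<^sup>+\<omega>. ?m n \<omega> \<partial>P) + ennreal (t * C)" for n
    proof -
      have "emeasure base UNIV = (\<integral>\<^sup>+\<omega>. mass n UNIV \<omega> \<partial>P)" by (rule nn_integral_mass[symmetric]) simp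
      also have "\<dots> \<le> (\<integral>\<^sup>+\<omega>. ?m n \<omega> + ennreal t * (mass n UNIV \<omega>)\<^sup>2 \<partial>P)"
        by (intro nn_integral_mono ennreal_le_min_plus_square t)
      also have "\<dots> = (\<integral>\<^sup>+\<omega>. ?m n \<omega> \<partial>P) + ennreal t * (\<integral>\<^sup>+\<omega>. (mass n UNIV \<omega>)\<^sup>2 \<partial>P)"
        by (subst nn_integral_add) (auto simp: nn_integral_cmult)
      also have "\<dots> \<le> (\<integral>\<^sup>+\<omega>. ?m n \<omega> \<partial>P) + ennreal t * ennreal C"
        by (intro add_left_mono mult_left_mono C) simp
      finally show ?thesis using t C(1) by (simp add: ennreal_mult)
    qed
    ultimately show ?thesis by (intro LIMSEQ_le_const) auto
  qed
  \<comment> \<open>Since \<open>C\<close> is independent of \<open>t\<close>, letting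
    \<open>t\<close> tend to 0 contradicts the positive volume.\<close>
  have "((\<lambda>t. ennreal (t * C)) \<longlongrightarrow> ennreal (0 * C)) (at_right 0)"
    by (intro tendsto_ennrealI tendsto_intros)
  hence "emeasure base UNIV \<le> ennreal (0 * C)"
    by (rule tendsto_lowerbound) (auto simp: eventually_at_filter le)
  thus False using base_UNIV_pos by simp
qed

text \<open>The covering centres are fixed independently of \<open>\<omega>\<close>, so that
  expectations of sums over them can be taken term by term.\<close>

definition grid :: "nat \<Rightarrow> 'a set" where
  "grid = (SOME I. \<exists>C\<ge>1. \<forall>k. finite (I k) \<and> real (card (I k)) \<le> C * 2 ^ (k * DIM('a)) \<and> \<Omega> \<subseteq> (\<Union>c\<in>I k. cball c ((1/2) ^ k)))"

lemma grid: "\<exists>C\<ge>1. \<forall>k. finite (grid k) \<and> real (card (grid k)) \<le> C * 2 ^ (k * DIM('a)) \<and> \<Omega> \<subseteq> (\<Union>c\<in>grid k. cball c ((1/2) ^ k))"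
proof -
  obtain C where C: "C \<ge> 1" "\<And>k. \<exists>I. finite I \<and> real (card I) \<le> C * 2 ^ (k * DIM('a)) \<and> \<Omega> \<subseteq> (\<Union>c\<in>I. cball c ((1/2) ^ k))"
    using grid_cover[OF Omega_bounded] by blast
  from C(2) have "\<exists>I. \<forall>k. finite (I k) \<and> real (card (I k)) \<le> C * 2 ^ (k * DIM('a)) \<and> \<Omega> \<subseteq> (\<Union>c\<in>I k. cball c ((1/2) ^ k))"
    by metis
  hence "\<exists>I. \<exists>C\<ge>1. \<forall>k. finite (I k) \<and> real (card (I k)) \<le> C * 2 ^ (k * DIM('a)) \<and> \<Omega> \<subseteq> (\<Union>c\<in>I k. cball c ((1/2) ^ k))"
    using C(1) by blast
  from someI_ex[OF this] show ?thesis unfolding grid_def .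
qed

lemma finite_grid [simp]: "finite (grid k)" and Omega_grid: "\<Omega> \<subseteq> (\<Union>c\<in>grid k. cball c ((1/2) ^ k))"
  using grid by blast+

section \<open>Box dimension of the cutout set\<close>

definition cutset :: "'p \<Rightarrow> 'a set" where
  "cutset \<omega> = (\<Inter>n. \<Omega> - Delta (2 powr (- real n)) 1 (Y \<omega>))"

lemma cutset_sub: "cutset \<omega> \<subseteq> \<Omega>"
  by (auto simp: cutset_def)

lemma bounded_closure_cutset: "bounded (closure (cutset \<omega>))"
  using bounded_subset[OF Omega_bounded cutset_sub] by (rule bounded_closure)

text \<open>A cutout containing a whole ball removes all of its points, so only balls not contained
  in a cutout are needed. They are finitely many and closed, so they cover the closure as
  well.\<close>

lemma cutset_cover:
  "closure (cutset \<omega>) \<subseteq> (\<Union>c\<in>{c\<in>grid k. con_sets (cball c ((1/2) ^ k)) ((1/2) ^ k) 1 \<inter> Y \<omega> = {}}. cball c ((1/2) ^ k))"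
proof (rule closure_minimal)
  show "cutset \<omega> \<subseteq> (\<Union>c\<in>{c\<in>grid k. con_sets (cball c ((1/2) ^ k)) ((1/2) ^ k) 1 \<inter> Y \<omega> = {}}. cball c ((1/2) ^ k))"
  proof
    fix x assume x: "x \<in> cutset \<omega>"
    then obtain c where c: "c \<in> grid k" "x \<in> cball c ((1/2) ^ k)" using cutset_sub Omega_grid by blast
    have "x \<notin> Delta ((1/2) ^ k) 1 (Y \<omega>)" using x unfolding cutset_def two_powr_eq_half_power by blast
    hence "con_sets (cball c ((1/2) ^ k)) ((1/2) ^ k) 1 \<inter> Y \<omega> = {}"
      using c(2) unfolding Delta_def con_sets_def by blast
    thus "x \<in> (\<Union>c\<in>{c\<in>grid k. con_sets (cball c ((1/2) ^ k)) ((1/2) ^ k) 1 \<inter> Y \<omega> = {}}. cball c ((1/2) ^ k))"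
      using c by blast
  qed
qed (auto intro!: closed_UN)

lemma AE_upper_box_dim_le_aux:
  assumes s: "s > real DIM('a) - \<alpha>"
  shows "AE \<omega> in P. upper_box_dim (closure (cutset \<omega>)) \<le> ereal s"
proof -
  define D where "D = real DIM('a) - \<alpha>"
  \<comment> \<open>Half of the exponential gain \<open>(s - D) * ln 2\<close> is given up to the
    loss in \<open>measure_con_cball_ge\<close>; the other half gives the geometric factor
    \<open>exp (- \<epsilon>)\<close>.\<close>
  define \<epsilon> where "\<epsilon> = (s - D) * ln 2 / 2"
  have \<epsilon>: "\<epsilon> > 0" using s by (simp add: \<epsilon>_def D_def)
  have s0: "s > 0" using s alpha_lt by simp
  obtain b where b: "\<And>n x. measure Q (con_sets (cball x ((1/2) ^ n)) ((1/2) ^ n) 1) \<ge> real n * (\<alpha> * ln 2 - \<epsilon>) - b"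
    using measure_con_cball_ge[OF \<epsilon>] by blast
  obtain C where C: "C \<ge> 1" "\<And>k. real (card (grid k)) \<le> C * 2 ^ (k * DIM('a))" using grid by blast
  define J where "J k \<omega> = {c\<in>grid k. con_sets (cball c ((1/2) ^ k)) ((1/2) ^ k) 1 \<inter> Y \<omega> = {}}" for k \<omega>
  define H where "H k c = {\<omega> \<in> space P. con_sets (cball c ((1/2) ^ k)) ((1/2) ^ k) 1 \<inter> Y \<omega> = {}}" for k c
  have H: "H k c \<in> events" for k c unfolding H_def by (intro void_event sets_con)
  \<comment> \<open>The weighted number of surviving balls. Finiteness of the sum over
    \<open>k\<close> bounds every term by one constant \<open>M\<close>, which is needed because
    \<open>upper_box_dim_le\<close> asks for a bound at all scales.\<close>
  define f where "f k \<omega> = ennreal (((1/2) ^ k) powr s) * (\<Sum>c\<in>grid k. indicator (H k c) \<omega>)" for k \<omega>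
  have f_eq: "f k \<omega> = ennreal (((1/2) ^ k) powr s * real (card (J k \<omega>)))" if "\<omega> \<in> space P" for k \<omega>
  proof -
    have "(\<Sum>c\<in>grid k. indicator (H k c) \<omega>) = (\<Sum>c\<in>J k \<omega>. 1 :: ennreal)"
      unfolding J_def using that by (intro sum.mono_neutral_cong_right) (auto simp: H_def)
    thus ?thesis by (simp add: f_def ennreal_mult ennreal_of_nat_eq_real_of_nat)
  qed
  have "AE \<omega> in P. (\<Sum>k. f k \<omega>) < \<infinity>"
  proof (rule AE_suminf_finite)
    show "f k \<in> borel_measurable P" for k
      unfolding f_def[abs_def] using H by measurable
    show "(\<integral>\<^sup>+\<omega>. f k \<omega> \<partial>P) \<le> ennreal (C * exp b * exp (- \<epsilon>) ^ k)" for k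
    proof -
      have pH: "emeasure P (H k c) \<le> ennreal (exp (b - real k * (\<alpha> * ln 2 - \<epsilon>)))" for c
      proof -
        have "prob (H k c) = exp (- measure Q (con_sets (cball c ((1/2) ^ k)) ((1/2) ^ k) 1))"
          unfolding H_def by (intro void_prob sets_con Q_con_finite) (auto simp: not_less)
        thus ?thesis using b[of k c] by (simp add: emeasure_eq_measure ennreal_leI)
      qed
      have "(\<integral>\<^sup>+\<omega>. f k \<omega> \<partial>P) = ennreal (((1/2) ^ k) powr s) * (\<Sum>c\<in>grid k. emeasure P (H k c))"
        unfolding f_def using H by (subst nn_integral_cmult) (auto simp: nn_integral_sum)
      also have "\<dots> \<le> ennreal (((1/2) ^ k) powr s) * (\<Sum>c\<in>grid k. ennreal (exp (b - real k * (\<alpha> * ln 2 - \<epsilon>))))"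
        by (intro mult_left_mono sum_mono pH) simp
      also have "\<dots> = ennreal (((1/2) ^ k) powr s * (real (card (grid k)) * exp (b - real k * (\<alpha> * ln 2 - \<epsilon>))))"
        by (simp add: ennreal_mult ennreal_of_nat_eq_real_of_nat)
      also have "\<dots> \<le> ennreal (((1/2) ^ k) powr s * ((C * 2 ^ (k * DIM('a))) * exp (b - real k * (\<alpha> * ln 2 - \<epsilon>))))"
        by (intro ennreal_leI mult_left_mono mult_right_mono C) auto
      also have "((1/2) ^ k) powr s * ((C * 2 ^ (k * DIM('a))) * exp (b - real k * (\<alpha> * ln 2 - \<epsilon>))) = C * exp b * exp (- \<epsilon>) ^ k"
      proof -
        have 1: "((1/2) ^ k) powr s = exp (- (real k * s * ln 2))"
          by (simp add: powr_def ln_realpow ln_div)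
        have 2: "(2::real) ^ (k * DIM('a)) = exp (real k * real DIM('a) * ln 2)"
          by (subst powr_realpow[symmetric]) (auto simp: powr_def)
        have 3: "exp (- \<epsilon>) ^ k = exp (- (real k * \<epsilon>))" by (simp add: exp_of_nat_mult[symmetric])
        have 4: "real k * s * ln 2 = real k * (real DIM('a) - \<alpha>) * ln 2 + 2 * (real k * \<epsilon>)"
          by (simp add: \<epsilon>_def D_def field_simps)
        show ?thesis unfolding 1 2 3 4 by (simp add: field_simps flip: exp_add)
      qed
      finally show ?thesis .
    qed
    show "exp (- \<epsilon>) < 1" using \<epsilon> by simp
  qed (use C in auto)
  with AE_space show ?thesis
  proof eventually_elim
    case (elim \<omega>)
    then obtain M where M: "(\<Sum>k. f k \<omega>) = ennreal M" "M \<ge> 0" by (cases "\<Sum>k. f k \<omega>") auto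
    have card: "real (card (J k \<omega>)) \<le> M * ((1/2) ^ k) powr (- s)" for k
    proof -
      have "ennreal (((1/2) ^ k) powr s * real (card (J k \<omega>))) \<le> ennreal M"
        using term_le_suminf[of "\<lambda>k. f k \<omega>" k] f_eq[OF elim(1), of k] M by simp
      hence "((1/2) ^ k) powr s * real (card (J k \<omega>)) \<le> M" using M(2) by (subst (asm) ennreal_le_iff) auto
      thus ?thesis by (simp add: powr_minus field_simps)
    qed
    show ?case
    proof (rule upper_box_dim_le[OF bounded_closure_cutset])
      \<comment> \<open>\<open>M\<close> may be below 1; adding 1 meets the requirement on the
        constant.\<close>
      show "1 \<le> (M + 1) * 2 powr s"
        using mult_mono[of 1 "M + 1" 1 "2 powr s"] M(2) s0 by (simp add: ge_one_powr_ge_zero)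
      show "real (covering_number ((1/2) ^ k) (closure (cutset \<omega>))) \<le> (M + 1) * 2 powr s * ((1/2) ^ k) powr (- s)" for k
      proof -
        \<comment> \<open>The grid one level finer is used because a ball of radius
          \<open>2^-(k+1)\<close> has diameter \<open>2^-k\<close>; this costs the factor
          \<open>2 powr s\<close>.\<close>
        have "covering_number ((1/2) ^ k) (closure (cutset \<omega>)) \<le> card ((\<lambda>c. cball c ((1/2) ^ Suc k)) ` J (Suc k) \<omega>)"
          using cutset_cover[of \<omega> "Suc k"] by (intro covering_number_le) (auto simp: J_def)
        also have "\<dots> \<le> card (J (Suc k) \<omega>)" by (rule card_image_le) (simp add: J_def)
        finally have "real (covering_number ((1/2) ^ k) (closure (cutset \<omega>))) \<le> real (card (J (Suc k) \<omega>))" by simp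
        also have "\<dots> \<le> M * ((1/2) ^ Suc k) powr (- s)" by (rule card)
        also have "\<dots> \<le> (M + 1) * ((1/2) ^ Suc k) powr (- s)" by (intro mult_right_mono) auto
        also have "((1/2 :: real) ^ Suc k) powr (- s) = 2 powr s * ((1/2) ^ k) powr (- s)"
          by (simp add: powr_mult powr_minus_divide powr_divide)
        finally show ?thesis by (simp add: mult.assoc)
      qed
    qed (use s0 in simp)
  qed
qed

lemma AE_upper_box_dim_le: "AE \<omega> in P. upper_box_dim (closure (cutset \<omega>)) \<le> ereal (real DIM('a) - \<alpha>)"
proof -
  have "AE \<omega> in P. \<forall>j. upper_box_dim (closure (cutset \<omega>)) \<le> ereal (real DIM('a) - \<alpha> + 1 / Suc j)"
    unfolding AE_all_countable by (intro allI AE_upper_box_dim_le_aux) simp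
  thus ?thesis
  proof eventually_elim
    case (elim \<omega>)
    have "(\<lambda>j. real DIM('a) - \<alpha> + 1 / real (Suc j)) \<longlonglongrightarrow> real DIM('a) - \<alpha> + 0"
      by (intro tendsto_add tendsto_const LIMSEQ_Suc lim_1_over_n)
    hence "(\<lambda>j. ereal (real DIM('a) - \<alpha> + 1 / real (Suc j))) \<longlonglongrightarrow> ereal (real DIM('a) - \<alpha>)"
      by (intro tendsto_ereal) simp
    thus ?case by (rule LIMSEQ_le_const) (use elim in auto)
  qed
qed

end

section \<open>Local and Hausdorff dimension\<close>

context cutout
begin

section \<open>Support of the limit measure\<close>

lemma mu_sets: "\<omega> \<in> space P \<Longrightarrow> sets (mu_inf \<omega>) = sets borel"
  and mu_finite: "\<omega> \<in> space P \<Longrightarrow> finite_measure (mu_inf \<omega>)"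
  using mu_borel by auto

text \<open>\<open>B\<close> need not be measurable, so it is trapped in open sets, the ones on
  which \<open>mu_inf\<close> can be estimated. An infimum of 0 over the bounds suffices.\<close>

lemma AE_mu_inf_not_in:
  fixes V :: "nat \<Rightarrow> 'a set"
  assumes \<omega>: "\<omega> \<in> space P" and V: "\<And>k. open (V k)"
    and le: "\<And>k. emeasure (mu_inf \<omega>) (V k) \<le> f k" and f: "(INF k. f k) = 0"
    and B: "\<And>k. B \<subseteq> V k"
  shows "AE x in mu_inf \<omega>. x \<notin> B"
proof -
  have meas: "V k \<in> sets (mu_inf \<omega>)" for k using V by (simp add: mu_sets[OF \<omega>])
  have "emeasure (mu_inf \<omega>) (\<Inter>k. V k) \<le> f k" for k
    using meas by (intro order_trans[OF emeasure_mono le]) auto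
  hence "emeasure (mu_inf \<omega>) (\<Inter>k. V k) \<le> (INF k. f k)" by (rule INF_greatest)
  hence "emeasure (mu_inf \<omega>) (\<Inter>k. V k) = 0" using f by simp
  moreover have "(\<Inter>k. V k) \<in> sets (mu_inf \<omega>)"
    using meas by (intro sets.countable_INT) auto
  ultimately have "(\<Inter>k. V k) \<in> null_sets (mu_inf \<omega>)" by (rule null_setsI)
  thus ?thesis by (rule AE_I') (use B in auto)
qed

lemma nn_integral_liminf_mass_le:
  assumes "U \<in> sets borel" "H \<in> events"
    and "\<And>m. m \<ge> n \<Longrightarrow> (\<integral>\<^sup>+\<omega>. mass m U \<omega> * indicator H \<omega> \<partial>P) \<le> B"
  shows "(\<integral>\<^sup>+\<omega>. liminf (\<lambda>m. mass m U \<omega> * indicator H \<omega>) \<partial>P) \<le> B"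
proof -
  have "(\<integral>\<^sup>+\<omega>. liminf (\<lambda>m. mass m U \<omega> * indicator H \<omega>) \<partial>P) \<le> liminf (\<lambda>m. \<integral>\<^sup>+\<omega>. mass m U \<omega> * indicator H \<omega> \<partial>P)"
    using assms(1,2)
    by (intro nn_integral_liminf borel_measurable_times_ennreal mass_measurable borel_measurable_indicator)
  also have "\<dots> \<le> Liminf sequentially (\<lambda>m. B)"
    using assms(3) by (intro Liminf_mono eventually_sequentiallyI[of n])
  also have "\<dots> = B" by (simp add: Liminf_const)
  finally show ?thesis .
qed

text \<open>Weak limits need not respect a set that is not closed. Open sets \<open>T j\<close>
  around the complement meet Omega in volume below \<open>2^-j\<close>, and that volume is the mean
  of their mass, so Fatou bounds the limit.\<close>

lemma AE_mu_inf_in_Omega: "AE \<omega> in P. AE x in mu_inf \<omega>. x \<in> \<Omega>"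
proof -
  have "\<exists>T. open T \<and> - \<Omega> \<subseteq> T \<and> emeasure lebesgue (T - (- \<Omega>)) < ennreal ((1/2) ^ j)" for j
  proof -
    have "- \<Omega> \<in> sets lebesgue" using sets.compl_sets[OF Omega_meas] by (simp add: Compl_eq_Diff_UNIV)
    moreover have "(0::real) < (1/2) ^ j" by simp
    ultimately obtain T where "open T" "- \<Omega> \<subseteq> T" "emeasure lebesgue (T - (- \<Omega>)) < ennreal ((1/2) ^ j)"
      by (rule sets_lebesgue_outer_open)
    thus ?thesis by blast
  qed
  hence "\<exists>T. \<forall>j. open (T j) \<and> - \<Omega> \<subseteq> T j \<and> emeasure lebesgue (T j - (- \<Omega>)) < ennreal ((1/2) ^ j)"
    by (intro choice allI)
  then obtain T where T: "\<And>j. open (T j)" "\<And>j. - \<Omega> \<subseteq> T j"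
    "\<And>j. emeasure lebesgue (T j - (- \<Omega>)) < ennreal ((1/2) ^ j)" by blast
  have "AE \<omega> in P. (INF j. liminf (\<lambda>n. mass n (T j) \<omega>)) = 0"
  proof (rule AE_INF_eq_0)
    fix j
    have Tb: "T j \<in> sets borel" using T(1) by simp
    show "(\<lambda>\<omega>. liminf (\<lambda>n. mass n (T j) \<omega>)) \<in> borel_measurable P" using Tb by measurable
    have "(\<integral>\<^sup>+\<omega>. liminf (\<lambda>n. mass n (T j) \<omega>) \<partial>P) \<le> liminf (\<lambda>n. \<integral>\<^sup>+\<omega>. mass n (T j) \<omega> \<partial>P)"
      by (intro nn_integral_liminf mass_measurable Tb)
    also have "\<dots> = emeasure base (T j)" using Tb by (simp add: nn_integral_mass Liminf_const)
    also have "\<dots> = emeasure lebesgue (T j - (- \<Omega>))"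
      unfolding emeasure_base[OF Tb] by (rule arg_cong[where f = "emeasure lebesgue"]) auto
    also have "\<dots> \<le> ennreal ((1/2) ^ j)" using T(3)[of j] by simp
    finally show "(\<integral>\<^sup>+\<omega>. liminf (\<lambda>n. mass n (T j) \<omega>) \<partial>P) \<le> ennreal ((1/2) ^ j)" .
  qed (intro LIMSEQ_realpow_zero, auto)
  with AE_mu_inf AE_space show ?thesis
  proof eventually_elim
    case (elim \<omega>)
    have "AE x in mu_inf \<omega>. x \<notin> - \<Omega>"
      by (rule AE_mu_inf_not_in[OF elim(2) T(1) _ elim(3) T(2)]) (use elim(1) T(1) in blast)
    thus ?case by simp
  qed
qed

text \<open>The removed part of Omega is covered by the grid balls hit by a cutout. The expected
  mass of such a ball is its volume times \<open>\<delta> k\<close>; the number of balls times the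
  volume is bounded over all scales, and \<open>\<delta> k\<close> tends to 0. Interiors and
  frontiers are treated together in this way.\<close>

lemma AE_mu_inf_not_in_Delta:
  "AE \<omega> in P. AE x in mu_inf \<omega>. x \<notin> \<Omega> \<inter> Delta ((1/2) ^ n) 1 (Y \<omega>)"
proof -
  define r where "r k = ((1/2) ^ k :: real)" for k
  define H where "H k c = {\<omega> \<in> space P. hit_sets (cball c (r k)) ((1/2) ^ n) 1 \<inter> Y \<omega> \<noteq> {}}" for k c
  \<comment> \<open>The grid is one level finer than the radius: its closed balls then lie in open
    balls of radius \<open>r k\<close>, and only open sets allow the comparison with
    \<open>mass\<close>.\<close>
  define f where "f k \<omega> = (\<Sum>c\<in>grid (Suc k). liminf (\<lambda>m. mass m (ball c (r k)) \<omega> * indicator (H k c) \<omega>))" for k \<omega>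
  define \<delta> where "\<delta> k = measure Q (hit_sets (cball 0 (r k)) ((1/2) ^ n) 1 - con_sets (cball 0 (r k)) ((1/2) ^ n) 1)" for k
  obtain C where C: "C \<ge> 1" "\<And>k. real (card (grid k)) \<le> C * 2 ^ (k * DIM('a))" using grid by blast
  let ?v = "unit_ball_vol (real DIM('a))"
  have H: "H k c \<in> events" for k c
  proof -
    have "space P - {\<omega> \<in> space P. hit_sets (cball c (r k)) ((1/2) ^ n) 1 \<inter> Y \<omega> = {}} \<in> events"
      by (intro sets.Diff sets.top void_event sets_hit) simp
    also have "space P - {\<omega> \<in> space P. hit_sets (cball c (r k)) ((1/2) ^ n) 1 \<inter> Y \<omega> = {}} = H k c"
      by (auto simp: H_def)
    finally show ?thesis .
  qed
  have liminf_meas: "(\<lambda>\<omega>. liminf (\<lambda>m. mass m (ball c (r k)) \<omega> * indicator (H k c) \<omega>)) \<in> borel_measurable P" for k c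
    by (intro borel_measurable_liminf borel_measurable_times_ennreal mass_measurable borel_measurable_indicator H) simp
  have "AE \<omega> in P. (INF k. f k \<omega>) = 0"
  proof (rule AE_INF_eq_0)
    show "f k \<in> borel_measurable P" for k
      unfolding f_def[abs_def] using liminf_meas by measurable
    show "(\<lambda>k. C * 2 ^ DIM('a) * ?v * \<delta> k) \<longlonglongrightarrow> 0"
      using tendsto_mult_right_zero[OF measure_near_boundary_tendsto[of "(1/2) ^ n" 1]]
      by (simp add: \<delta>_def r_def)
    show "(\<integral>\<^sup>+\<omega>. f k \<omega> \<partial>P) \<le> ennreal (C * 2 ^ DIM('a) * ?v * \<delta> k)" for k
    proof -
      have le: "(\<integral>\<^sup>+\<omega>. liminf (\<lambda>m. mass m (ball c (r k)) \<omega> * indicator (H k c) \<omega>) \<partial>P) \<le> ennreal (?v * (1/2) ^ (k * DIM('a)) * \<delta> k)" for c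
      proof (rule nn_integral_liminf_mass_le[OF _ H])
        fix m assume "n \<le> m"
        hence "(\<integral>\<^sup>+\<omega>. mass m (ball c (r k)) \<omega> * indicator (H k c) \<omega> \<partial>P) \<le> emeasure base (ball c (r k)) * ennreal (\<delta> k)"
          unfolding H_def \<delta>_def by (intro nn_integral_mass_hit_le) (auto simp: r_def)
        also have "emeasure base (ball c (r k)) \<le> emeasure base (cball c (r k))" by (intro emeasure_mono) auto
        also have "\<dots> \<le> ennreal (?v * (r k) ^ DIM('a))" by (rule nu_cball_le) (simp add: r_def)
        finally show "(\<integral>\<^sup>+\<omega>. mass m (ball c (r k)) \<omega> * indicator (H k c) \<omega> \<partial>P) \<le> ennreal (?v * (1/2) ^ (k * DIM('a)) * \<delta> k)"
          by (simp add: r_def \<delta>_def power_mult mult_right_mono flip: ennreal_mult)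
      qed simp
      have "(\<integral>\<^sup>+\<omega>. f k \<omega> \<partial>P) = (\<Sum>c\<in>grid (Suc k). \<integral>\<^sup>+\<omega>. liminf (\<lambda>m. mass m (ball c (r k)) \<omega> * indicator (H k c) \<omega>) \<partial>P)"
        unfolding f_def by (intro nn_integral_sum liminf_meas)
      also have "\<dots> \<le> (\<Sum>c\<in>grid (Suc k). ennreal (?v * (1/2) ^ (k * DIM('a)) * \<delta> k))"
        by (intro sum_mono le)
      also have "\<dots> = ennreal (real (card (grid (Suc k))) * (?v * (1/2) ^ (k * DIM('a)) * \<delta> k))"
        by (simp add: ennreal_mult ennreal_of_nat_eq_real_of_nat \<delta>_def)
      also have "\<dots> \<le> ennreal ((C * 2 ^ (Suc k * DIM('a))) * (?v * (1/2) ^ (k * DIM('a)) * \<delta> k))"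
        by (intro ennreal_leI mult_right_mono C) (simp add: \<delta>_def)
      also have "(C * 2 ^ (Suc k * DIM('a))) * (?v * (1/2) ^ (k * DIM('a)) * \<delta> k) = C * 2 ^ DIM('a) * ?v * \<delta> k"
        by (simp add: power_add power_one_over)
      finally show ?thesis .
    qed
  qed
  with AE_mu_inf AE_space show ?thesis
  proof eventually_elim
    case (elim \<omega>)
    define V where "V k = (\<Union>c\<in>{c\<in>grid (Suc k). \<omega> \<in> H k c}. ball c (r k))" for k
    show ?case
    proof (rule AE_mu_inf_not_in[OF elim(2) _ _ elim(3)])
      show "open (V k)" for k unfolding V_def by blast
      show "emeasure (mu_inf \<omega>) (V k) \<le> f k \<omega>" for k
      proof -
        have "emeasure (mu_inf \<omega>) (V k) \<le> (\<Sum>c\<in>{c\<in>grid (Suc k). \<omega> \<in> H k c}. emeasure (mu_inf \<omega>) (ball c (r k)))"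
          unfolding V_def by (intro emeasure_subadditive_finite) (auto simp: mu_sets[OF elim(2)])
        also have "\<dots> \<le> (\<Sum>c\<in>{c\<in>grid (Suc k). \<omega> \<in> H k c}. liminf (\<lambda>m. mass m (ball c (r k)) \<omega> * indicator (H k c) \<omega>))"
          using elim(1) by (intro sum_mono) auto
        also have "\<dots> \<le> f k \<omega>" unfolding f_def by (intro sum_mono2) auto
        finally show ?thesis .
      qed
      show "\<Omega> \<inter> Delta ((1/2) ^ n) 1 (Y \<omega>) \<subseteq> V k" for k
      proof
        fix x assume x: "x \<in> \<Omega> \<inter> Delta ((1/2) ^ n) 1 (Y \<omega>)"
        then obtain L where L: "L \<in> Y \<omega>" "x \<in> L" "(1/2) ^ n \<le> diameter L" "diameter L < 1" unfolding Delta_def by blast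
        obtain c where c: "c \<in> grid (Suc k)" "x \<in> cball c ((1/2) ^ Suc k)" using x Omega_grid by blast
        have "(1/2 :: real) ^ Suc k < (1/2) ^ k" by simp
        hence xb: "x \<in> ball c (r k)" using c(2) unfolding r_def by (simp only: mem_cball mem_ball)
        hence "x \<in> cball c (r k)" by simp
        hence "L \<in> hit_sets (cball c (r k)) ((1/2) ^ n) 1 \<inter> Y \<omega>"
          using L Y_sub[OF elim(2)] unfolding hit_sets_def by blast
        thus "x \<in> V k" using c(1) xb elim(2) unfolding V_def H_def by blast
      qed
    qed
  qed
qed

lemma AE_mu_inf_in_cutset: "AE \<omega> in P. AE x in mu_inf \<omega>. x \<in> cutset \<omega>"
proof -
  have "AE \<omega> in P. \<forall>n. AE x in mu_inf \<omega>. x \<notin> \<Omega> \<inter> Delta ((1/2) ^ n) 1 (Y \<omega>)"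
    unfolding AE_all_countable by (intro allI AE_mu_inf_not_in_Delta)
  with AE_mu_inf_in_Omega show ?thesis
  proof eventually_elim
    case (elim \<omega>)
    from elim(2) have "AE x in mu_inf \<omega>. \<forall>n. x \<notin> \<Omega> \<inter> Delta ((1/2) ^ n) 1 (Y \<omega>)"
      unfolding AE_all_countable .
    with elim(1) show ?case
      by eventually_elim (auto simp: cutset_def two_powr_eq_half_power)
  qed
qed

text \<open>There are about \<open>2^(j d)\<close> grid balls of radius comparable to
  \<open>2^-j\<close>, each with second moment of order \<open>2^(-j d) * 2^(-j D)\<close>. Dividing
  by the threshold, of order \<open>2^(-j s)\<close>, bounds the expected mass of all heavy balls by
  a constant times \<open>2^(-j (D - s))\<close>, which is summable.\<close>

lemma AE_measure_cball_le:
  assumes s: "s < real DIM('a) - \<alpha>"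
  shows "AE \<omega> in P. AE x in mu_inf \<omega>. \<forall>\<^sub>F k in sequentially. measure (mu_inf \<omega>) (cball x ((1/2) ^ k)) \<le> ((1/2) ^ k) powr s"
proof -
  define D where "D = real DIM('a) - \<alpha>"
  define \<rho> where "\<rho> = (1/2 :: real) powr (D - s)"
  have \<rho>: "0 \<le> \<rho>" "\<rho> < 1" using s by (auto simp: \<rho>_def D_def powr_less_one powr01_less_one)
  obtain C where C: "C \<ge> 1" "\<And>k. real (card (grid k)) \<le> C * 2 ^ (k * DIM('a))" using grid by blast
  define \<tau> where "\<tau> j = ((1/2 :: real) ^ (j + 3)) powr s" for j
  \<comment> \<open>Every \<open>x\<close> in Omega is within \<open>2^-(j+3)\<close> of a grid
    centre, so its ball of that radius reaches at most \<open>2^-(j+2)\<close> from the centre and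
    lies inside the open ball \<open>W\<close>. The threshold \<open>\<tau> j\<close> is the bound
    wanted at radius \<open>2^-(j+3)\<close>.\<close>
  define W where "W j c = ball (c :: 'a) ((1/2) ^ Suc j)" for j c
  define K where "K = unit_ball_vol (real DIM('a)) * kernel_const"
  have K: "K \<ge> 0" using kernel_const_nonneg by (simp add: K_def)
  have \<tau>: "\<tau> j > 0" for j by (simp add: \<tau>_def)
  define g where "g j c \<omega> = liminf (\<lambda>m. ennreal (1 / \<tau> j) * (mass m (W j c) \<omega>)\<^sup>2)" for j c \<omega>
  define f where "f j \<omega> = (\<Sum>c\<in>grid (j + 3). g j c \<omega>)" for j \<omega>
  have Wb: "W j c \<in> sets borel" for j c by (simp add: W_def)
  have sqm: "(\<lambda>\<omega>. ennreal (1 / \<tau> j) * (mass m (W j c) \<omega>)\<^sup>2) \<in> borel_measurable P" for j c m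
    unfolding power2_eq_square by (intro borel_measurable_times_ennreal borel_measurable_const mass_measurable Wb)
  have gm: "g j c \<in> borel_measurable P" for j c unfolding g_def[abs_def] by (intro borel_measurable_liminf sqm)
  have g_le: "(\<integral>\<^sup>+\<omega>. g j c \<omega> \<partial>P) \<le> ennreal (1 / \<tau> j * (K * (1/2) ^ (j * DIM('a)) * ((1/2) ^ j) powr D))" for j c
  proof -
    let ?B = "ennreal (1 / \<tau> j) * ennreal (K * (1/2) ^ (j * DIM('a)) * ((1/2) ^ j) powr D)"
    have "(\<integral>\<^sup>+\<omega>. g j c \<omega> \<partial>P) \<le> liminf (\<lambda>m. \<integral>\<^sup>+\<omega>. ennreal (1 / \<tau> j) * (mass m (W j c) \<omega>)\<^sup>2 \<partial>P)"
      unfolding g_def by (intro nn_integral_liminf sqm)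
    also have "\<dots> \<le> Liminf sequentially (\<lambda>m. ?B)"
    proof (intro Liminf_mono always_eventually allI)
      fix m
      have "(\<integral>\<^sup>+\<omega>. (mass m (W j c) \<omega>)\<^sup>2 \<partial>P) \<le> (\<integral>\<^sup>+\<omega>. (mass m (cball c ((1/2) ^ Suc j)) \<omega>)\<^sup>2 \<partial>P)"
        unfolding mass_def W_def
        by (intro nn_integral_mono power_mono mult_left_mono emeasure_mono sets.Int) (auto simp: open_vacant)
      also have "\<dots> \<le> ennreal (K * (1/2) ^ (j * DIM('a)) * ((1/2) ^ j) powr D)"
        unfolding K_def D_def by (rule mass_sq_ball)
      finally have "ennreal (1 / \<tau> j) * (\<integral>\<^sup>+\<omega>. (mass m (W j c) \<omega>)\<^sup>2 \<partial>P) \<le> ?B" by (rule mult_left_mono) simp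
      thus "(\<integral>\<^sup>+\<omega>. ennreal (1 / \<tau> j) * (mass m (W j c) \<omega>)\<^sup>2 \<partial>P) \<le> ?B"
        using Wb by (subst nn_integral_cmult) auto
    qed
    also have "\<dots> = ?B" by (simp add: Liminf_const)
    also have "?B = ennreal (1 / \<tau> j * (K * (1/2) ^ (j * DIM('a)) * ((1/2) ^ j) powr D))"
      using \<tau>[of j] K by (intro ennreal_mult[symmetric]) auto
    finally show ?thesis .
  qed
  have "AE \<omega> in P. (\<Sum>j. f j \<omega>) < \<infinity>"
  proof (rule AE_suminf_finite[OF _ _ _ \<rho>])
    show "f j \<in> borel_measurable P" for j unfolding f_def[abs_def] using gm by measurable
    show "0 \<le> C * 2 ^ (3 * DIM('a)) * K * 8 powr s" using C K by simp
    show "(\<integral>\<^sup>+\<omega>. f j \<omega> \<partial>P) \<le> ennreal (C * 2 ^ (3 * DIM('a)) * K * 8 powr s * \<rho> ^ j)" for j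
    proof -
      let ?b = "1 / \<tau> j * (K * (1/2) ^ (j * DIM('a)) * ((1/2) ^ j) powr D)"
      have b0: "?b \<ge> 0" using \<tau>[of j] K by simp
      have "(\<integral>\<^sup>+\<omega>. f j \<omega> \<partial>P) = (\<Sum>c\<in>grid (j + 3). \<integral>\<^sup>+\<omega>. g j c \<omega> \<partial>P)"
        unfolding f_def using gm by (intro nn_integral_sum) auto
      also have "\<dots> \<le> (\<Sum>c\<in>grid (j + 3). ennreal ?b)" by (intro sum_mono g_le)
      also have "\<dots> = ennreal (real (card (grid (j + 3))) * ?b)"
        by (simp only: sum_constant ennreal_of_nat_eq_real_of_nat ennreal_mult[OF of_nat_0_le_iff b0])
      also have "\<dots> \<le> ennreal ((C * 2 ^ ((j + 3) * DIM('a))) * ?b)"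
        by (intro ennreal_leI mult_right_mono C b0)
      also have "(C * 2 ^ ((j + 3) * DIM('a))) * ?b = C * 2 ^ (3 * DIM('a)) * K * 8 powr s * \<rho> ^ j"
      proof -
        have 1: "1 / \<tau> j = 8 powr s * ((1/2) ^ j) powr (- s)"
        proof -
          have "\<tau> j = ((1/2) ^ j) powr s * (1 / 8) powr s"
          proof -
            have "(1/2 :: real) ^ (j + 3) = (1/2) ^ j * (1 / 8)" by (simp add: power_add power3_eq_cube)
            thus ?thesis unfolding \<tau>_def by (simp only: powr_mult)
          qed
          also have "(1 / 8 :: real) powr s = 1 / 8 powr s" by (simp add: powr_divide)
          finally have t: "\<tau> j = ((1/2) ^ j) powr s * (1 / 8 powr s)" .
          have "1 / (x * (1 / e)) = e * inverse x" for x e :: real by (simp add: inverse_eq_divide)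
          thus ?thesis unfolding t powr_minus .
        qed
        have 2: "\<rho> ^ j = ((1/2) ^ j) powr (- s) * ((1/2) ^ j) powr D"
        proof -
          have "\<rho> ^ j = ((1/2) ^ j) powr (D - s)"
            by (simp add: \<rho>_def powr_power powr_realpow[symmetric] powr_powr mult.commute)
          also have "\<dots> = ((1/2) ^ j) powr (- s) * ((1/2) ^ j) powr D" by (simp flip: powr_add)
          finally show ?thesis .
        qed
        have 3: "(2::real) ^ ((j + 3) * DIM('a)) * (1/2) ^ (j * DIM('a)) = 2 ^ (3 * DIM('a))"
          by (simp add: add_mult_distrib power_add power_one_over)
        have "(C * 2 ^ ((j + 3) * DIM('a))) * ?b =
            C * (2 ^ ((j + 3) * DIM('a)) * (1/2) ^ (j * DIM('a))) * K * 8 powr s * (((1/2) ^ j) powr (- s) * ((1/2) ^ j) powr D)"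
          unfolding 1 by (simp only: mult_ac)
        thus ?thesis by (simp only: 2[symmetric] 3)
      qed
      finally show ?thesis .
    qed
  qed
  with AE_mu_inf AE_space AE_mu_inf_in_Omega show ?thesis
  proof eventually_elim
    case (elim \<omega>)
    interpret mu: finite_measure "mu_inf \<omega>" by (rule mu_finite[OF elim(2)])
    note sets_mu = mu_sets[OF elim(2)]
    define B where "B j = (\<Union>c\<in>{c\<in>grid (j + 3). ennreal (\<tau> j) < emeasure (mu_inf \<omega>) (W j c)}. W j c)" for j
    have B: "B j \<in> sets (mu_inf \<omega>)" for j unfolding B_def using Wb by (intro sets.finite_UN) (auto simp: sets_mu)
    have le: "emeasure (mu_inf \<omega>) (B j) \<le> f j \<omega>" for j
    proof -
      have "emeasure (mu_inf \<omega>) (B j) \<le> (\<Sum>c\<in>{c\<in>grid (j + 3). ennreal (\<tau> j) < emeasure (mu_inf \<omega>) (W j c)}. emeasure (mu_inf \<omega>) (W j c))"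
        unfolding B_def using Wb by (intro emeasure_subadditive_finite) (auto simp: sets_mu)
      also have "\<dots> \<le> (\<Sum>c\<in>{c\<in>grid (j + 3). ennreal (\<tau> j) < emeasure (mu_inf \<omega>) (W j c)}. g j c \<omega>)"
        unfolding g_def using elim(1) \<tau> by (intro sum_mono le_liminf_square) (auto simp: W_def)
      also have "\<dots> \<le> f j \<omega>" unfolding f_def by (intro sum_mono2) auto
      finally show ?thesis .
    qed
    have "(\<Sum>j. emeasure (mu_inf \<omega>) (B j)) \<le> (\<Sum>j. f j \<omega>)" by (intro suminf_le le) auto
    hence "(\<Sum>j. ennreal (measure (mu_inf \<omega>) (B j))) \<noteq> top"
      using elim(4) by (auto simp: mu.emeasure_eq_measure[symmetric] top_unique)
    hence "summable (\<lambda>j. measure (mu_inf \<omega>) (B j))" by (intro summable_suminf_not_top) auto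
    \<comment> \<open>Borel-Cantelli for the measure \<open>mu_inf \<omega>\<close> itself, with
      \<open>\<omega>\<close> fixed.\<close>
    hence "AE x in mu_inf \<omega>. \<forall>\<^sub>F j in sequentially. x \<in> space (mu_inf \<omega>) - B j"
      using B by (intro borel_cantelli_AE1) (auto simp: mu.emeasure_eq_measure)
    with elim(3) show ?case
    proof eventually_elim
      case (elim x)
      note x = elim(1)
      from elim(2) have "\<forall>\<^sub>F j in sequentially. measure (mu_inf \<omega>) (cball x ((1/2) ^ (j + 3))) \<le> ((1/2) ^ (j + 3)) powr s"
      proof eventually_elim
        case (elim j)
        obtain c where c: "c \<in> grid (j + 3)" "x \<in> cball c ((1/2) ^ (j + 3))" using x Omega_grid by blast
        have sub: "cball x ((1/2) ^ (j + 3)) \<subseteq> W j c"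
        proof
          fix y assume "y \<in> cball x ((1/2) ^ (j + 3))"
          moreover have "(1/2 :: real) ^ (j + 3) + (1/2) ^ (j + 3) < (1/2) ^ Suc j" by (simp add: power_add power3_eq_cube)
          ultimately show "y \<in> W j c"
            using c(2) dist_triangle[of c y x] unfolding W_def mem_cball mem_ball by linarith
        qed
        have "x \<in> W j c" using sub by auto
        hence "\<not> ennreal (\<tau> j) < emeasure (mu_inf \<omega>) (W j c)" using elim c(1) unfolding B_def by blast
        hence "measure (mu_inf \<omega>) (W j c) \<le> \<tau> j"
          using \<tau>[of j] by (simp add: mu.emeasure_eq_measure not_less)
        moreover have "measure (mu_inf \<omega>) (cball x ((1/2) ^ (j + 3))) \<le> measure (mu_inf \<omega>) (W j c)"
          using sub Wb by (intro mu.finite_measure_mono) (auto simp: sets_mu)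
        ultimately show ?case unfolding \<tau>_def by linarith
      qed
      \<comment> \<open>Removes the shift by 3 between the index of the balls and the scale of the
        radius.\<close>
      thus ?case by (rule eventually_sequentially_seg[THEN iffD1])
    qed
  qed
qed

lemma AE_dimension:
  "AE \<omega> in P. mu_inf \<omega> \<noteq> null_measure (mu_inf \<omega>) \<longrightarrow>
     (AE x in mu_inf \<omega>. x \<in> closure (cutset \<omega>) \<longrightarrow> local_dim_eq (mu_inf \<omega>) x (real DIM('a) - \<alpha>)) \<and>
     hausdorff_dim (closure (cutset \<omega>)) = real DIM('a) - \<alpha> \<and>
     upper_box_dim (closure (cutset \<omega>)) = ereal (real DIM('a) - \<alpha>)"
proof -
  define D where "D = real DIM('a) - \<alpha>"
  have D: "D > 0" using alpha_lt by (simp add: D_def)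
  have ex: "\<exists>j. 1 / real (Suc j) < e" if "e > 0" for e :: real
    using reals_Archimedean[OF that] by (simp add: inverse_eq_divide)
  \<comment> \<open>Almost sure statements commute only with countable quantifiers, so exponents are
    first taken from a sequence approaching \<open>D\<close>; monotonicity of powers fills in the
    others.\<close>
  have "AE \<omega> in P. \<forall>j. AE x in mu_inf \<omega>. \<forall>\<^sub>F k in sequentially.
      measure (mu_inf \<omega>) (cball x ((1/2) ^ k)) \<le> ((1/2) ^ k) powr (D - 1 / Suc j)"
    unfolding AE_all_countable D_def by (intro allI AE_measure_cball_le) simp
  with AE_mu_inf_in_cutset AE_upper_box_dim_le AE_space show ?thesis
    unfolding D_def[symmetric]
  proof eventually_elim
    case (elim \<omega>)
    let ?A = "closure (cutset \<omega>)" and ?\<mu> = "mu_inf \<omega>"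
    note mu = mu_sets[OF elim(3)] mu_finite[OF elim(3)]
    have inA: "AE x in ?\<mu>. x \<in> ?A" using elim(1) by eventually_elim (use closure_subset in blast)
    have up: "AE x in ?\<mu>. \<forall>s<D. \<forall>\<^sub>F k in sequentially. measure ?\<mu> (cball x ((1/2) ^ k)) \<le> ((1/2) ^ k) powr s"
    proof -
      from elim(4) have "AE x in ?\<mu>. \<forall>j. \<forall>\<^sub>F k in sequentially. measure ?\<mu> (cball x ((1/2) ^ k)) \<le> ((1/2) ^ k) powr (D - 1 / Suc j)"
        unfolding AE_all_countable .
      thus ?thesis
      proof eventually_elim
        case (elim x)
        show ?case
        proof (intro allI impI)
          fix s assume "s < D"
          then obtain j where j: "1 / real (Suc j) < D - s" using ex[of "D - s"] by auto
          have le: "((1/2 :: real) ^ k) powr (D - 1 / Suc j) \<le> ((1/2) ^ k) powr s" for k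
            using j by (intro powr_mono') (auto simp: power_le_one)
          show "\<forall>\<^sub>F k in sequentially. measure ?\<mu> (cball x ((1/2) ^ k)) \<le> ((1/2) ^ k) powr s"
            by (rule eventually_mono[OF elim[rule_format, of j]]) (rule order_trans[OF _ le])
        qed
      qed
    qed
    have low: "AE x in ?\<mu>. \<forall>s>D. \<forall>\<^sub>F k in sequentially. ((1/2) ^ k) powr s \<le> measure ?\<mu> (cball x ((1/2) ^ k))"
    proof -
      have "AE x in ?\<mu>. \<forall>j. \<forall>\<^sub>F k in sequentially. ((1/2) ^ k) powr (D + 1 / Suc j) \<le> measure ?\<mu> (cball x ((1/2) ^ k))"
        unfolding AE_all_countable using elim(2)
        by (intro allI AE_measure_cball_ge[OF mu bounded_closure_cutset inA] order_le_less_trans[OF elim(2)]) simp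
      thus ?thesis
      proof eventually_elim
        case (elim x)
        show ?case
        proof (intro allI impI)
          fix s assume "D < s"
          then obtain j where j: "1 / real (Suc j) < s - D" using ex[of "s - D"] by auto
          have le: "((1/2 :: real) ^ k) powr s \<le> ((1/2) ^ k) powr (D + 1 / Suc j)" for k
            using j by (intro powr_mono') (auto simp: power_le_one)
          show "\<forall>\<^sub>F k in sequentially. ((1/2) ^ k) powr s \<le> measure ?\<mu> (cball x ((1/2) ^ k))"
            by (rule eventually_mono[OF elim[rule_format, of j]]) (rule order_trans[OF le])
        qed
      qed
    qed
    show ?case
    proof
      assume nonnull: "?\<mu> \<noteq> null_measure ?\<mu>"
      have "AE x in ?\<mu>. x \<in> ?A \<longrightarrow> local_dim_eq ?\<mu> x D"
        using up low by eventually_elim (intro impI local_dim_eqI[OF mu D], auto)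
      \<comment> \<open>Otherwise the mass distribution principle would force the limit measure to
        vanish.\<close>
      moreover have "hausdorff_measure s ?A \<noteq> 0" if s: "0 < s" "s < D" for s
      proof
        assume "hausdorff_measure s ?A = 0"
        moreover have "AE x in ?\<mu>. \<forall>\<^sub>F k in sequentially. measure ?\<mu> (cball x ((1/2) ^ k)) \<le> ((1/2) ^ k) powr s"
          using up by eventually_elim (use s in blast)
        ultimately have "?\<mu> = null_measure ?\<mu>" using mass_distribution[OF mu s(1) inA] by blast
        thus False using nonnull by blast
      qed
      ultimately show "(AE x in ?\<mu>. x \<in> ?A \<longrightarrow> local_dim_eq ?\<mu> x D) \<and> hausdorff_dim ?A = D \<and> upper_box_dim ?A = ereal D"
        using hausdorff_upper_box_dim_eq[OF bounded_closure_cutset D elim(2)] by blast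
    qed
  qed
qed

end

text \<open>The set of \<open>\<omega>\<close> with a nonzero limit is not assumed to be an event.
  Positive probability is therefore expressed as the failure of almost sure nullity, and
  conditioning as an implication under the almost sure quantifier.\<close>

theorem theorem5p7:
  fixes \<Omega> :: "'a::euclidean_space set"
    and Q :: "'a set measure"
    and P :: "'p measure"
    and Y :: "'p \<Rightarrow> 'a set set"
    and \<alpha> :: real
    and mu_inf :: "'p \<Rightarrow> 'a measure"
  assumes Omega_bounded: "bounded \<Omega>"
    and Omega_meas: "\<Omega> \<in> sets lebesgue"
    and Omega_pos: "emeasure lebesgue \<Omega> > 0"
    and Q_space: "space Q = compact_sets"
    and Q_sets: "sets Q = sets hausdorff_borel"
    and Q_sigma_finite: "sigma_finite_measure Q"
    and Q_infinite: "emeasure Q (space Q) = \<infinity>"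
    and M1: "\<And>S t. S \<in> sets Q \<Longrightarrow>
               emeasure Q S = emeasure Q ((\<lambda>L. (\<lambda>x. x + t) ` L) ` S)"
    and M2: "\<And>S s. S \<in> sets Q \<Longrightarrow> s > 0 \<Longrightarrow>
               emeasure Q S = emeasure Q ((\<lambda>L. (\<lambda>x. s *\<^sub>R x) ` L) ` S)"
    and M3: "emeasure Q {L \<in> space Q. diameter L > 1 \<and> L \<subseteq> cbox (- One) One} < \<infinity>"
    and M4: "AE L in Q. emeasure lborel (frontier L) = 0"
    and PPP: "poisson_point_process P Y Q"
    and alpha_def: "2 powr (- \<alpha>) = measure P {\<omega> \<in> space P. 0 \<notin> Delta (1/2) 1 (Y \<omega>)}"
    and alpha_nonneg: "0 \<le> \<alpha>"
    and alpha_lt: "\<alpha> < real DIM('a)"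
    and mu_borel: "\<And>\<omega>. \<omega> \<in> space P \<Longrightarrow> sets (mu_inf \<omega>) = sets borel \<and> finite_measure (mu_inf \<omega>)"
    and mu_limit: "AE \<omega> in P. weak_conv_measures
               (\<lambda>n. density lebesgue (\<lambda>x. ennreal (2 powr (real n * \<alpha>)) *
                   indicator (\<Omega> - Delta (2 powr (- real n)) 1 (Y \<omega>)) x))
               (mu_inf \<omega>)"
  defines "A \<equiv> \<lambda>\<omega>. closure (\<Inter>n. \<Omega> - Delta (2 powr (- real n)) 1 (Y \<omega>))"
  shows "(AE \<omega> in P. upper_box_dim (A \<omega>) \<le> ereal (real DIM('a) - \<alpha>))
         \<and> \<not> (AE \<omega> in P. mu_inf \<omega> = null_measure (mu_inf \<omega>))
         \<and> (AE \<omega> in P. mu_inf \<omega> \<noteq> null_measure (mu_inf \<omega>) \<longrightarrow>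
               (AE x in mu_inf \<omega>. x \<in> A \<omega> \<longrightarrow> local_dim_eq (mu_inf \<omega>) x (real DIM('a) - \<alpha>))
             \<and> hausdorff_dim (A \<omega>) = real DIM('a) - \<alpha>
             \<and> upper_box_dim (A \<omega>) = ereal (real DIM('a) - \<alpha>))"
proof -
  interpret cutout Q P Y \<alpha> \<Omega> mu_inf
    by (intro cutout.intro poisson_cutout.intro invariant_measure.intro poisson_cutout_axioms.intro cutout_axioms.intro)
      (fact assms)+
  have A: "A = (\<lambda>\<omega>. closure (cutset \<omega>))" by (simp add: A_def cutset_def)
  show ?thesis
    unfolding A using AE_upper_box_dim_le not_AE_mu_inf_null AE_dimension by blast
qed

end
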